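(* Let $(\Sigma,m)$ be a weighted simplicial complex. If for all $\rho\in\Sigma$ all connected components of the graph $b_\rho$ over $\mathrm{lk}(\rho)$ are recurrent, then for $\Delta=\delta_D\partial_N+\partial_N\delta_D$ one has $$\ell^2(\Sigma,m)=\ker\Delta\oplus\overline{\mathrm{range}(\delta_D)}\oplus\overline{\mathrm{range}(\partial_N)},$$ and for all $k\ge0$, with $\Delta_k$ the restriction of $\Delta$ to $\ell^2(\Sigma_k,m)$, $$\ker(\delta_{D,k})/\overline{\mathrm{range}(\delta_{D,k-1})}\cong\ker\Delta_k.$$
   Context: Weighted simplicial complexes. Let $X$ be a set (of vertices). A simplicial complex $\hat\Sigma$ over $X$ is a (non-empty) set of finite subsets of $X$ closed under taking subsets, whose $0$-simplices are identified with $X$; it contains $\varnothing$. A simplex with $k+1$ elements has dimension $k$. Write $\tau\prec\sigma$ (or $\sigma\succ\tau$) if $\tau\subseteq\sigma$ and $|\sigma\setminus\tau|=1$; then $\tau$ is a face of $\sigma$ and $\sigma$ a coface of $\tau$. Let $m:\hat\Sigma\to(0,\infty)$. Put $\Sigma=\hat\Sigma$ if $\sum_{x\in X}m(x)<\infty$ and $\Sigma=\hat\Sigma\setminus\{\varnothing\}$ otherwise. Assume $m$ is locally summable: $\sum_{\sigma\succ\tau}m(\sigma)<\infty$ for all $\tau\in\Sigma$. Then $(\Sigma,m)$ is called a weighted simplicial complex; no local finiteness is assumed. All simplices below range over $\Sigma$, and $\Sigma_k$ is the set of $k$-dimensional simplices in $\Sigma$ (so $\Sigma_{-1}=\{\varnothing\}$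 if $\varnothing\in\Sigma$ and $\Sigma_{-1}=\emptyset$ otherwise). $C(\Sigma)$ denotes the complex functions on $\Sigma$, $C_c(\Sigma)$ those of finite support, and $\ell^2=\ell^2(\Sigma,m)$ is the Hilbert space with inner product $\langle f,g\rangle=\sum_{\tau\in\Sigma} m(\tau)f(\tau)\overline{g(\tau)}$ and norm $\|\cdot\|_2$; $\ell^2(\Sigma_k,m)$ is the closed subspace of those functions supported on $\Sigma_k$. Coboundary and boundary. Fix a coboundary operator, i.e. a linear operator $\delta:C(\Sigma)\to C(\Sigma)$ of the form $\delta\omega(\sigma)=\sum_{\tau\prec\sigma}\theta(\tau,\sigma)\omega(\tau)$ (a finite sum) with $\theta(\tau,\sigma)=\delta 1_\tau(\sigma)\in\{\pm1\}$ for $\tau\prec\sigma$, satisfying $\delta\delta=0$. The boundary operator $\partial:D(\partial)\to C(\Sigma)$ is $$\partial\omega(\rho)=\frac1{m(\rho)}\sum_{\tau\succ\rho}m(\tau)\theta(\rho,\tau)\omega(\tau),\qquad D(\partial)=\Big\{\omega\in C(\Sigma):\sum_{\tau\succ\rho}m(\tau)|\omega(\tau)|<\infty\text{ for all }\rho\in\Sigma\Big\}.$$ One has $\ell^2\subseteq D(\partial)$. Boundary conditions. $\partial_N$ is the restriction of $\partial$ to $D(\partial_N)=\{\omega\in\ell^2:\partial\omega\in\ell^2\}$. $\delta_D$ is the restriction of $\delta$ to $D(\delta_D)=\{\omega\in\ell^2:\lim_n(\|\omega_n-\omega\|_2^2+\|\delta(\omega_n-\omega)\|_2^2)=0\text{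 for some }\omega_n\in C_c(\Sigma)\}$. Both are closed densely defined operators on $\ell^2$. $\delta_{D,k}$ is the restriction of $\delta_D$ to $D(\delta_D)\cap\ell^2(\Sigma_k,m)$. The operator $\Delta=\delta_D\partial_N+\partial_N\delta_D$ has its natural domain $\{\omega\in D(\delta_D)\cap D(\partial_N):\delta_D\omega\in D(\partial_N),\ \partial_N\omega\in D(\delta_D)\}$. The symbol $\oplus$ denotes the (orthogonal) direct sum of closed subspaces of the Hilbert space $\ell^2$, and $\cong$ denotes isomorphism of Hilbert spaces. Links. For $\rho\in\Sigma$, $\mathrm{lk}(\rho)=\{v\in X: v\cup\rho\in\Sigma,\ v\cup\rho\succ\rho\}$ (identifying the vertex $v$ with $\{v\}$), with $v\rho=v\cup\rho$ and $vv'\rho=v\cup v'\cup\rho$. The link graph is the symmetric function $b_\rho:\mathrm{lk}(\rho)\times\mathrm{lk}(\rho)\to[0,\infty)$, $b_\rho(v,v')=m(vv'\rho)$ if $v\ne v'$ and $vv'\rho\in\Sigma$, and $b_\rho(v,v')=0$ otherwise. Local summability gives $\sum_{v'}b_\rho(v,v')<\infty$ for all $v\in\mathrm{lk}(\rho)$. Connected components are the classes of vertices joined by finite paths along which $b_\rho>0$. Recurrence. A connected graph $b$ over $X$ is recurrent if the Markov chain $(Y_n)$ with transition probabilities $\mathbb P(Y_n=y\mid Y_{n-1}=x)=b(x,y)/\sum_z b(x,z)$ satisfies $\mathbb P(Y_k=y\text{ for some }k>0\mid Y_0=x)=1$ for all $x,y$; equivalently, the constant function $1$ is a pointwise limit of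 finitely supported functions $\varphi_n$ with $\frac12\sum_{x,y}b(x,y)|\varphi_n(x)-\varphi_n(y)|^2\to0$. A component consisting of a single vertex counts as recurrent. *)

theory Defs
  imports "HOL-Probability.Probability" "HOL-Library.Function_Algebras"
begin

section \<open>Weighted simplicial complexes\<close>

definition face :: "'v set \<Rightarrow> 'v set \<Rightarrow> bool" where
  "face \<tau> \<sigma> \<longleftrightarrow> \<tau> \<subseteq> \<sigma> \<and> card (\<sigma> - \<tau>) = 1"

definition simplicial_complex :: "'v set \<Rightarrow> 'v set set \<Rightarrow> bool" where
  "simplicial_complex X S \<longleftrightarrow>
     S \<noteq> {} \<and>
     (\<forall>\<sigma>\<in>S. finite \<sigma> \<and> \<sigma> \<subseteq> X) \<and>
     (\<forall>\<sigma>\<in>S. \<forall>\<tau>. \<tau> \<subseteq> \<sigma> \<longrightarrow> \<tau> \<in> S) \<and>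
     (\<forall>x\<in>X. {x} \<in> S)"

text \<open>The set \<open>\<Sigma>\<close> is the complex \<open>S\<close> with the empty simplex kept exactly when the total
  vertex weight is finite. For nonnegative weights, \<open>summable_on\<close> expresses finiteness of the sum.\<close>

definition weighted_simplicial_complex :: "'v set \<Rightarrow> 'v set set \<Rightarrow> ('v set \<Rightarrow> real) \<Rightarrow> bool" where
  "weighted_simplicial_complex X \<Sigma> m \<longleftrightarrow>
     (\<exists>S. simplicial_complex X S \<and>
          (\<forall>\<sigma>\<in>S. 0 < m \<sigma>) \<and>
          \<Sigma> = (if (\<lambda>x. m {x}) summable_on X then S else S - {{}}) \<and>
          (\<forall>\<tau>\<in>\<Sigma>. m summable_on {\<sigma>\<in>\<Sigma>. face \<tau> \<sigma>}))"

definition simplices_dim :: "'v set set \<Rightarrow> int \<Rightarrow> 'v set set" where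
  "simplices_dim \<Sigma> k = {\<sigma>\<in>\<Sigma>. int (card \<sigma>) = k + 1}"

section \<open>Cochains and the weighted Hilbert space\<close>

text \<open>Functions on \<open>\<Sigma>\<close> are represented by their extension by zero.\<close>

definition cochains :: "'v set set \<Rightarrow> ('v set \<Rightarrow> complex) set" where
  "cochains \<Sigma> = {\<omega>. \<forall>\<sigma>. \<sigma> \<notin> \<Sigma> \<longrightarrow> \<omega> \<sigma> = 0}"

definition cochains_fin :: "'v set set \<Rightarrow> ('v set \<Rightarrow> complex) set" where
  "cochains_fin \<Sigma> = {\<omega> \<in> cochains \<Sigma>. finite {\<sigma>. \<omega> \<sigma> \<noteq> 0}}"

text \<open>The squared norm takes values in \<^typ>\<open>ennreal\<close>: it is also applied to cochains outside
  of the Hilbert space, where a real-valued \<open>infsum\<close> would silently be zero.\<close>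

definition l2_norm_sq :: "'v set set \<Rightarrow> ('v set \<Rightarrow> real) \<Rightarrow> ('v set \<Rightarrow> complex) \<Rightarrow> ennreal" where
  "l2_norm_sq \<Sigma> m f = (\<Sum>\<^sub>\<infinity>\<sigma>\<in>\<Sigma>. ennreal (m \<sigma> * (cmod (f \<sigma>))\<^sup>2))"

definition l2 :: "'v set set \<Rightarrow> ('v set \<Rightarrow> real) \<Rightarrow> ('v set \<Rightarrow> complex) set" where
  "l2 \<Sigma> m = {f \<in> cochains \<Sigma>. l2_norm_sq \<Sigma> m f < \<infinity>}"

definition l2_norm :: "'v set set \<Rightarrow> ('v set \<Rightarrow> real) \<Rightarrow> ('v set \<Rightarrow> complex) \<Rightarrow> real" where
  "l2_norm \<Sigma> m f = sqrt (enn2real (l2_norm_sq \<Sigma> m f))"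

definition l2_inner ::
  "'v set set \<Rightarrow> ('v set \<Rightarrow> real) \<Rightarrow> ('v set \<Rightarrow> complex) \<Rightarrow> ('v set \<Rightarrow> complex) \<Rightarrow> complex" where
  "l2_inner \<Sigma> m f g = (\<Sum>\<^sub>\<infinity>\<sigma>\<in>\<Sigma>. complex_of_real (m \<sigma>) * f \<sigma> * cnj (g \<sigma>))"

definition l2_dim :: "'v set set \<Rightarrow> ('v set \<Rightarrow> real) \<Rightarrow> int \<Rightarrow> ('v set \<Rightarrow> complex) set" where
  "l2_dim \<Sigma> m k = {f \<in> l2 \<Sigma> m. \<forall>\<sigma>. f \<sigma> \<noteq> 0 \<longrightarrow> \<sigma> \<in> simplices_dim \<Sigma> k}"

definition l2_closure ::
  "'v set set \<Rightarrow> ('v set \<Rightarrow> real) \<Rightarrow> ('v set \<Rightarrow> complex) set \<Rightarrow> ('v set \<Rightarrow> complex) set" where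
  "l2_closure \<Sigma> m A =
     {f \<in> l2 \<Sigma> m. \<exists>u :: nat \<Rightarrow> _. (\<forall>n. u n \<in> A) \<and> (\<lambda>n. l2_norm_sq \<Sigma> m (u n - f)) \<longlonglongrightarrow> 0}"

definition closed_subspace ::
  "'v set set \<Rightarrow> ('v set \<Rightarrow> real) \<Rightarrow> ('v set \<Rightarrow> complex) set \<Rightarrow> bool" where
  "closed_subspace \<Sigma> m A \<longleftrightarrow>
     A \<subseteq> l2 \<Sigma> m \<and> 0 \<in> A \<and>
     (\<forall>f\<in>A. \<forall>g\<in>A. f + g \<in> A) \<and>
     (\<forall>c. \<forall>f\<in>A. (\<lambda>\<sigma>. c * f \<sigma>) \<in> A) \<and>
     l2_closure \<Sigma> m A \<subseteq> A"

definition l2_orthogonal ::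
  "'v set set \<Rightarrow> ('v set \<Rightarrow> real) \<Rightarrow> ('v set \<Rightarrow> complex) set \<Rightarrow> ('v set \<Rightarrow> complex) set \<Rightarrow> bool" where
  "l2_orthogonal \<Sigma> m A B \<longleftrightarrow> (\<forall>f\<in>A. \<forall>g\<in>B. l2_inner \<Sigma> m f g = 0)"

text \<open>\<open>H = A \<oplus> B \<oplus> C\<close> as an orthogonal sum of closed subspaces.\<close>

definition orthogonal_sum3 ::
  "'v set set \<Rightarrow> ('v set \<Rightarrow> real) \<Rightarrow> ('v set \<Rightarrow> complex) set \<Rightarrow>
   ('v set \<Rightarrow> complex) set \<Rightarrow> ('v set \<Rightarrow> complex) set \<Rightarrow> ('v set \<Rightarrow> complex) set \<Rightarrow> bool" where
  "orthogonal_sum3 \<Sigma> m H A B C \<longleftrightarrow>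
     closed_subspace \<Sigma> m A \<and> closed_subspace \<Sigma> m B \<and> closed_subspace \<Sigma> m C \<and>
     l2_orthogonal \<Sigma> m A B \<and> l2_orthogonal \<Sigma> m A C \<and> l2_orthogonal \<Sigma> m B C \<and>
     H = {a + b + c | a b c. a \<in> A \<and> b \<in> B \<and> c \<in> C}"

section \<open>Coboundary, boundary and Laplacian\<close>

definition incidence ::
  "(('v set \<Rightarrow> complex) \<Rightarrow> ('v set \<Rightarrow> complex)) \<Rightarrow> 'v set \<Rightarrow> 'v set \<Rightarrow> complex" where
  "incidence \<delta> \<tau> \<sigma> = \<delta> (indicator {\<tau>}) \<sigma>"

text \<open>Linearity of \<open>\<delta>\<close> on cochains is a consequence of the sum formula.\<close>

definition coboundary_operator ::
  "'v set set \<Rightarrow> (('v set \<Rightarrow> complex) \<Rightarrow> ('v set \<Rightarrow> complex)) \<Rightarrow> bool" where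
  "coboundary_operator \<Sigma> \<delta> \<longleftrightarrow>
     (\<forall>\<omega>\<in>cochains \<Sigma>. \<delta> \<omega> \<in> cochains \<Sigma>) \<and>
     (\<forall>\<omega>\<in>cochains \<Sigma>. \<forall>\<sigma>\<in>\<Sigma>. \<delta> \<omega> \<sigma> = (\<Sum>\<tau> | \<tau> \<in> \<Sigma> \<and> face \<tau> \<sigma>. incidence \<delta> \<tau> \<sigma> * \<omega> \<tau>)) \<and>
     (\<forall>\<sigma>\<in>\<Sigma>. \<forall>\<tau>\<in>\<Sigma>. face \<tau> \<sigma> \<longrightarrow> incidence \<delta> \<tau> \<sigma> \<in> {1, -1}) \<and>
     (\<forall>\<omega>\<in>cochains \<Sigma>. \<delta> (\<delta> \<omega>) = 0)"

definition boundary ::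
  "'v set set \<Rightarrow> ('v set \<Rightarrow> real) \<Rightarrow> (('v set \<Rightarrow> complex) \<Rightarrow> ('v set \<Rightarrow> complex)) \<Rightarrow>
   ('v set \<Rightarrow> complex) \<Rightarrow> ('v set \<Rightarrow> complex)" where
  "boundary \<Sigma> m \<delta> \<omega> =
     (\<lambda>\<rho>. if \<rho> \<in> \<Sigma>
          then 1 / complex_of_real (m \<rho>) *
               (\<Sum>\<^sub>\<infinity>\<tau>\<in>{\<tau>\<in>\<Sigma>. face \<rho> \<tau>}. complex_of_real (m \<tau>) * incidence \<delta> \<rho> \<tau> * \<omega> \<tau>)
          else 0)"

definition dom_boundary :: "'v set set \<Rightarrow> ('v set \<Rightarrow> real) \<Rightarrow> ('v set \<Rightarrow> complex) set" where
  "dom_boundary \<Sigma> m =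
     {\<omega> \<in> cochains \<Sigma>. \<forall>\<rho>\<in>\<Sigma>. (\<lambda>\<tau>. m \<tau> * cmod (\<omega> \<tau>)) summable_on {\<tau>\<in>\<Sigma>. face \<rho> \<tau>}}"

text \<open>The operators with boundary conditions are restrictions of \<open>boundary\<close>, \<open>\<delta>\<close>
  and \<open>laplacian\<close> to the domains below; such a restriction is given by the pair of a domain
  and an unrestricted operator.\<close>

definition dom_boundary_N ::
  "'v set set \<Rightarrow> ('v set \<Rightarrow> real) \<Rightarrow> (('v set \<Rightarrow> complex) \<Rightarrow> ('v set \<Rightarrow> complex)) \<Rightarrow>
   ('v set \<Rightarrow> complex) set" where
  "dom_boundary_N \<Sigma> m \<delta> = {\<omega> \<in> l2 \<Sigma> m \<inter> dom_boundary \<Sigma> m. boundary \<Sigma> m \<delta> \<omega> \<in> l2 \<Sigma> m}"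

definition dom_coboundary_D ::
  "'v set set \<Rightarrow> ('v set \<Rightarrow> real) \<Rightarrow> (('v set \<Rightarrow> complex) \<Rightarrow> ('v set \<Rightarrow> complex)) \<Rightarrow>
   ('v set \<Rightarrow> complex) set" where
  "dom_coboundary_D \<Sigma> m \<delta> =
     {\<omega> \<in> l2 \<Sigma> m. \<exists>u :: nat \<Rightarrow> _. (\<forall>n. u n \<in> cochains_fin \<Sigma>) \<and>
        (\<lambda>n. l2_norm_sq \<Sigma> m (u n - \<omega>) + l2_norm_sq \<Sigma> m (\<delta> (u n - \<omega>))) \<longlonglongrightarrow> 0}"

definition dom_laplacian ::
  "'v set set \<Rightarrow> ('v set \<Rightarrow> real) \<Rightarrow> (('v set \<Rightarrow> complex) \<Rightarrow> ('v set \<Rightarrow> complex)) \<Rightarrow>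
   ('v set \<Rightarrow> complex) set" where
  "dom_laplacian \<Sigma> m \<delta> =
     {\<omega> \<in> dom_coboundary_D \<Sigma> m \<delta> \<inter> dom_boundary_N \<Sigma> m \<delta>.
        \<delta> \<omega> \<in> dom_boundary_N \<Sigma> m \<delta> \<and> boundary \<Sigma> m \<delta> \<omega> \<in> dom_coboundary_D \<Sigma> m \<delta>}"

definition laplacian ::
  "'v set set \<Rightarrow> ('v set \<Rightarrow> real) \<Rightarrow> (('v set \<Rightarrow> complex) \<Rightarrow> ('v set \<Rightarrow> complex)) \<Rightarrow>
   ('v set \<Rightarrow> complex) \<Rightarrow> ('v set \<Rightarrow> complex)" where
  "laplacian \<Sigma> m \<delta> \<omega> = \<delta> (boundary \<Sigma> m \<delta> \<omega>) + boundary \<Sigma> m \<delta> (\<delta> \<omega>)"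

definition kernel_on ::
  "('v set \<Rightarrow> complex) set \<Rightarrow> (('v set \<Rightarrow> complex) \<Rightarrow> ('v set \<Rightarrow> complex)) \<Rightarrow> ('v set \<Rightarrow> complex) set" where
  "kernel_on D T = {\<omega> \<in> D. T \<omega> = 0}"

section \<open>Links and recurrence\<close>

definition link :: "'v set \<Rightarrow> 'v set set \<Rightarrow> 'v set \<Rightarrow> 'v set" where
  "link X \<Sigma> \<rho> = {v \<in> X. insert v \<rho> \<in> \<Sigma> \<and> face \<rho> (insert v \<rho>)}"

definition link_graph :: "'v set set \<Rightarrow> ('v set \<Rightarrow> real) \<Rightarrow> 'v set \<Rightarrow> 'v \<Rightarrow> 'v \<Rightarrow> real" where
  "link_graph \<Sigma> m \<rho> v v' =
     (if v \<noteq> v' \<and> insert v (insert v' \<rho>) \<in> \<Sigma> then m (insert v (insert v' \<rho>)) else 0)"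

definition graph_components :: "'v set \<Rightarrow> ('v \<Rightarrow> 'v \<Rightarrow> real) \<Rightarrow> 'v set set" where
  "graph_components V b = V // {(x, y). x \<in> V \<and> y \<in> V \<and> 0 < b x y}\<^sup>*"

text \<open>\<open>M\<close> is the law, on the path space over \<open>C\<close>, of a Markov chain started at \<open>x\<close>
  with transition probabilities \<open>p\<close>; the chain itself is the coordinate process
  \<open>Y\<^sub>n w = w n\<close>. The Markov property is stated in multiplied form, so that paths of
  probability zero need no special treatment.\<close>

definition markov_chain_law ::
  "'v set \<Rightarrow> ('v \<Rightarrow> 'v \<Rightarrow> real) \<Rightarrow> 'v \<Rightarrow> (nat \<Rightarrow> 'v) measure \<Rightarrow> bool" where
  "markov_chain_law C p x M \<longleftrightarrow>
     prob_space M \<and>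
     sets M = sets (Pi\<^sub>M UNIV (\<lambda>_. count_space C)) \<and>
     measure M {w \<in> space M. w 0 = x} = 1 \<and>
     (\<forall>n. \<forall>a. (\<forall>i. a i \<in> C) \<longrightarrow>
        measure M {w \<in> space M. \<forall>i\<le>Suc n. w i = a i} =
        measure M {w \<in> space M. \<forall>i\<le>n. w i = a i} * p (a n) (a (Suc n)))"

definition transition_prob :: "'v set \<Rightarrow> ('v \<Rightarrow> 'v \<Rightarrow> real) \<Rightarrow> 'v \<Rightarrow> 'v \<Rightarrow> real" where
  "transition_prob C b x y = b x y / (\<Sum>\<^sub>\<infinity>z\<in>C. b x z)"

text \<open>Recurrence of a connected graph \<open>b\<close> over \<open>C\<close>. Such a graph with summable edge weights
  at every vertex has countably many vertices, so its Markov chain law exists and is unique;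
  the existential quantifier just names it.\<close>

definition recurrent_graph :: "'v set \<Rightarrow> ('v \<Rightarrow> 'v \<Rightarrow> real) \<Rightarrow> bool" where
  "recurrent_graph C b \<longleftrightarrow>
     (\<exists>v. C = {v}) \<or>
     (\<forall>x\<in>C. \<forall>y\<in>C. \<exists>M. markov_chain_law C (transition_prob C b) x M \<and>
        measure M {w \<in> space M. \<exists>k>0. w k = y} = 1)"

section \<open>Isomorphism of Hilbert spaces and quotients\<close>

record 'x ip_space =
  ip_carrier :: "'x set"
  ip_add :: "'x \<Rightarrow> 'x \<Rightarrow> 'x"
  ip_scale :: "complex \<Rightarrow> 'x \<Rightarrow> 'x"
  ip_inner :: "'x \<Rightarrow> 'x \<Rightarrow> complex"

definition ip_isomorphic :: "'x ip_space \<Rightarrow> 'y ip_space \<Rightarrow> bool" where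
  "ip_isomorphic G H \<longleftrightarrow>
     (\<exists>\<phi>. bij_betw \<phi> (ip_carrier G) (ip_carrier H) \<and>
       (\<forall>f\<in>ip_carrier G. \<forall>g\<in>ip_carrier G. \<phi> (ip_add G f g) = ip_add H (\<phi> f) (\<phi> g)) \<and>
       (\<forall>c. \<forall>f\<in>ip_carrier G. \<phi> (ip_scale G c f) = ip_scale H c (\<phi> f)) \<and>
       (\<forall>f\<in>ip_carrier G. \<forall>g\<in>ip_carrier G. ip_inner H (\<phi> f) (\<phi> g) = ip_inner G f g))"

definition l2_subspace ::
  "'v set set \<Rightarrow> ('v set \<Rightarrow> real) \<Rightarrow> ('v set \<Rightarrow> complex) set \<Rightarrow> ('v set \<Rightarrow> complex) ip_space" where
  "l2_subspace \<Sigma> m A =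
     \<lparr> ip_carrier = A, ip_add = (\<lambda>f g. f + g), ip_scale = (\<lambda>c f \<sigma>. c * f \<sigma>),
       ip_inner = l2_inner \<Sigma> m \<rparr>"

definition quotient_norm ::
  "'v set set \<Rightarrow> ('v set \<Rightarrow> real) \<Rightarrow> ('v set \<Rightarrow> complex) set \<Rightarrow> real" where
  "quotient_norm \<Sigma> m U = (INF u\<in>U. l2_norm \<Sigma> m u)"

definition coset_add ::
  "('v set \<Rightarrow> complex) set \<Rightarrow> ('v set \<Rightarrow> complex) set \<Rightarrow> ('v set \<Rightarrow> complex) set" where
  "coset_add U V = {u + v | u v. u \<in> U \<and> v \<in> V}"

text \<open>The summand \<open>r\<close> matters for \<open>c = 0\<close>, where the result has to be the coset \<open>R\<close>.\<close>

definition coset_scale ::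
  "('v set \<Rightarrow> complex) set \<Rightarrow> complex \<Rightarrow> ('v set \<Rightarrow> complex) set \<Rightarrow> ('v set \<Rightarrow> complex) set" where
  "coset_scale R c U = {(\<lambda>\<sigma>. c * u \<sigma>) + r | u r. u \<in> U \<and> r \<in> R}"

text \<open>The quotient of \<open>A\<close> by a closed subspace \<open>R\<close> carries the quotient norm; its inner
  product (linear in the first argument) is recovered from that norm by polarization.\<close>

definition l2_quotient ::
  "'v set set \<Rightarrow> ('v set \<Rightarrow> real) \<Rightarrow> ('v set \<Rightarrow> complex) set \<Rightarrow> ('v set \<Rightarrow> complex) set \<Rightarrow>
   ('v set \<Rightarrow> complex) set ip_space" where
  "l2_quotient \<Sigma> m A R =
     \<lparr> ip_carrier = (\<lambda>f. {f + r | r. r \<in> R}) ` A,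
       ip_add = coset_add,
       ip_scale = coset_scale R,
       ip_inner = (\<lambda>U V. (\<Sum>j<(4::nat). \<i> ^ j *
         complex_of_real ((quotient_norm \<Sigma> m (coset_add U (coset_scale R (\<i> ^ j) V)))\<^sup>2)) / 4) \<rparr>"

text \<open>\<open>A / R \<cong> B\<close> as Hilbert spaces, including that the quotient makes sense: \<open>R \<subseteq> A\<close>, and all
  three are closed subspaces of the ambient Hilbert space.\<close>

definition quotient_isomorphic ::
  "'v set set \<Rightarrow> ('v set \<Rightarrow> real) \<Rightarrow>
   ('v set \<Rightarrow> complex) set \<Rightarrow> ('v set \<Rightarrow> complex) set \<Rightarrow> ('v set \<Rightarrow> complex) set \<Rightarrow> bool" where
  "quotient_isomorphic \<Sigma> m A R B \<longleftrightarrow>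
     closed_subspace \<Sigma> m A \<and> closed_subspace \<Sigma> m R \<and> closed_subspace \<Sigma> m B \<and> R \<subseteq> A \<and>
     ip_isomorphic (l2_quotient \<Sigma> m A R) (l2_subspace \<Sigma> m B)"

end

theory Submission
  imports Defs
begin

text \<open>Write \<open>\<delta>_D\<close> and \<open>\<partial>_N\<close> for the coboundary and boundary operators with the domains \<open>D\<close> and \<open>N\<close>.
Testing against finitely supported cochains shows that \<open>\<partial>_N\<close> is the Hilbert space adjoint of
\<open>\<delta>_D\<close>; since \<open>\<delta>_D\<close> is closed, it is in turn the adjoint of \<open>\<partial>_N\<close>. Hence
\<open>ker \<partial>_N = range(\<delta>_D)\<^sup>\<bottom>\<close> and \<open>ker \<delta>_D = range(\<partial>_N)\<^sup>\<bottom>\<close> (lemmas \<open>kernel_bd_eq_ortho\<close> and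
\<open>kernel_\<delta>_eq_ortho\<close>), and \<open>ker \<Delta> = ker \<delta>_D \<inter> ker \<partial>_N\<close> because
\<open>\<langle>\<Delta>\<omega>, \<omega>\<rangle> = \<parallel>\<partial>\<omega>\<parallel>\<^sup>2 + \<parallel>\<delta>\<omega>\<parallel>\<^sup>2\<close>. So the kernel of \<open>\<Delta>\<close> is always the common orthogonal complement of the
two ranges, and the decomposition holds as soon as these ranges are orthogonal to each other, that
is, as soon as \<open>\<partial>\<partial>\<eta> = 0\<close> for all \<open>\<eta> \<in> N\<close>. The obstacle is the lack of local finiteness:
interchanging the two summations in \<open>\<partial>\<partial>\<eta>\<close> is not justified in general, and this is where
recurrence of the links is used.

Let \<open>\<eta> \<in> N\<close> and \<open>\<rho> \<in> \<Sigma>\<close>. Up to the factor \<open>m(\<rho>)\<close>, the value \<open>\<partial>\<partial>\<eta>(\<rho>)\<close> is an absolutely convergent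
sum over the vertices \<open>v\<close> of the link of \<open>\<rho>\<close>, and it vanishes because its part over each connected
component \<open>C\<close> of the link graph does (lemma \<open>component_sum_zero\<close>). For such a component, take
finitely supported functions \<open>\<phi>_n\<close> on \<open>C\<close> that tend to \<open>1\<close> pointwise, with \<open>0 \<le> \<phi>_n \<le> 1\<close> and energy
tending to \<open>0\<close>, and spread them to the cochains \<open>\<omega>_n\<close> with value \<open>\<theta>(\<rho>,v\<rho>) \<phi>_n(v)\<close> at \<open>v\<rho>\<close>. The relation
\<open>\<delta>\<delta> = 0\<close> makes the two contributions to \<open>\<delta>\<omega>_n\<close> at a simplex \<open>vv'\<rho>\<close> have opposite signs, so
\<open>\<parallel>\<delta>\<omega>_n\<parallel>\<^sup>2\<close> is the energy of \<open>\<phi>_n\<close> on the link graph. Therefore \<open>\<langle>\<omega>_n, \<partial>\<eta>\<rangle> = \<langle>\<delta>\<omega>_n, \<eta>\<rangle>\<close> tends to \<open>0\<close>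
by the Cauchy-Schwarz inequality, and to the sum over \<open>C\<close> by dominated convergence.

The functions \<open>\<phi>_n\<close> come from the Markov chain: \<open>\<phi>_n(v)\<close> is the probability that the chain started
at \<open>v\<close> reaches a fixed base vertex within \<open>n\<close> steps without leaving a finite set \<open>K_n\<close>, where
the sets \<open>K_n\<close> exhaust \<open>C\<close>. Allowing one more step only increases this probability, so \<open>\<phi>_n\<close> is subharmonic away from the
base vertex, and its energy is at most the degree of the base vertex times the probability of not
returning there within \<open>n + 1\<close> steps inside \<open>K_n\<close>, which tends to \<open>0\<close> by recurrence.

Finally, for cochains of dimension \<open>k\<close>, an element of \<open>ker \<delta>_{D,k}\<close> that is orthogonal to
\<open>\<delta>(D \<inter> \<ell>\<^sup>2(\<Sigma>_{k-1}))\<close> is automatically orthogonal to the whole range of \<open>\<delta>_D\<close>, because the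
coboundary of a single simplex of any other dimension has disjoint support. So \<open>ker \<Delta>_k\<close> is the
orthogonal complement of the closed range in \<open>ker \<delta>_{D,k}\<close>, and an orthogonal complement is
isometric to the quotient.\<close>

section \<open>The weighted Hilbert space\<close>

definition norm_sq :: "'v set set \<Rightarrow> ('v set \<Rightarrow> real) \<Rightarrow> ('v set \<Rightarrow> complex) \<Rightarrow> real" where
  "norm_sq \<Sigma> m f = (\<Sum>\<^sub>\<infinity>\<sigma>\<in>\<Sigma>. m \<sigma> * (cmod (f \<sigma>))\<^sup>2)"

definition linear_subspace :: "'v set set \<Rightarrow> ('v set \<Rightarrow> real) \<Rightarrow> ('v set \<Rightarrow> complex) set \<Rightarrow> bool" where
  "linear_subspace \<Sigma> m A \<longleftrightarrow>
     A \<subseteq> l2 \<Sigma> m \<and> 0 \<in> A \<and> (\<forall>f\<in>A. \<forall>g\<in>A. f + g \<in> A) \<and> (\<forall>c. \<forall>f\<in>A. (\<lambda>\<sigma>. c * f \<sigma>) \<in> A)"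

lemma infsum_ennreal:
  fixes f :: "'a \<Rightarrow> real"
  assumes "f summable_on A" "\<And>x. x \<in> A \<Longrightarrow> 0 \<le> f x"
  shows "(\<Sum>\<^sub>\<infinity>x\<in>A. ennreal (f x)) = ennreal (infsum f A)"
proof -
  have "ennreal (infsum f A) = (SUP F\<in>{F. finite F \<and> F \<subseteq> A}. ennreal (sum f F))"
    using assms by (rule infsum_nonneg_is_SUPREMUM_ennreal)
  also have "\<dots> = (SUP F\<in>{F. finite F \<and> F \<subseteq> A}. (\<Sum>x\<in>F. ennreal (f x)))"
    using assms by (intro SUP_cong) (auto simp: subset_iff)
  also have "\<dots> = (\<Sum>\<^sub>\<infinity>x\<in>A. ennreal (f x))"
    by (simp add: nonneg_infsum_complete)
  finally show ?thesis by simp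
qed

lemma infsum_ennreal_less_top_iff:
  fixes f :: "'a \<Rightarrow> real"
  assumes "\<And>x. x \<in> A \<Longrightarrow> 0 \<le> f x"
  shows "(\<Sum>\<^sub>\<infinity>x\<in>A. ennreal (f x)) < \<infinity> \<longleftrightarrow> f summable_on A"
proof
  assume "f summable_on A"
  then show "(\<Sum>\<^sub>\<infinity>x\<in>A. ennreal (f x)) < \<infinity>"
    using assms by (simp add: infsum_ennreal)
next
  assume L: "(\<Sum>\<^sub>\<infinity>x\<in>A. ennreal (f x)) < \<infinity>"
  define c where "c = enn2real (\<Sum>\<^sub>\<infinity>x\<in>A. ennreal (f x))"
  have c: "(\<Sum>\<^sub>\<infinity>x\<in>A. ennreal (f x)) = ennreal c" "0 \<le> c"
    using L by (auto simp: c_def)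
  have "sum f F \<le> c" if "F \<subseteq> A" "finite F" for F
  proof -
    have "ennreal (sum f F) = (\<Sum>x\<in>F. ennreal (f x))"
      using that assms by (auto simp: subset_iff)
    also have "\<dots> \<le> (\<Sum>\<^sub>\<infinity>x\<in>A. ennreal (f x))"
      using that by (auto simp: nonneg_infsum_complete intro: SUP_upper)
    finally show ?thesis using c by simp
  qed
  then have "bdd_above (sum f ` {F. F \<subseteq> A \<and> finite F})"
    by (auto intro!: bdd_aboveI[of _ c])
  then show "f summable_on A"
    using assms by (intro nonneg_bdd_above_summable_on) auto
qed

lemma infsum_complex_of_real:
  "(\<Sum>\<^sub>\<infinity>x\<in>A. complex_of_real (f x)) = complex_of_real (infsum f A)"
proof (cases "f summable_on A")
  case True
  then have "((\<lambda>x. complex_of_real (f x)) has_sum complex_of_real (infsum f A)) A"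
    by (intro has_sum_of_real has_sum_infsum)
  then show ?thesis by (rule infsumI)
next
  case False
  then have "\<not> (\<lambda>x. complex_of_real (f x)) summable_on A"
    using summable_on_Re by fastforce
  with False show ?thesis by (simp add: infsum_not_exists)
qed

locale weighted_l2 =
  fixes \<Sigma> :: "'v set set" and m :: "'v set \<Rightarrow> real"
  assumes weight_pos: "\<sigma> \<in> \<Sigma> \<Longrightarrow> 0 < m \<sigma>"
begin

abbreviation ip :: "('v set \<Rightarrow> complex) \<Rightarrow> ('v set \<Rightarrow> complex) \<Rightarrow> complex" where
  "ip \<equiv> l2_inner \<Sigma> m"

abbreviation nsq :: "('v set \<Rightarrow> complex) \<Rightarrow> real" where
  "nsq \<equiv> norm_sq \<Sigma> m"

abbreviation H :: "('v set \<Rightarrow> complex) set" where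
  "H \<equiv> l2 \<Sigma> m"

lemma weight_nonneg: "\<sigma> \<in> \<Sigma> \<Longrightarrow> 0 \<le> m \<sigma>"
  using weight_pos less_imp_le by blast

lemma l2_iff: "f \<in> H \<longleftrightarrow> f \<in> cochains \<Sigma> \<and> (\<lambda>\<sigma>. m \<sigma> * (cmod (f \<sigma>))\<^sup>2) summable_on \<Sigma>"
  using infsum_ennreal_less_top_iff[of \<Sigma> "\<lambda>\<sigma>. m \<sigma> * (cmod (f \<sigma>))\<^sup>2"]
  by (auto simp: l2_def l2_norm_sq_def weight_nonneg)

lemma l2_norm_sq_eq: "f \<in> H \<Longrightarrow> l2_norm_sq \<Sigma> m f = ennreal (nsq f)"
  unfolding l2_norm_sq_def norm_sq_def
  by (rule infsum_ennreal) (auto simp: l2_iff weight_nonneg)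

lemma nsq_nonneg: "0 \<le> nsq f"
  unfolding norm_sq_def by (intro infsum_nonneg) (simp add: weight_nonneg)

lemma l2_norm_eq: "f \<in> H \<Longrightarrow> l2_norm \<Sigma> m f = sqrt (nsq f)"
  by (simp add: l2_norm_def l2_norm_sq_eq nsq_nonneg)

lemma l2_summable: "f \<in> H \<Longrightarrow> (\<lambda>\<sigma>. m \<sigma> * (cmod (f \<sigma>))\<^sup>2) summable_on \<Sigma>"
  by (simp add: l2_iff)

lemma l2_cochain: "f \<in> H \<Longrightarrow> f \<in> cochains \<Sigma>"
  by (simp add: l2_iff)

lemma l2_outside: "f \<in> H \<Longrightarrow> \<sigma> \<notin> \<Sigma> \<Longrightarrow> f \<sigma> = 0"
  by (simp add: l2_iff cochains_def)

lemma ip_abs_summable: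
  assumes "f \<in> H" "g \<in> H"
  shows "(\<lambda>\<sigma>. norm (complex_of_real (m \<sigma>) * f \<sigma> * cnj (g \<sigma>))) summable_on \<Sigma>"
proof (rule summable_on_comparison_test)
  show "(\<lambda>\<sigma>. m \<sigma> * (cmod (f \<sigma>))\<^sup>2 + m \<sigma> * (cmod (g \<sigma>))\<^sup>2) summable_on \<Sigma>"
    using assms by (intro summable_on_add l2_summable)
  fix \<sigma> assume \<sigma>: "\<sigma> \<in> \<Sigma>"
  have "2 * (cmod (f \<sigma>) * cmod (g \<sigma>)) \<le> (cmod (f \<sigma>))\<^sup>2 + (cmod (g \<sigma>))\<^sup>2"
    using sum_squares_bound[of "cmod (f \<sigma>)" "cmod (g \<sigma>)"] by simp
  then have "cmod (f \<sigma>) * cmod (g \<sigma>) \<le> (cmod (f \<sigma>))\<^sup>2 + (cmod (g \<sigma>))\<^sup>2"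
    by (smt (verit) mult_nonneg_nonneg norm_ge_zero)
  then have "m \<sigma> * (cmod (f \<sigma>) * cmod (g \<sigma>)) \<le> m \<sigma> * ((cmod (f \<sigma>))\<^sup>2 + (cmod (g \<sigma>))\<^sup>2)"
    using weight_nonneg[OF \<sigma>] by (rule mult_left_mono)
  then show "norm (complex_of_real (m \<sigma>) * f \<sigma> * cnj (g \<sigma>))
      \<le> m \<sigma> * (cmod (f \<sigma>))\<^sup>2 + m \<sigma> * (cmod (g \<sigma>))\<^sup>2"
    using weight_nonneg[OF \<sigma>] by (simp add: norm_mult algebra_simps)
qed auto

lemma ip_summable:
  "f \<in> H \<Longrightarrow> g \<in> H \<Longrightarrow> (\<lambda>\<sigma>. complex_of_real (m \<sigma>) * f \<sigma> * cnj (g \<sigma>)) summable_on \<Sigma>"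
  by (rule abs_summable_summable[OF ip_abs_summable])

lemma l2_zero: "0 \<in> H"
  by (simp add: l2_iff cochains_def zero_fun_def)

lemma l2_scale: "f \<in> H \<Longrightarrow> (\<lambda>\<sigma>. c * f \<sigma>) \<in> H"
proof -
  assume f: "f \<in> H"
  have "(\<lambda>\<sigma>. (cmod c)\<^sup>2 * (m \<sigma> * (cmod (f \<sigma>))\<^sup>2)) summable_on \<Sigma>"
    using l2_summable[OF f] by (rule summable_on_cmult_right)
  then show ?thesis using f
    by (simp add: l2_iff cochains_def norm_mult power_mult_distrib mult.left_commute)
qed

lemma l2_add:
  assumes "f \<in> H" "g \<in> H"
  shows "f + g \<in> H"
proof -
  have "(\<lambda>\<sigma>. m \<sigma> * (cmod (f \<sigma> + g \<sigma>))\<^sup>2) summable_on \<Sigma>"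
  proof (rule summable_on_comparison_test)
    show "(\<lambda>\<sigma>. 2 * (m \<sigma> * (cmod (f \<sigma>))\<^sup>2 + m \<sigma> * (cmod (g \<sigma>))\<^sup>2)) summable_on \<Sigma>"
      using assms by (intro summable_on_cmult_right summable_on_add l2_summable)
    fix \<sigma> assume \<sigma>: "\<sigma> \<in> \<Sigma>"
    have "(cmod (f \<sigma> + g \<sigma>))\<^sup>2 \<le> (cmod (f \<sigma>) + cmod (g \<sigma>))\<^sup>2"
      by (intro power_mono norm_triangle_ineq) simp
    also have "\<dots> \<le> 2 * ((cmod (f \<sigma>))\<^sup>2 + (cmod (g \<sigma>))\<^sup>2)"
      using sum_squares_bound[of "cmod (f \<sigma>)" "cmod (g \<sigma>)"] by (simp add: power2_sum)
    finally have "m \<sigma> * (cmod (f \<sigma> + g \<sigma>))\<^sup>2 \<le> m \<sigma> * (2 * ((cmod (f \<sigma>))\<^sup>2 + (cmod (g \<sigma>))\<^sup>2))"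
      using weight_nonneg[OF \<sigma>] by (rule mult_left_mono)
    then show "m \<sigma> * (cmod (f \<sigma> + g \<sigma>))\<^sup>2 \<le> 2 * (m \<sigma> * (cmod (f \<sigma>))\<^sup>2 + m \<sigma> * (cmod (g \<sigma>))\<^sup>2)"
      by (simp add: algebra_simps)
    show "0 \<le> m \<sigma> * (cmod (f \<sigma> + g \<sigma>))\<^sup>2" using weight_nonneg[OF \<sigma>] by simp
  qed
  then show ?thesis using assms by (simp add: l2_iff cochains_def)
qed

lemma l2_uminus: "f \<in> H \<Longrightarrow> - f \<in> H"
  using l2_scale[of f "-1"] by (simp add: fun_Compl_def)

lemma l2_diff: "f \<in> H \<Longrightarrow> g \<in> H \<Longrightarrow> f - g \<in> H"
  using l2_add[of f "- g"] l2_uminus[of g] by simp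

lemma ip_add_left:
  assumes "f \<in> H" "g \<in> H" "h \<in> H"
  shows "ip (f + g) h = ip f h + ip g h"
proof -
  have "ip f h + ip g h = (\<Sum>\<^sub>\<infinity>\<sigma>\<in>\<Sigma>. complex_of_real (m \<sigma>) * f \<sigma> * cnj (h \<sigma>)
      + complex_of_real (m \<sigma>) * g \<sigma> * cnj (h \<sigma>))"
    unfolding l2_inner_def using assms by (intro infsum_add[symmetric] ip_summable)
  then show ?thesis by (simp add: l2_inner_def algebra_simps)
qed

lemma ip_scale_left:
  assumes "f \<in> H" "h \<in> H"
  shows "ip (\<lambda>\<sigma>. c * f \<sigma>) h = c * ip f h"
proof -
  have "c * ip f h = (\<Sum>\<^sub>\<infinity>\<sigma>\<in>\<Sigma>. c * (complex_of_real (m \<sigma>) * f \<sigma> * cnj (h \<sigma>)))"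
    unfolding l2_inner_def by (rule infsum_cmult_right'[symmetric])
  then show ?thesis by (simp add: l2_inner_def algebra_simps)
qed

lemma cnj_ip: "cnj (ip f g) = ip g f"
proof -
  have "cnj (ip f g) = (\<Sum>\<^sub>\<infinity>\<sigma>\<in>\<Sigma>. cnj (complex_of_real (m \<sigma>) * f \<sigma> * cnj (g \<sigma>)))"
    unfolding l2_inner_def by (rule infsum_cnj[symmetric])
  then show ?thesis by (simp add: l2_inner_def mult.assoc mult.left_commute mult.commute)
qed

lemma ip_zero_commute: "ip f g = 0 \<longleftrightarrow> ip g f = 0"
  by (metis cnj_ip complex_cnj_zero)

lemma ip_zero_left [simp]: "ip 0 f = 0"
  by (simp add: l2_inner_def)

lemma ip_zero_right [simp]: "ip f 0 = 0"
  by (simp add: l2_inner_def)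

lemma ip_uminus_left: "f \<in> H \<Longrightarrow> h \<in> H \<Longrightarrow> ip (- f) h = - ip f h"
  using ip_scale_left[of f h "-1"] by (simp add: fun_Compl_def)

lemma ip_diff_left: "f \<in> H \<Longrightarrow> g \<in> H \<Longrightarrow> h \<in> H \<Longrightarrow> ip (f - g) h = ip f h - ip g h"
  using ip_add_left[of f "- g" h] by (simp add: ip_uminus_left l2_uminus)

lemma ip_add_right: "f \<in> H \<Longrightarrow> g \<in> H \<Longrightarrow> h \<in> H \<Longrightarrow> ip h (f + g) = ip h f + ip h g"
  using ip_add_left[of f g h] by (metis cnj_ip complex_cnj_add)

lemma ip_scale_right: "f \<in> H \<Longrightarrow> h \<in> H \<Longrightarrow> ip h (\<lambda>\<sigma>. c * f \<sigma>) = cnj c * ip h f"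
  using ip_scale_left[of f h c] by (metis cnj_ip complex_cnj_mult)

lemma ip_self: "ip f f = complex_of_real (nsq f)"
proof -
  have "ip f f = (\<Sum>\<^sub>\<infinity>\<sigma>\<in>\<Sigma>. complex_of_real (m \<sigma> * (cmod (f \<sigma>))\<^sup>2))"
    unfolding l2_inner_def
    by (simp add: complex_norm_square mult.assoc flip: of_real_power)
  also have "\<dots> = complex_of_real (nsq f)"
    unfolding norm_sq_def by (rule infsum_complex_of_real)
  finally show ?thesis .
qed

lemma nsq_ip: "nsq f = Re (ip f f)"
  by (simp add: ip_self)

text \<open>The parallelogram law, the Cauchy-Schwarz inequality and polarization all follow from this
expansion.\<close>

lemma nsq_add_scale:
  assumes "f \<in> H" "g \<in> H"
  shows "nsq (f + (\<lambda>\<sigma>. c * g \<sigma>)) = nsq f + 2 * Re (cnj c * ip f g) + (cmod c)\<^sup>2 * nsq g"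
proof -
  have cg: "(\<lambda>\<sigma>. c * g \<sigma>) \<in> H" using assms l2_scale by blast
  have "ip (f + (\<lambda>\<sigma>. c * g \<sigma>)) (f + (\<lambda>\<sigma>. c * g \<sigma>)) =
      ip f f + cnj c * ip f g + c * ip g f + c * cnj c * ip g g"
    using assms cg
    by (simp add: ip_add_left ip_add_right l2_add ip_scale_left ip_scale_right algebra_simps)
  moreover have "c * ip g f = cnj (cnj c * ip f g)"
    by (simp add: cnj_ip)
  moreover have "Re (c * cnj c * ip g g) = (cmod c)\<^sup>2 * nsq g"
    by (simp add: ip_self complex_mult_cnj cmod_power2 flip: of_real_mult of_real_add of_real_power)
  ultimately show ?thesis unfolding nsq_ip by (simp only: plus_complex.sel complex_cnj) simp
qed

lemma nsq_add: "f \<in> H \<Longrightarrow> g \<in> H \<Longrightarrow> nsq (f + g) = nsq f + 2 * Re (ip f g) + nsq g"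
  using nsq_add_scale[of f g 1] by simp

lemma nsq_diff: "f \<in> H \<Longrightarrow> g \<in> H \<Longrightarrow> nsq (f - g) = nsq f - 2 * Re (ip f g) + nsq g"
  using nsq_add_scale[of f g "-1"] by (simp add: fun_diff_def plus_fun_def)

lemma nsq_scale: "f \<in> H \<Longrightarrow> nsq (\<lambda>\<sigma>. c * f \<sigma>) = (cmod c)\<^sup>2 * nsq f"
  unfolding norm_sq_def
  by (subst infsum_cmult_right'[symmetric]) (simp add: norm_mult power_mult_distrib mult_ac)

lemma nsq_minus_commute: "nsq (f - g) = nsq (g - f)"
  by (simp add: norm_sq_def norm_minus_commute)

lemma nsq_le_parallelogram:
  assumes "f \<in> H" "g \<in> H"
  shows "nsq (f + g) \<le> 2 * nsq f + 2 * nsq g"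
  using assms nsq_nonneg[of "f - g"] by (simp add: nsq_add nsq_diff)

lemma weight_sq_le_nsq: "f \<in> H \<Longrightarrow> \<sigma> \<in> \<Sigma> \<Longrightarrow> m \<sigma> * (cmod (f \<sigma>))\<^sup>2 \<le> nsq f"
  using finite_sum_le_infsum[OF l2_summable, of f "{\<sigma>}"]
  by (simp add: norm_sq_def weight_nonneg)

lemma nsq_eq_0: "f \<in> H \<Longrightarrow> nsq f = 0 \<Longrightarrow> f = 0"
proof
  fix \<sigma> assume f: "f \<in> H" "nsq f = 0"
  show "f \<sigma> = 0 \<sigma>"
  proof (cases "\<sigma> \<in> \<Sigma>")
    case True
    then have "m \<sigma> * (cmod (f \<sigma>))\<^sup>2 \<le> 0" using weight_sq_le_nsq[OF f(1), of \<sigma>] f(2) by simp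
    then show ?thesis using weight_pos[OF True]
      by (simp add: mult_le_0_iff)
  qed (simp add: f l2_outside)
qed

lemma Cauchy_Schwarz:
  assumes "f \<in> H" "g \<in> H"
  shows "(cmod (ip f g))\<^sup>2 \<le> nsq f * nsq g"
proof (cases "nsq g = 0")
  case True
  then show ?thesis using nsq_eq_0[OF assms(2)] by (simp add: nsq_nonneg)
next
  case False
  then have pos: "0 < nsq g" using nsq_nonneg[of g] by linarith
  define c where "c = - (ip f g / nsq g)"
  have "0 \<le> nsq f + 2 * Re (cnj c * ip f g) + (cmod c)\<^sup>2 * nsq g"
    using nsq_add_scale[OF assms, of c] nsq_nonneg by metis
  also have "cnj c * ip f g = complex_of_real (- ((cmod (ip f g))\<^sup>2 / nsq g))"
    by (simp add: c_def complex_norm_square[symmetric] mult.commute[of "cnj _"] flip: of_real_power)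
  also have "(cmod c)\<^sup>2 * nsq g = (cmod (ip f g))\<^sup>2 / nsq g"
    using pos by (simp add: c_def norm_divide power_divide power2_eq_square)
  finally have "(cmod (ip f g))\<^sup>2 / nsq g \<le> nsq f" by simp
  then show ?thesis using pos by (simp add: divide_le_eq)
qed

abbreviation l2_tendsto ::
  "(nat \<Rightarrow> 'v set \<Rightarrow> complex) \<Rightarrow> ('v set \<Rightarrow> complex) \<Rightarrow> bool" where
  "l2_tendsto u f \<equiv> (\<lambda>n. nsq (u n - f)) \<longlonglongrightarrow> 0"

lemma tendsto_ip_left:
  assumes "\<And>n. u n \<in> H" "f \<in> H" "g \<in> H" "l2_tendsto u f"
  shows "(\<lambda>n. ip (u n) g) \<longlonglongrightarrow> ip f g"
proof -
  have "(\<lambda>n. sqrt (nsq (u n - f) * nsq g)) \<longlonglongrightarrow> sqrt (0 * nsq g)"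
    using assms(4) by (intro tendsto_intros)
  then have lim: "(\<lambda>n. sqrt (nsq (u n - f) * nsq g)) \<longlonglongrightarrow> 0" by simp
  have "(\<lambda>n. ip (u n) g - ip f g) \<longlonglongrightarrow> 0"
  proof (rule tendsto_0_le[OF lim, of _ 1], rule always_eventually, rule allI)
    fix n
    have "(cmod (ip (u n - f) g))\<^sup>2 \<le> nsq (u n - f) * nsq g"
      using assms by (intro Cauchy_Schwarz l2_diff)
    then have "cmod (ip (u n - f) g) \<le> sqrt (nsq (u n - f) * nsq g)"
      by (rule real_le_rsqrt)
    moreover have "ip (u n - f) g = ip (u n) g - ip f g"
      using assms by (simp add: ip_diff_left)
    ultimately show "norm (ip (u n) g - ip f g) \<le> norm (sqrt (nsq (u n - f) * nsq g)) * 1"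
      by simp
  qed
  then show ?thesis using Lim_null by blast
qed

text \<open>The limit is taken pointwise. A bound on \<open>u j - u k\<close> restricts to every finite set of simplices,
survives \<open>j \<rightarrow> \<infinity>\<close> there, and then extends to the full sum.\<close>

lemma l2_complete:
  assumes u: "\<And>n. u n \<in> H"
    and Cauchy: "\<And>e. 0 < e \<Longrightarrow> \<exists>N. \<forall>j\<ge>N. \<forall>k\<ge>N. nsq (u j - u k) < e"
  shows "\<exists>f\<in>H. l2_tendsto u f"
proof -
  have "Cauchy (\<lambda>n. u n \<sigma>)" for \<sigma>
  proof (cases "\<sigma> \<in> \<Sigma>")
    case True
    show ?thesis
    proof (rule metric_CauchyI)
      fix e :: real assume "0 < e"
      then have "0 < m \<sigma> * e\<^sup>2" using weight_pos[OF True] by simp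
      then obtain N where N: "\<forall>j\<ge>N. \<forall>k\<ge>N. nsq (u j - u k) < m \<sigma> * e\<^sup>2" using Cauchy by blast
      have "dist (u j \<sigma>) (u k \<sigma>) < e" if "j \<ge> N" "k \<ge> N" for j k
      proof -
        have "m \<sigma> * (cmod ((u j - u k) \<sigma>))\<^sup>2 \<le> nsq (u j - u k)"
          using u True by (intro weight_sq_le_nsq l2_diff)
        also have "\<dots> < m \<sigma> * e\<^sup>2" using N that by blast
        finally have "(cmod (u j \<sigma> - u k \<sigma>))\<^sup>2 < e\<^sup>2" using weight_pos[OF True] by simp
        then show ?thesis using \<open>0 < e\<close> by (simp add: dist_norm power_less_imp_less_base)
      qed
      then show "\<exists>N. \<forall>j\<ge>N. \<forall>k\<ge>N. dist (u j \<sigma>) (u k \<sigma>) < e" by blast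
    qed
  next
    case False
    then show ?thesis using u by (simp add: l2_outside Cauchy_convergent_iff convergent_const)
  qed
  then have "\<exists>l. (\<lambda>n. u n \<sigma>) \<longlonglongrightarrow> l" for \<sigma>
    by (simp add: Cauchy_convergent_iff convergent_def)
  then obtain f where f: "\<And>\<sigma>. (\<lambda>n. u n \<sigma>) \<longlonglongrightarrow> f \<sigma>" by metis
  have f0: "f \<sigma> = 0" if "\<sigma> \<notin> \<Sigma>" for \<sigma>
    using f[of \<sigma>] u that by (simp add: l2_outside LIMSEQ_const_iff)
  have bound: "u k - f \<in> H \<and> nsq (u k - f) \<le> e"
    if k: "k \<ge> N" and N: "\<forall>j\<ge>N. \<forall>k\<ge>N. nsq (u j - u k) < e" for k N e
  proof -
    have fin: "(\<Sum>\<sigma>\<in>F. m \<sigma> * (cmod ((u k - f) \<sigma>))\<^sup>2) \<le> e" if "F \<subseteq> \<Sigma>" "finite F" for F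
    proof (rule LIMSEQ_le_const2)
      show "(\<lambda>j. \<Sum>\<sigma>\<in>F. m \<sigma> * (cmod ((u k - u j) \<sigma>))\<^sup>2) \<longlonglongrightarrow> (\<Sum>\<sigma>\<in>F. m \<sigma> * (cmod ((u k - f) \<sigma>))\<^sup>2)"
        unfolding minus_apply using f by (intro tendsto_intros)
      have "(\<Sum>\<sigma>\<in>F. m \<sigma> * (cmod ((u k - u j) \<sigma>))\<^sup>2) \<le> e" if "j \<ge> N" for j
      proof -
        have "(\<Sum>\<sigma>\<in>F. m \<sigma> * (cmod ((u k - u j) \<sigma>))\<^sup>2) \<le> nsq (u k - u j)"
          unfolding norm_sq_def using \<open>F \<subseteq> \<Sigma>\<close> \<open>finite F\<close> u
          by (intro finite_sum_le_infsum l2_summable l2_diff) (auto simp: weight_nonneg)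
        then show ?thesis using N k that by (meson less_imp_le order_trans)
      qed
      then show "\<exists>N. \<forall>j\<ge>N. (\<Sum>\<sigma>\<in>F. m \<sigma> * (cmod ((u k - u j) \<sigma>))\<^sup>2) \<le> e" by blast
    qed
    have "(\<lambda>\<sigma>. m \<sigma> * (cmod ((u k - f) \<sigma>))\<^sup>2) summable_on \<Sigma>"
      using fin by (intro nonneg_bdd_above_summable_on) (auto simp: weight_nonneg intro!: bdd_aboveI[of _ e])
    moreover have "u k - f \<in> cochains \<Sigma>"
      using u f0 by (simp add: cochains_def l2_outside)
    ultimately show ?thesis
      using fin by (auto simp: l2_iff norm_sq_def intro!: infsum_le_finite_sums)
  qed
  obtain N where "\<forall>j\<ge>N. \<forall>k\<ge>N. nsq (u j - u k) < 1" using Cauchy[of 1] by auto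
  then have "u N - f \<in> H" using bound by blast
  then have "u N - (u N - f) \<in> H" using u by (rule l2_diff[rotated])
  moreover have "u N - (u N - f) = f" by simp
  ultimately have "f \<in> H" by (simp only:)
  moreover have "l2_tendsto u f"
  proof (rule LIMSEQ_I)
    fix e :: real assume "0 < e"
    then obtain N where "\<forall>j\<ge>N. \<forall>k\<ge>N. nsq (u j - u k) < e / 2" using Cauchy[of "e/2"] by auto
    then have "nsq (u k - f) \<le> e / 2" if "k \<ge> N" for k using bound that by blast
    then show "\<exists>N. \<forall>n\<ge>N. norm (nsq (u n - f) - 0) < e"
      using \<open>0 < e\<close> nsq_nonneg by (intro exI[of _ N]) (fastforce simp: abs_of_nonneg)
  qed
  ultimately show ?thesis by blast
qed

lemma linear_subspace_subset: "linear_subspace \<Sigma> m V \<Longrightarrow> V \<subseteq> H"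
  and linear_subspace_zero: "linear_subspace \<Sigma> m V \<Longrightarrow> 0 \<in> V"
  and linear_subspace_add: "linear_subspace \<Sigma> m V \<Longrightarrow> f \<in> V \<Longrightarrow> g \<in> V \<Longrightarrow> f + g \<in> V"
  and linear_subspace_scale: "linear_subspace \<Sigma> m V \<Longrightarrow> f \<in> V \<Longrightarrow> (\<lambda>\<sigma>. c * f \<sigma>) \<in> V"
  unfolding linear_subspace_def by blast+

lemma linear_subspace_diff:
  assumes "linear_subspace \<Sigma> m V" "f \<in> V" "g \<in> V"
  shows "f - g \<in> V"
proof -
  have "(\<lambda>\<sigma>. (-1) * g \<sigma>) \<in> V" using linear_subspace_scale[OF assms(1,3)] .
  then have "- g \<in> V" by (simp add: fun_Compl_def)
  then have "f + - g \<in> V" using linear_subspace_add[OF assms(1,2)] by blast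
  then show ?thesis by simp
qed

text \<open>The sequence \<open>u\<close> minimizes \<open>\<parallel>f - v\<parallel>\<^sup>2 + \<parallel>T v\<parallel>\<^sup>2\<close> over \<open>v \<in> V\<close>, and the conclusion is the
Euler-Lagrange equation of this problem. For \<open>T = 0\<close> it yields the orthogonal projection onto the
closure of \<open>V\<close>; for \<open>T = \<delta>\<close> on finitely supported cochains it amounts to a projection onto the
closure of the graph of \<open>\<delta>\<close>, without introducing the Hilbert space \<open>\<ell>\<^sup>2 \<times> \<ell>\<^sup>2\<close>.\<close>

lemma regularized_projection:
  assumes V: "linear_subspace \<Sigma> m V" and f: "f \<in> H"
    and T: "\<And>v. v \<in> V \<Longrightarrow> T v \<in> H"
    and T_add: "\<And>v v'. v \<in> V \<Longrightarrow> v' \<in> V \<Longrightarrow> T (v + v') = T v + T v'"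
    and T_scale: "\<And>c v. v \<in> V \<Longrightarrow> T (\<lambda>\<sigma>. c * v \<sigma>) = (\<lambda>\<sigma>. c * T v \<sigma>)"
  shows "\<exists>u p q. (\<forall>n. u n \<in> V) \<and> p \<in> H \<and> q \<in> H \<and> l2_tendsto u p \<and>
           (\<lambda>n. nsq (T (u n) - q)) \<longlonglongrightarrow> 0 \<and> (\<forall>v\<in>V. ip (f - p) v = ip q (T v))"
proof -
  define J where "J v = nsq (f - v) + nsq (T v)" for v
  define d where "d = (INF v\<in>V. J v)"
  have VH: "v \<in> H" if "v \<in> V" for v using linear_subspace_subset[OF V] that by blast
  have V0: "V \<noteq> {}" using linear_subspace_zero[OF V] by blast
  have V_add: "v + v' \<in> V" if "v \<in> V" "v' \<in> V" for v v'
    using linear_subspace_add[OF V] that .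
  have V_scale: "(\<lambda>\<sigma>. c * v \<sigma>) \<in> V" if "v \<in> V" for c v
    using linear_subspace_scale[OF V] that .
  have J0: "0 \<le> J v" for v by (simp add: J_def nsq_nonneg)
  have J_ge: "d \<le> J v" if "v \<in> V" for v
    unfolding d_def using that J0 by (intro cINF_lower bdd_belowI[of _ 0]) auto
  have "\<exists>v\<in>V. J v < d + 1 / Suc n" for n
  proof -
    have "Inf (J ` V) < d + 1 / Suc n" by (simp add: d_def)
    then show ?thesis using V0 cInf_lessD[of "J ` V"] by blast
  qed
  then obtain u where u: "\<And>n. u n \<in> V" and Ju: "\<And>n. J (u n) < d + 1 / Suc n" by metis
  have T_diff: "T (v - v') = T v - T v'" if "v \<in> V" "v' \<in> V" for v v'
  proof -
    have "v - v' + v' = v" by simp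
    then show ?thesis
      using T_add[of "v - v'" v'] that linear_subspace_diff[OF V] by (metis add_diff_cancel_right')
  qed
  have close: "nsq (u j - u k) + nsq (T (u j) - T (u k)) \<le> 2 / Suc j + 2 / Suc k" for j k
  proof -
    \<comment> \<open>The midpoint of two almost minimizers cannot beat the infimum, so by the parallelogram
      law the two are close to each other.\<close>
    define h where "h = (\<lambda>\<sigma>. (1/2) * (u j + u k) \<sigma>)"
    have hV: "h \<in> V" unfolding h_def using V_scale V_add u by blast
    have Th: "T h = (\<lambda>\<sigma>. (1/2) * (T (u j) + T (u k)) \<sigma>)"
      unfolding h_def T_scale[OF V_add[OF u u]] T_add[OF u u] ..
    define a b where "a = f - u j" and "b = f - u k"
    have ab: "a \<in> H" "b \<in> H" using f u VH by (auto simp: a_def b_def intro: l2_diff)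
    have "a - b = u k - u j" by (simp add: a_def b_def)
    then have 1: "nsq (a - b) = nsq (u j - u k)" by (simp add: nsq_minus_commute)
    have "a + b = (\<lambda>\<sigma>. 2 * (f - h) \<sigma>)"
      by (rule ext) (simp add: a_def b_def h_def algebra_simps)
    then have 2: "nsq (a + b) = 4 * nsq (f - h)"
      using nsq_scale[of "f - h" 2] f hV VH l2_diff by simp
    have "T (u j) + T (u k) = (\<lambda>\<sigma>. 2 * T h \<sigma>)" by (rule ext) (simp add: Th)
    then have 3: "nsq (T (u j) + T (u k)) = 4 * nsq (T h)"
      using nsq_scale[of "T h" 2] T[OF hV] by simp
    have Jj: "J (u j) = nsq a + nsq (T (u j))" and Jk: "J (u k) = nsq b + nsq (T (u k))"
      and Jh: "J h = nsq (f - h) + nsq (T h)"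
      by (simp_all add: J_def a_def b_def)
    have "nsq (a + b) + nsq (a - b) = 2 * nsq a + 2 * nsq b"
      using ab by (simp add: nsq_add nsq_diff)
    moreover have "nsq (T (u j) + T (u k)) + nsq (T (u j) - T (u k))
        = 2 * nsq (T (u j)) + 2 * nsq (T (u k))"
      using T u by (simp add: nsq_add nsq_diff)
    ultimately have "nsq (u j - u k) + nsq (T (u j) - T (u k)) = 2 * J (u j) + 2 * J (u k) - 4 * J h"
      unfolding 1 2 3 Jj Jk Jh by algebra
    also have "\<dots> \<le> 2 * (d + 1 / Suc j) + 2 * (d + 1 / Suc k) - 4 * d"
      using Ju[of j] Ju[of k] J_ge[OF hV] by argo
    finally show ?thesis by simp
  qed
  have "\<exists>N. \<forall>j\<ge>N. \<forall>k\<ge>N. nsq (u j - u k) + nsq (T (u j) - T (u k)) < e" if "0 < e" for e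
  proof -
    from that have "0 < e / 4" by simp
    then obtain N where N: "1 / Suc N < e / 4" by (rule nat_approx_posE)
    have "nsq (u j - u k) + nsq (T (u j) - T (u k)) < e" if "j \<ge> N" "k \<ge> N" for j k
    proof -
      have "1 / Suc j \<le> 1 / Suc N" "1 / Suc k \<le> 1 / Suc N" using that by (auto simp: frac_le)
      then show ?thesis using close[of j k] N by argo
    qed
    then show ?thesis by blast
  qed
  note C = this
  have "\<exists>p\<in>H. l2_tendsto u p"
  proof (rule l2_complete)
    show "\<exists>N. \<forall>j\<ge>N. \<forall>k\<ge>N. nsq (u j - u k) < e" if "0 < e" for e
      using C[OF that] nsq_nonneg by (meson le_add_same_cancel1 le_less_trans)
  qed (use u VH in blast)
  then obtain p where p: "p \<in> H" "l2_tendsto u p" by blast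
  have "\<exists>q\<in>H. (\<lambda>n. nsq (T (u n) - q)) \<longlonglongrightarrow> 0"
  proof (rule l2_complete)
    show "\<exists>N. \<forall>j\<ge>N. \<forall>k\<ge>N. nsq (T (u j) - T (u k)) < e" if "0 < e" for e
      using C[OF that] nsq_nonneg by (meson le_add_same_cancel2 le_less_trans)
  qed (use u T in blast)
  then obtain q where q: "q \<in> H" "(\<lambda>n. nsq (T (u n) - q)) \<longlonglongrightarrow> 0" by blast
  have "ip (f - p) v = ip q (T v)" if v: "v \<in> V" for v
  proof -
    define K where "K = nsq v + nsq (T v)"
    define x where "x n = ip (f - u n) v - ip (T (u n)) (T v)" for n
    have K0: "0 \<le> K" by (simp add: K_def nsq_nonneg)
    have bound: "(cmod (x n))\<^sup>2 \<le> (K + 1) / Suc n" for n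
    proof -
      \<comment> \<open>Moving from \<open>u n\<close> in the direction \<open>v\<close> lowers the functional most for the multiplier
        \<open>x n / K\<close>; the denominator \<open>K + 1\<close> covers \<open>K = 0\<close> as well.\<close>
      define s where "s = x n / complex_of_real (K + 1)"
      have sv: "(\<lambda>\<sigma>. s * v \<sigma>) \<in> V" using V_scale v by blast
      have diff: "f - (u n + (\<lambda>\<sigma>. s * v \<sigma>)) = (f - u n) + (\<lambda>\<sigma>. (- s) * v \<sigma>)"
        by (rule ext) simp
      have 1: "nsq (f - (u n + (\<lambda>\<sigma>. s * v \<sigma>))) =
          nsq (f - u n) - 2 * Re (cnj s * ip (f - u n) v) + (cmod s)\<^sup>2 * nsq v"
        unfolding diff nsq_add_scale[OF l2_diff[OF f VH[OF u]] VH[OF v]] by simp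
      have 2: "nsq (T (u n + (\<lambda>\<sigma>. s * v \<sigma>))) =
          nsq (T (u n)) + 2 * Re (cnj s * ip (T (u n)) (T v)) + (cmod s)\<^sup>2 * nsq (T v)"
        unfolding T_add[OF u sv] T_scale[OF v] by (rule nsq_add_scale[OF T[OF u] T[OF v]])
      have "d \<le> J (u n + (\<lambda>\<sigma>. s * v \<sigma>))" using J_ge V_add u sv by blast
      also have "\<dots> = J (u n) - 2 * Re (cnj s * x n) + (cmod s)\<^sup>2 * K"
        unfolding J_def 1 2 K_def x_def by (simp add: algebra_simps)
      finally have d_le: "d \<le> J (u n) - 2 * Re (cnj s * x n) + (cmod s)\<^sup>2 * K" .
      define y where "y = (cmod (x n))\<^sup>2"
      have "cnj s * x n = complex_of_real y / complex_of_real (K + 1)"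
        unfolding y_def complex_norm_square by (simp add: s_def mult.commute)
      then have "cnj s * x n = complex_of_real (y / (K + 1))" by (simp only: of_real_divide)
      then have 3: "Re (cnj s * x n) = y / (K + 1)" by (simp only: Re_complex_of_real)
      have "cmod (complex_of_real (K + 1)) = K + 1"
        unfolding norm_of_real using K0 by simp
      then have 4: "(cmod s)\<^sup>2 = y / (K + 1)\<^sup>2"
        by (simp only: s_def y_def norm_divide power_divide)
      have "y / (K + 1) * (K / (K + 1)) \<le> y / (K + 1) * 1"
        using K0 by (intro mult_left_mono) (auto simp: y_def)
      then have 5: "y / (K + 1)\<^sup>2 * K \<le> y / (K + 1)"
        by (simp add: power2_eq_square)
      have "y / (K + 1) \<le> 1 / Suc n" using d_le Ju[of n] 5 unfolding 3 4 by argo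
      then show ?thesis using K0 by (simp add: field_simps y_def)
    qed
    have "(\<lambda>n. (K + 1) * (1 / Suc n)) \<longlonglongrightarrow> (K + 1) * 0"
      by (intro tendsto_intros LIMSEQ_Suc[OF lim_1_over_n])
    then have lim0: "(\<lambda>n. (cmod (x n))\<^sup>2) \<longlonglongrightarrow> 0"
      using bound by (intro tendsto_sandwich[of "\<lambda>_. 0" "\<lambda>n. (cmod (x n))\<^sup>2" _ "\<lambda>n. (K + 1) * (1 / Suc n)"]) auto
    then have "x \<longlonglongrightarrow> 0"
      using tendsto_real_sqrt[OF lim0] by (simp add: tendsto_norm_zero_iff)
    moreover have "x \<longlonglongrightarrow> (ip f v - ip p v) - ip q (T v)"
    proof -
      have "x = (\<lambda>n. ip f v - ip (u n) v - ip (T (u n)) (T v))"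
        unfolding x_def using ip_diff_left[OF f VH[OF u] VH[OF v]] by simp
      moreover have "\<dots> \<longlonglongrightarrow> (ip f v - ip p v) - ip q (T v)"
        using u v VH T p q
        by (intro tendsto_diff tendsto_const tendsto_ip_left[of u] tendsto_ip_left[of "\<lambda>n. T (u n)"]) auto
      ultimately show ?thesis by simp
    qed
    ultimately have "(ip f v - ip p v) - ip q (T v) = 0" by (metis LIMSEQ_unique)
    then show ?thesis using f p v VH by (simp add: ip_diff_left)
  qed
  with u p q show ?thesis by blast
qed

abbreviation cl :: "('v set \<Rightarrow> complex) set \<Rightarrow> ('v set \<Rightarrow> complex) set" where
  "cl \<equiv> l2_closure \<Sigma> m"

lemma l2_closure_iff:
  assumes "A \<subseteq> H"
  shows "f \<in> cl A \<longleftrightarrow> f \<in> H \<and> (\<exists>u. (\<forall>n. u n \<in> A) \<and> l2_tendsto u f)"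
proof -
  have "(\<lambda>n. l2_norm_sq \<Sigma> m (u n - f)) \<longlonglongrightarrow> 0 \<longleftrightarrow> l2_tendsto u f"
    if "f \<in> H" "\<forall>n. u n \<in> A" for u :: "nat \<Rightarrow> _"
  proof -
    have "(\<lambda>n. l2_norm_sq \<Sigma> m (u n - f)) = (\<lambda>n. ennreal (nsq (u n - f)))"
      using that assms by (auto simp: l2_norm_sq_eq l2_diff subset_iff)
    then show ?thesis
      using tendsto_ennreal_iff[of "\<lambda>n. nsq (u n - f)" sequentially 0] nsq_nonneg by simp
  qed
  then show ?thesis unfolding l2_closure_def by blast
qed

lemma l2_closure_subset: "cl A \<subseteq> H"
  by (auto simp: l2_closure_def)

lemma subset_l2_closure: "A \<subseteq> H \<Longrightarrow> A \<subseteq> cl A"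
proof
  fix f assume "A \<subseteq> H" "f \<in> A"
  then show "f \<in> cl A"
    by (auto simp: l2_closure_iff norm_sq_def intro!: exI[of _ "\<lambda>_. f"])
qed

lemma l2_closure_mono: "A \<subseteq> B \<Longrightarrow> cl A \<subseteq> cl B"
  unfolding l2_closure_def by blast

lemma l2_closure_ip_zero:
  assumes "A \<subseteq> H" "g \<in> H" "\<And>a. a \<in> A \<Longrightarrow> ip a g = 0" "f \<in> cl A"
  shows "ip f g = 0"
proof -
  obtain u where u: "\<forall>n. u n \<in> A" "f \<in> H" "l2_tendsto u f"
    using assms l2_closure_iff by blast
  have "(\<lambda>n. ip (u n) g) \<longlonglongrightarrow> ip f g" using u assms by (intro tendsto_ip_left) auto
  moreover have "(\<lambda>n. ip (u n) g) = (\<lambda>_. 0)" using u assms by auto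
  ultimately show ?thesis by (simp add: LIMSEQ_const_iff)
qed

lemma l2_closureE:
  assumes "A \<subseteq> H" "f \<in> cl A"
  obtains u where "\<forall>n. u n \<in> A" "f \<in> H" "l2_tendsto u f"
  using assms(2) unfolding l2_closure_iff[OF assms(1)] by (elim conjE exE)

lemma l2_closureI:
  assumes "A \<subseteq> H" "\<forall>n. u n \<in> A" "f \<in> H" "l2_tendsto u f"
  shows "f \<in> cl A"
  unfolding l2_closure_iff[OF assms(1)] by (intro conjI exI) (fact assms)+

lemma nsq_squeeze:
  assumes "\<And>n. nsq (a n) \<le> b n" "b \<longlonglongrightarrow> 0"
  shows "(\<lambda>n. nsq (a n)) \<longlonglongrightarrow> 0"
  by (rule tendsto_sandwich[OF _ _ tendsto_const assms(2)]) (simp_all add: nsq_nonneg assms(1))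

lemma closed_subspace_closure:
  assumes "linear_subspace \<Sigma> m A"
  shows "closed_subspace \<Sigma> m (cl A)"
proof -
  have AH: "A \<subseteq> H" and A0: "0 \<in> A" using linear_subspace_subset[OF assms] linear_subspace_zero[OF assms] by blast+
  let ?C = "cl A"
  have add: "f + g \<in> ?C" if f: "f \<in> ?C" and g: "g \<in> ?C" for f g
  proof -
    obtain u where u: "\<forall>n. u n \<in> A" "f \<in> H" "l2_tendsto u f"
      by (rule l2_closureE[OF AH f])
    obtain v where v: "\<forall>n. v n \<in> A" "g \<in> H" "l2_tendsto v g"
      by (rule l2_closureE[OF AH g])
    have lim: "(\<lambda>n. 2 * nsq (u n - f) + 2 * nsq (v n - g)) \<longlonglongrightarrow> 2 * 0 + 2 * 0"
      using u v by (intro tendsto_intros)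
    have "nsq (u n + v n - (f + g)) \<le> 2 * nsq (u n - f) + 2 * nsq (v n - g)" for n
    proof -
      have "u n + v n - (f + g) = (u n - f) + (v n - g)" by simp
      moreover have "u n - f \<in> H" "v n - g \<in> H" using u(1,2) v(1,2) AH l2_diff by blast+
      ultimately show ?thesis by (simp only: nsq_le_parallelogram)
    qed
    then have "(\<lambda>n. nsq (u n + v n - (f + g))) \<longlonglongrightarrow> 0"
      by (rule nsq_squeeze) (use lim in simp)
    moreover have "\<forall>n. u n + v n \<in> A" using u v linear_subspace_add[OF assms] by blast
    ultimately show ?thesis using u v AH l2_add by (intro l2_closureI[OF AH, of "\<lambda>n. u n + v n"]) auto
  qed
  have scale: "(\<lambda>\<sigma>. c * f \<sigma>) \<in> ?C" if f: "f \<in> ?C" for c f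
  proof -
    obtain u where u: "\<forall>n. u n \<in> A" "f \<in> H" "l2_tendsto u f"
      by (rule l2_closureE[OF AH f])
    have "nsq ((\<lambda>\<sigma>. c * u n \<sigma>) - (\<lambda>\<sigma>. c * f \<sigma>)) = (cmod c)\<^sup>2 * nsq (u n - f)" for n
    proof -
      have "(\<lambda>\<sigma>. c * u n \<sigma>) - (\<lambda>\<sigma>. c * f \<sigma>) = (\<lambda>\<sigma>. c * (u n - f) \<sigma>)"
        by (rule ext) (simp add: algebra_simps)
      moreover have "u n - f \<in> H" using u(1,2) AH l2_diff by blast
      ultimately show ?thesis by (simp only: nsq_scale)
    qed
    moreover have "(\<lambda>n. (cmod c)\<^sup>2 * nsq (u n - f)) \<longlonglongrightarrow> (cmod c)\<^sup>2 * 0"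
      using u by (intro tendsto_intros)
    ultimately have "(\<lambda>n. nsq ((\<lambda>\<sigma>. c * u n \<sigma>) - (\<lambda>\<sigma>. c * f \<sigma>))) \<longlonglongrightarrow> 0" by simp
    moreover have "\<forall>n. (\<lambda>\<sigma>. c * u n \<sigma>) \<in> A" using u linear_subspace_scale[OF assms] by blast
    ultimately show ?thesis using l2_scale[OF u(2)]
      by (intro l2_closureI[OF AH, of "\<lambda>n \<sigma>. c * u n \<sigma>"])
  qed
  have "cl ?C \<subseteq> ?C"
  proof
    fix f assume "f \<in> cl ?C"
    then obtain u where u: "\<forall>n. u n \<in> ?C" "f \<in> H" "l2_tendsto u f"
      by (rule l2_closureE[OF l2_closure_subset])
    have "\<exists>a\<in>A. nsq (a - u n) < 1 / Suc n" for n
    proof -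
      obtain v where v: "\<forall>k. v k \<in> A" "(\<lambda>k. nsq (v k - u n)) \<longlonglongrightarrow> 0"
        by (rule l2_closureE[OF AH u(1)[rule_format]]) blast
      have "eventually (\<lambda>k. nsq (v k - u n) < 1 / Suc n) sequentially"
        using v(2) by (rule order_tendstoD) simp
      then show ?thesis using v(1) by (auto simp: eventually_sequentially)
    qed
    then obtain a where a: "\<And>n. a n \<in> A" "\<And>n. nsq (a n - u n) < 1 / Suc n" by metis
    have "nsq (a n - f) \<le> 2 * (1 / Suc n) + 2 * nsq (u n - f)" for n
    proof -
      have "u n \<in> H" "a n \<in> H" using u a AH l2_closure_subset by blast+
      moreover have "a n - f = (a n - u n) + (u n - f)" by simp
      ultimately have "nsq (a n - f) \<le> 2 * nsq (a n - u n) + 2 * nsq (u n - f)"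
        using u(2) nsq_le_parallelogram[of "a n - u n" "u n - f"] by (simp only: l2_diff)
      then show ?thesis using a(2)[of n] by linarith
    qed
    moreover have "(\<lambda>n. 2 * (1 / Suc n) + 2 * nsq (u n - f)) \<longlonglongrightarrow> 2 * 0 + 2 * 0"
      using u by (intro tendsto_intros LIMSEQ_Suc[OF lim_1_over_n])
    ultimately have "l2_tendsto a f"
      by (intro nsq_squeeze[of "\<lambda>n. a n - f"]) simp_all
    then show "f \<in> ?C" using a u by (intro l2_closureI[OF AH, of a]) auto
  qed
  then show ?thesis
    using add scale l2_closure_subset subset_l2_closure[OF AH] A0
    by (auto simp: closed_subspace_def)
qed

lemma projection_on_closure:
  assumes V: "linear_subspace \<Sigma> m V" and f: "f \<in> H"
  shows "\<exists>p\<in>cl V. \<forall>v\<in>cl V. ip (f - p) v = 0"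
proof -
  note VH = linear_subspace_subset[OF V]
  have "\<exists>u p q. (\<forall>n. u n \<in> V) \<and> p \<in> H \<and> q \<in> H \<and> l2_tendsto u p \<and>
           (\<lambda>n. nsq (0 - q)) \<longlonglongrightarrow> 0 \<and> (\<forall>v\<in>V. ip (f - p) v = ip q 0)"
    by (rule regularized_projection[OF V f, where T = "\<lambda>_. 0"]) (use l2_zero in \<open>simp_all add: zero_fun_def\<close>)
  then obtain u p q where u: "\<forall>n. u n \<in> V" "p \<in> H" "l2_tendsto u p"
      and ortho: "\<forall>v\<in>V. ip (f - p) v = ip q 0" by (elim exE conjE)
  have p: "p \<in> cl V" by (rule l2_closureI[OF VH u(1,2,3)])
  have "ip (f - p) v = 0" if v: "v \<in> cl V" for v
  proof -
    have "ip v (f - p) = 0"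
    proof (rule l2_closure_ip_zero[OF VH _ _ v])
      show "f - p \<in> H" by (rule l2_diff[OF f u(2)])
      show "ip a (f - p) = 0" if "a \<in> V" for a
        using ortho that ip_zero_commute by (metis ip_zero_right)
    qed
    then show ?thesis using ip_zero_commute by blast
  qed
  with p show ?thesis by blast
qed

definition ortho :: "('v set \<Rightarrow> complex) set \<Rightarrow> ('v set \<Rightarrow> complex) set" where
  "ortho A = {f \<in> H. \<forall>a\<in>A. ip f a = 0}"

lemma orthoI: "f \<in> H \<Longrightarrow> (\<And>a. a \<in> A \<Longrightarrow> ip f a = 0) \<Longrightarrow> f \<in> ortho A"
  by (simp add: ortho_def)

lemma orthoD: "f \<in> ortho A \<Longrightarrow> a \<in> A \<Longrightarrow> ip f a = 0"
  by (simp add: ortho_def)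

lemma ortho_subset: "ortho A \<subseteq> H"
  by (auto simp: ortho_def)

lemma closed_subspace_ortho:
  assumes A: "A \<subseteq> H"
  shows "closed_subspace \<Sigma> m (ortho A)"
  unfolding closed_subspace_def
proof (intro conjI ballI allI)
  show "cl (ortho A) \<subseteq> ortho A"
  proof
    fix f assume f: "f \<in> cl (ortho A)"
    have "ip f a = 0" if a: "a \<in> A" for a
      using A a orthoD by (intro l2_closure_ip_zero[OF ortho_subset _ _ f]) blast+
    then show "f \<in> ortho A" using f l2_closure_subset by (intro orthoI) blast+
  qed
  show "ortho A \<subseteq> H" by (rule ortho_subset)
  show "0 \<in> ortho A" by (simp add: ortho_def l2_zero)
next
  fix f g assume f: "f \<in> ortho A" and g: "g \<in> ortho A"
  have H: "f \<in> H" "g \<in> H" using f g ortho_subset by blast+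
  show "f + g \<in> ortho A"
  proof (rule orthoI)
    show "f + g \<in> H" using H by (rule l2_add)
    fix a assume a: "a \<in> A"
    then have "a \<in> H" using A by blast
    then show "ip (f + g) a = 0" using orthoD[OF f a] orthoD[OF g a] H by (simp add: ip_add_left)
  qed
next
  fix c f assume f: "f \<in> ortho A"
  have H: "f \<in> H" using f ortho_subset by blast
  show "(\<lambda>\<sigma>. c * f \<sigma>) \<in> ortho A"
  proof (rule orthoI)
    show "(\<lambda>\<sigma>. c * f \<sigma>) \<in> H" using H by (rule l2_scale)
    fix a assume a: "a \<in> A"
    then have "a \<in> H" using A by blast
    then show "ip (\<lambda>\<sigma>. c * f \<sigma>) a = 0" using orthoD[OF f a] H by (simp add: ip_scale_left)
  qed
qed

lemma closed_subspace_Int: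
  "closed_subspace \<Sigma> m A \<Longrightarrow> closed_subspace \<Sigma> m B \<Longrightarrow> closed_subspace \<Sigma> m (A \<inter> B)"
  using l2_closure_mono[of "A \<inter> B" A] l2_closure_mono[of "A \<inter> B" B]
  unfolding closed_subspace_def by blast

lemma closed_subspace_imp_linear: "closed_subspace \<Sigma> m A \<Longrightarrow> linear_subspace \<Sigma> m A"
  unfolding closed_subspace_def linear_subspace_def by blast

lemma closure_subset_ortho:
  assumes A: "A \<subseteq> H" and B: "B \<subseteq> H" and AB: "A \<subseteq> ortho B"
  shows "cl A \<subseteq> ortho (cl B)"
proof
  fix f assume f: "f \<in> cl A"
  have fH: "f \<in> H" using f l2_closure_subset by blast
  have fb: "ip b f = 0" if b: "b \<in> B" for b
  proof -
    have "ip f b = 0"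
      by (rule l2_closure_ip_zero[OF A _ _ f]) (use b B AB orthoD in blast)+
    then show ?thesis using ip_zero_commute by blast
  qed
  show "f \<in> ortho (cl B)"
  proof (rule orthoI[OF fH])
    fix g assume "g \<in> cl B"
    then have "ip g f = 0" by (rule l2_closure_ip_zero[OF B fH fb, rotated])
    then show "ip f g = 0" using ip_zero_commute by blast
  qed
qed

lemma ortho_closure_subset: "A \<subseteq> H \<Longrightarrow> ortho A \<subseteq> ortho (cl A)"
proof
  fix f assume A: "A \<subseteq> H" and f: "f \<in> ortho A"
  have fH: "f \<in> H" using f ortho_subset by blast
  show "f \<in> ortho (cl A)"
  proof (rule orthoI[OF fH])
    fix g assume g: "g \<in> cl A"
    have "ip g f = 0"
      by (rule l2_closure_ip_zero[OF A fH _ g]) (use orthoD[OF f] ip_zero_commute in blast)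
    then show "ip f g = 0" using ip_zero_commute by blast
  qed
qed

lemma ortho_commute:
  assumes B: "B \<subseteq> H" and AB: "A \<subseteq> ortho B"
  shows "B \<subseteq> ortho A"
proof
  fix b assume b: "b \<in> B"
  show "b \<in> ortho A"
  proof (rule orthoI)
    show "b \<in> H" using b B by blast
    fix a assume "a \<in> A"
    then have "ip a b = 0" using AB b orthoD by blast
    then show "ip b a = 0" using ip_zero_commute by blast
  qed
qed

text \<open>For orthogonal \<open>B\<close> and \<open>C\<close>, the remainder of \<open>f\<close> after subtracting its projections onto both closures
is orthogonal to each of them.\<close>

lemma orthogonal_sum3_complement:
  assumes B: "linear_subspace \<Sigma> m B" and C: "linear_subspace \<Sigma> m C" and BC: "B \<subseteq> ortho C"
  shows "orthogonal_sum3 \<Sigma> m H (ortho B \<inter> ortho C) (cl B) (cl C)"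
proof -
  note BH = linear_subspace_subset[OF B] and CH = linear_subspace_subset[OF C]
  let ?B = "cl B" and ?C = "cl C"
  have closed: "closed_subspace \<Sigma> m (ortho B \<inter> ortho C)" "closed_subspace \<Sigma> m ?B" "closed_subspace \<Sigma> m ?C"
    by (intro closed_subspace_Int closed_subspace_ortho closed_subspace_closure BH CH B C)+
  have BC': "ip b c = 0" if "b \<in> ?B" "c \<in> ?C" for b c
    using closure_subset_ortho[OF BH CH BC] that orthoD by blast
  have AB: "ip a b = 0" if "a \<in> ortho B" "b \<in> ?B" for a b
    using ortho_closure_subset[OF BH] that orthoD by blast
  have AC: "ip a c = 0" if "a \<in> ortho C" "c \<in> ?C" for a c
    using ortho_closure_subset[OF CH] that orthoD by blast
  have "f \<in> {a + b + c | a b c. a \<in> ortho B \<inter> ortho C \<and> b \<in> ?B \<and> c \<in> ?C}" if f: "f \<in> H" for f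
  proof -
    obtain b where b: "b \<in> ?B" "\<forall>v\<in>?B. ip (f - b) v = 0" using projection_on_closure[OF B f] by blast
    obtain c where c: "c \<in> ?C" "\<forall>v\<in>?C. ip (f - c) v = 0" using projection_on_closure[OF C f] by blast
    have bcH: "b \<in> H" "c \<in> H" using b(1) c(1) l2_closure_subset by blast+
    define a where "a = f - b - c"
    have aH: "a \<in> H" unfolding a_def by (intro l2_diff f bcH)
    have "a \<in> ortho B"
    proof (rule orthoI[OF aH])
      fix v assume v: "v \<in> B"
      have v': "v \<in> ?B" "v \<in> H" using v subset_l2_closure[OF BH] BH by blast+
      have "ip c v = 0" using BC'[OF v'(1) c(1)] ip_zero_commute by blast
      then show "ip a v = 0"
        unfolding a_def ip_diff_left[OF l2_diff[OF f bcH(1)] bcH(2) v'(2)] using b(2) v' by simp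
    qed
    moreover have "a \<in> ortho C"
    proof (rule orthoI[OF aH])
      fix v assume v: "v \<in> C"
      have v': "v \<in> ?C" "v \<in> H" using v subset_l2_closure[OF CH] CH by blast+
      have a: "a = f - c - b" by (simp add: a_def)
      show "ip a v = 0"
        unfolding a ip_diff_left[OF l2_diff[OF f bcH(2)] bcH(1) v'(2)]
        using BC'[OF b(1) v'(1)] c(2) v' by simp
    qed
    moreover have "f = a + b + c" by (simp add: a_def)
    ultimately show ?thesis using b(1) c(1) by blast
  qed
  moreover have "a + b + c \<in> H" if "a \<in> ortho B" "b \<in> ?B" "c \<in> ?C" for a b c
    using that ortho_subset l2_closure_subset l2_add by blast
  ultimately have "H = {a + b + c | a b c. a \<in> ortho B \<inter> ortho C \<and> b \<in> ?B \<and> c \<in> ?C}" by blast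
  then show ?thesis
    unfolding orthogonal_sum3_def l2_orthogonal_def using closed AB AC BC' by blast
qed

text \<open>If \<open>b\<close> is orthogonal to \<open>R\<close>, then \<open>b\<close> is the element of least norm in its coset, by Pythagoras.\<close>

lemma quotient_norm_orthogonal:
  assumes R: "linear_subspace \<Sigma> m R" and b: "b \<in> H" "\<And>r. r \<in> R \<Longrightarrow> ip b r = 0"
  shows "quotient_norm \<Sigma> m {b + r | r. r \<in> R} = sqrt (nsq b)"
  unfolding quotient_norm_def
proof (rule cInf_eq_minimum)
  have "b = b + 0" by simp
  then have "b \<in> {b + r | r. r \<in> R}" using linear_subspace_zero[OF R] by blast
  then have "l2_norm \<Sigma> m b \<in> l2_norm \<Sigma> m ` {b + r | r. r \<in> R}" by (rule imageI)
  then show "sqrt (nsq b) \<in> l2_norm \<Sigma> m ` {b + r | r. r \<in> R}" by (simp only: l2_norm_eq[OF b(1)])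
next
  fix x assume "x \<in> l2_norm \<Sigma> m ` {b + r | r. r \<in> R}"
  then obtain r where r: "r \<in> R" "x = l2_norm \<Sigma> m (b + r)" by blast
  have rH: "r \<in> H" using r linear_subspace_subset[OF R] by blast
  have "nsq (b + r) = nsq b + nsq r" using b r rH by (simp add: nsq_add)
  then show "sqrt (nsq b) \<le> x"
    using nsq_nonneg[of r] l2_norm_eq[OF l2_add[OF b(1) rH]] r by simp
qed

lemma polarization:
  assumes f: "f \<in> H" and g: "g \<in> H"
  shows "(\<Sum>j<(4::nat). \<i> ^ j * complex_of_real (nsq (f + (\<lambda>\<sigma>. \<i> ^ j * g \<sigma>)))) / 4 = ip f g"
proof -
  have n: "nsq (f + (\<lambda>\<sigma>. c * g \<sigma>)) = nsq f + nsq g + 2 * (Re c * Re (ip f g) + Im c * Im (ip f g))"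
    if "cmod c = 1" for c
    using nsq_add_scale[OF f g, of c] that by (simp add: algebra_simps)
  have "(\<Sum>j<(4::nat). \<i> ^ j * complex_of_real (nsq (f + (\<lambda>\<sigma>. \<i> ^ j * g \<sigma>)))) =
      complex_of_real (nsq (f + (\<lambda>\<sigma>. 1 * g \<sigma>))) + \<i> * complex_of_real (nsq (f + (\<lambda>\<sigma>. \<i> * g \<sigma>)))
      - complex_of_real (nsq (f + (\<lambda>\<sigma>. (-1) * g \<sigma>))) - \<i> * complex_of_real (nsq (f + (\<lambda>\<sigma>. (-\<i>) * g \<sigma>)))"
    by (simp add: eval_nat_numeral)
  also have "\<dots> = 4 * ip f g"
    unfolding n[of 1, simplified norm_one, OF refl] n[of \<i>, simplified norm_ii, OF refl]
      n[of "-1", simplified norm_minus_cancel norm_one, OF refl]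
      n[of "-\<i>", simplified norm_minus_cancel norm_ii, OF refl]
    by (simp add: complex_eq_iff)
  finally show ?thesis by simp
qed

text \<open>Every coset of \<open>R\<close> in \<open>A\<close> contains exactly one element of the orthogonal complement \<open>B\<close>. Sending the
coset to this element is isometric for the quotient norm by \<open>quotient_norm_orthogonal\<close>, hence it also
preserves the inner product that polarization recovers from that norm.\<close>

lemma quotient_isomorphic_orthogonal_complement:
  assumes A: "closed_subspace \<Sigma> m A" and R: "closed_subspace \<Sigma> m R" and B: "closed_subspace \<Sigma> m B"
    and RA: "R \<subseteq> A" and BA: "B \<subseteq> A" and orth: "\<And>b r. b \<in> B \<Longrightarrow> r \<in> R \<Longrightarrow> ip b r = 0"
    and decomp: "\<And>a. a \<in> A \<Longrightarrow> \<exists>b\<in>B. \<exists>r\<in>R. a = b + r"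
  shows "quotient_isomorphic \<Sigma> m A R B"
proof -
  note Al = closed_subspace_imp_linear[OF A] and Rl = closed_subspace_imp_linear[OF R]
    and Bl = closed_subspace_imp_linear[OF B]
  define cs where "cs f = {f + r | r. r \<in> R}" for f
  let ?G = "l2_quotient \<Sigma> m A R" and ?H = "l2_subspace \<Sigma> m B"
  have BH: "b \<in> H" if "b \<in> B" for b using that linear_subspace_subset[OF Bl] by blast
  have RH: "r \<in> H" if "r \<in> R" for r using that linear_subspace_subset[OF Rl] by blast
  have cs_shift: "cs (b + r) = cs b" if r: "r \<in> R" for b r
  proof
    show "cs (b + r) \<subseteq> cs b"
      using linear_subspace_add[OF Rl r] unfolding cs_def by (auto simp: add.assoc)
    show "cs b \<subseteq> cs (b + r)"
    proof
      fix f assume "f \<in> cs b"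
      then obtain r' where r': "r' \<in> R" "f = b + r'" unfolding cs_def by blast
      have "f = b + r + (r' - r)" using r' by simp
      then show "f \<in> cs (b + r)" unfolding cs_def using linear_subspace_diff[OF Rl r'(1) r] by blast
    qed
  qed
  have cs_inj: "b = b'" if b: "b \<in> B" and b': "b' \<in> B" and eq: "cs b = cs b'" for b b'
  proof -
    have "b = b + 0" by simp
    then have "b \<in> cs b" unfolding cs_def using linear_subspace_zero[OF Rl] by blast
    then obtain r where r: "r \<in> R" "b = b' + r" unfolding eq unfolding cs_def by blast
    have "b - b' = r" using r by simp
    then have "b - b' \<in> R" using r by simp
    then have "ip (b - b') (b - b') = 0"
      by (rule orth[OF linear_subspace_diff[OF Bl b b']])
    then have "nsq (b - b') = 0" by (simp add: ip_self)
    then have "b - b' = 0" by (rule nsq_eq_0[OF l2_diff[OF BH[OF b] BH[OF b']]])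
    then show ?thesis by simp
  qed
  have G_carrier: "ip_carrier ?G = cs ` B"
  proof -
    have "cs ` A = cs ` B"
    proof
      show "cs ` A \<subseteq> cs ` B"
      proof
        fix U assume "U \<in> cs ` A"
        then obtain a where a: "a \<in> A" "U = cs a" by blast
        obtain b r where "b \<in> B" "r \<in> R" "a = b + r" using decomp[OF a(1)] by blast
        then show "U \<in> cs ` B" using a cs_shift by blast
      qed
      show "cs ` B \<subseteq> cs ` A" using BA by blast
    qed
    then show ?thesis by (simp add: l2_quotient_def cs_def)
  qed
  have bij: "bij_betw cs B (ip_carrier ?G)"
    unfolding G_carrier using cs_inj by (intro inj_on_imp_bij_betw inj_onI)
  define \<phi> where "\<phi> = the_inv_into B cs"
  have \<phi>: "\<phi> (cs b) = b" if "b \<in> B" for b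
    unfolding \<phi>_def using bij that by (intro the_inv_into_f_f) (simp add: bij_betw_def)
  have add: "coset_add (cs b) (cs b') = cs (b + b')" for b b'
  proof
    show "coset_add (cs b) (cs b') \<subseteq> cs (b + b')"
    proof
      fix f assume "f \<in> coset_add (cs b) (cs b')"
      then obtain r r' where r: "r \<in> R" "r' \<in> R" "f = (b + r) + (b' + r')"
        unfolding coset_add_def cs_def by blast
      have "f = (b + b') + (r + r')" using r by (simp add: algebra_simps)
      then show "f \<in> cs (b + b')" unfolding cs_def using linear_subspace_add[OF Rl r(1,2)] by blast
    qed
    show "cs (b + b') \<subseteq> coset_add (cs b) (cs b')"
    proof
      fix f assume "f \<in> cs (b + b')"
      then obtain r where r: "r \<in> R" "f = b + b' + r" unfolding cs_def by blast
      have "f = (b + r) + (b' + 0)" using r by (simp add: algebra_simps)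
      moreover have "b + r \<in> cs b" "b' + 0 \<in> cs b'"
        unfolding cs_def using r(1) linear_subspace_zero[OF Rl] by blast+
      ultimately show "f \<in> coset_add (cs b) (cs b')" unfolding coset_add_def by blast
    qed
  qed
  have scale: "coset_scale R c (cs b) = cs (\<lambda>\<sigma>. c * b \<sigma>)" for c b
  proof
    show "coset_scale R c (cs b) \<subseteq> cs (\<lambda>\<sigma>. c * b \<sigma>)"
    proof
      fix f assume "f \<in> coset_scale R c (cs b)"
      then obtain r r' where r: "r \<in> R" "r' \<in> R" "f = (\<lambda>\<sigma>. c * (b + r) \<sigma>) + r'"
        unfolding coset_scale_def cs_def by blast
      have "f = (\<lambda>\<sigma>. c * b \<sigma>) + ((\<lambda>\<sigma>. c * r \<sigma>) + r')"
        unfolding r(3) by (rule ext) (simp add: algebra_simps)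
      then show "f \<in> cs (\<lambda>\<sigma>. c * b \<sigma>)" unfolding cs_def
        using linear_subspace_add[OF Rl linear_subspace_scale[OF Rl r(1)] r(2)] by blast
    qed
    show "cs (\<lambda>\<sigma>. c * b \<sigma>) \<subseteq> coset_scale R c (cs b)"
    proof
      fix f assume "f \<in> cs (\<lambda>\<sigma>. c * b \<sigma>)"
      then obtain r where r: "r \<in> R" "f = (\<lambda>\<sigma>. c * b \<sigma>) + r" unfolding cs_def by blast
      have "b = b + 0" by simp
      then have "b \<in> cs b" unfolding cs_def using linear_subspace_zero[OF Rl] by blast
      then show "f \<in> coset_scale R c (cs b)" unfolding coset_scale_def using r by blast
    qed
  qed
  have norm: "(quotient_norm \<Sigma> m (cs b))\<^sup>2 = nsq b" if b: "b \<in> B" for b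
    unfolding cs_def using quotient_norm_orthogonal[OF Rl BH[OF b] orth[OF b]] nsq_nonneg[of b] by simp
  have inner: "ip_inner ?G (cs b) (cs b') = ip b b'" if b: "b \<in> B" and b': "b' \<in> B" for b b'
  proof -
    have "ip_inner ?G (cs b) (cs b') =
        (\<Sum>j<(4::nat). \<i> ^ j * complex_of_real (nsq (b + (\<lambda>\<sigma>. \<i> ^ j * b' \<sigma>)))) / 4"
      unfolding l2_quotient_def ip_space.select_convs scale add
        norm[OF linear_subspace_add[OF Bl b linear_subspace_scale[OF Bl b']]] ..
    then show ?thesis unfolding polarization[OF BH[OF b] BH[OF b']] .
  qed
  have "ip_isomorphic ?G ?H"
    unfolding ip_isomorphic_def
  proof (intro exI[of _ \<phi>] conjI ballI allI)
    show "bij_betw \<phi> (ip_carrier ?G) (ip_carrier ?H)"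
      unfolding \<phi>_def using bij_betw_the_inv_into[OF bij] by (simp add: l2_subspace_def)
  next
    fix U V assume U: "U \<in> ip_carrier ?G" and V: "V \<in> ip_carrier ?G"
    obtain b where b: "b \<in> B" "U = cs b" using U G_carrier by blast
    obtain b' where b': "b' \<in> B" "V = cs b'" using V G_carrier by blast
    show "\<phi> (ip_add ?G U V) = ip_add ?H (\<phi> U) (\<phi> V)"
      using \<phi>[OF b(1)] \<phi>[OF b'(1)] \<phi>[OF linear_subspace_add[OF Bl b(1) b'(1)]]
      by (simp add: l2_quotient_def l2_subspace_def b b' add)
    show "ip_inner ?H (\<phi> U) (\<phi> V) = ip_inner ?G U V"
      unfolding b b' inner[OF b(1) b'(1)] \<phi>[OF b(1)] \<phi>[OF b'(1)] by (simp add: l2_subspace_def)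
  next
    fix c U assume U: "U \<in> ip_carrier ?G"
    obtain b where b: "b \<in> B" "U = cs b" using U G_carrier by blast
    show "\<phi> (ip_scale ?G c U) = ip_scale ?H c (\<phi> U)"
      using \<phi>[OF b(1)] \<phi>[OF linear_subspace_scale[OF Bl b(1), of c]]
      by (simp add: l2_quotient_def l2_subspace_def b scale)
  qed
  then show ?thesis unfolding quotient_isomorphic_def using A R B RA by blast
qed

end

section \<open>Recurrence and finitely supported approximations of the constant function\<close>

text \<open>The probability that a walk with transition probabilities \<open>p\<close> started at \<open>x\<close> visits \<open>base\<close> at one of
the times \<open>1, ..., k\<close> while staying in \<open>K\<close> up to that visit.\<close>

fun return_prob :: "('v \<Rightarrow> 'v \<Rightarrow> real) \<Rightarrow> 'v \<Rightarrow> 'v set \<Rightarrow> nat \<Rightarrow> 'v \<Rightarrow> real" where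
  "return_prob p base K 0 x = 0"
| "return_prob p base K (Suc k) x =
     (\<Sum>z\<in>K. p x z * (if z = base then 1 else return_prob p base K k z))"

text \<open>The visit may now also happen at time \<open>0\<close>, and the walk is killed outside of \<open>K\<close>: the value \<open>0\<close> there
gives the function finite support when \<open>K\<close> is finite.\<close>

definition hit_prob :: "('v \<Rightarrow> 'v \<Rightarrow> real) \<Rightarrow> 'v \<Rightarrow> 'v set \<Rightarrow> nat \<Rightarrow> 'v \<Rightarrow> real" where
  "hit_prob p base K k z = (if z = base then 1 else if z \<in> K then return_prob p base K k z else 0)"

locale finite_walk =
  fixes p :: "'v \<Rightarrow> 'v \<Rightarrow> real" and base :: 'v and K :: "'v set"
  assumes finite_K: "finite K" and base_mem: "base \<in> K"
    and p_nonneg: "x \<in> K \<Longrightarrow> z \<in> K \<Longrightarrow> 0 \<le> p x z"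
    and p_sum: "x \<in> K \<Longrightarrow> (\<Sum>z\<in>K. p x z) \<le> 1"
begin

lemma return_prob_Suc: "return_prob p base K (Suc k) x = (\<Sum>z\<in>K. p x z * hit_prob p base K k z)"
  by (auto simp: hit_prob_def intro!: sum.cong)

lemma return_prob_bounds: "x \<in> K \<Longrightarrow> 0 \<le> return_prob p base K k x \<and> return_prob p base K k x \<le> 1"
proof (induction k arbitrary: x)
  case (Suc k)
  have h: "0 \<le> hit_prob p base K k z \<and> hit_prob p base K k z \<le> 1" for z
    using Suc.IH[of z] by (auto simp: hit_prob_def)
  have "(\<Sum>z\<in>K. p x z * hit_prob p base K k z) \<le> (\<Sum>z\<in>K. p x z * 1)"
    using h p_nonneg Suc.prems by (intro sum_mono mult_left_mono) auto
  also have "\<dots> \<le> 1" using p_sum Suc.prems by simp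
  finally show ?case
    unfolding return_prob_Suc using h p_nonneg Suc.prems by (auto intro!: sum_nonneg)
qed auto

lemma hit_prob_bounds: "0 \<le> hit_prob p base K k z" "hit_prob p base K k z \<le> 1"
  using return_prob_bounds[of z k] by (auto simp: hit_prob_def)

text \<open>By conditioning on the first step, this monotonicity in the number of steps
makes \<open>hit_prob\<close> subharmonic away from the base vertex.\<close>

lemma return_prob_mono_step: "x \<in> K \<Longrightarrow> return_prob p base K k x \<le> return_prob p base K (Suc k) x"
proof (induction k arbitrary: x)
  case 0
  then show ?case using return_prob_bounds[of x "Suc 0"] by simp
next
  case (Suc k)
  have "hit_prob p base K k z \<le> hit_prob p base K (Suc k) z" for z
    using Suc.IH[of z] by (auto simp: hit_prob_def simp del: return_prob.simps)
  then show ?case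
    unfolding return_prob_Suc[of "Suc k"] return_prob_Suc[of k] using p_nonneg Suc.prems
    by (intro sum_mono mult_left_mono) auto
qed

lemma hit_prob_subharmonic:
  assumes "x \<in> K" "x \<noteq> base"
  shows "hit_prob p base K k x \<le> (\<Sum>z\<in>K. p x z * hit_prob p base K k z)"
  using return_prob_mono_step[OF assms(1), of k] assms
  unfolding return_prob_Suc by (simp add: hit_prob_def[of p base K k x])

end

lemma markov_event_sets:
  assumes "sets M = sets (Pi\<^sub>M UNIV (\<lambda>_. count_space C))"
  shows "{w \<in> space M. w i \<in> A} \<in> sets M"
proof -
  have [measurable_cong]: "sets M = sets (Pi\<^sub>M UNIV (\<lambda>_. count_space C))" by (fact assms)
  have "(\<lambda>w. w i) \<in> M \<rightarrow>\<^sub>M count_space C" by measurable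
  then have "(\<lambda>w. w i) -` (A \<inter> C) \<inter> space M \<in> sets M"
    by (rule measurable_sets) simp
  moreover have "{w \<in> space M. w i \<in> A} = (\<lambda>w. w i) -` (A \<inter> C) \<inter> space M"
    using sets_eq_imp_space_eq[OF assms] by (auto simp: space_PiM PiE_iff)
  ultimately show ?thesis by (simp only:)
qed

text \<open>The law of the chain is described by its values on cylinders, so the estimate is made on
cylinders, for a path \<open>a\<close> of arbitrary length; the first step after time \<open>n\<close> extends the cylinder by one vertex of \<open>K\<close>,
and there are finitely many of these.\<close>

lemma markov_cylinder_le_return_prob:
  assumes M: "markov_chain_law C p x M"
    and K: "finite K" "K \<subseteq> C" and a: "\<forall>i. a i \<in> C"
  shows "measure M {w \<in> space M. (\<forall>i\<le>n. w i = a i) \<and>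
            (\<exists>j. n < j \<and> j \<le> n + k \<and> w j = base \<and> (\<forall>i. n < i \<and> i \<le> j \<longrightarrow> w i \<in> K))}
         \<le> measure M {w \<in> space M. \<forall>i\<le>n. w i = a i} * return_prob p base K k (a n)"
  using a
proof (induction k arbitrary: n a)
  case 0
  have "{w \<in> space M. (\<forall>i\<le>n. w i = a i) \<and>
            (\<exists>j. n < j \<and> j \<le> n + 0 \<and> w j = base \<and> (\<forall>i. n < i \<and> i \<le> j \<longrightarrow> w i \<in> K))} = {}" by auto
  then show ?case by (simp only: measure_empty return_prob.simps mult_zero_right order_refl)
next
  case (Suc k)
  interpret prob_space M using M by (simp add: markov_chain_law_def)
  have sM: "sets M = sets (Pi\<^sub>M UNIV (\<lambda>_. count_space C))"
    using M by (simp add: markov_chain_law_def)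
  have [measurable]: "Measurable.pred M (\<lambda>w. w i \<in> A)" for i A
    using markov_event_sets[OF sM] by (simp add: pred_def)
  have [measurable]: "Measurable.pred M (\<lambda>w. w i = c)" for i c
    using markov_event_sets[OF sM, of i "{c}"] by (simp add: pred_def)
  define E where "E k n a = {w \<in> space M. (\<forall>i\<le>n. w i = a i) \<and>
            (\<exists>j. n < j \<and> j \<le> n + k \<and> w j = base \<and> (\<forall>i. n < i \<and> i \<le> j \<longrightarrow> w i \<in> K))}" for k n a
  define Z where "Z n a = {w \<in> space M. \<forall>i\<le>n. w i = a i}" for n :: nat and a
  define a' where "a' z = a(Suc n := z)" for z
  have E_meas: "E k n a \<in> sets M" for k n a unfolding E_def by measurable
  have Z_meas: "Z n a \<in> sets M" for n a unfolding Z_def by measurable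
  have a': "\<forall>i. a' z i \<in> C" if "z \<in> K" for z using that Suc.prems K by (auto simp: a'_def)
  have Z': "measure M (Z (Suc n) (a' z)) = measure M (Z n a) * p (a n) z" if z: "z \<in> K" for z
  proof -
    have "measure M (Z (Suc n) (a' z)) = measure M (Z n (a' z)) * p (a' z n) (a' z (Suc n))"
      using M a'[OF z] unfolding markov_chain_law_def Z_def by blast
    moreover have "Z n (a' z) = Z n a" by (auto simp: Z_def a'_def)
    ultimately show ?thesis by (simp add: a'_def)
  qed
  have sub: "E (Suc k) n a \<subseteq> (\<Union>z\<in>K. if z = base then Z (Suc n) (a' z) else E k (Suc n) (a' z))"
  proof
    fix w assume "w \<in> E (Suc k) n a"
    then obtain j where w: "w \<in> space M" "\<forall>i\<le>n. w i = a i" and j: "n < j" "j \<le> n + Suc k" "w j = base"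
      and wK: "\<forall>i. n < i \<and> i \<le> j \<longrightarrow> w i \<in> K" by (auto simp: E_def)
    let ?z = "w (Suc n)"
    have z: "?z \<in> K" using wK j by auto
    have cyl: "\<forall>i\<le>Suc n. w i = a' ?z i" using w by (auto simp: a'_def le_Suc_eq)
    have "w \<in> E k (Suc n) (a' ?z)" if "?z \<noteq> base"
    proof -
      have "Suc n < j" using that j by (cases "j = Suc n") auto
      then have "\<exists>j. Suc n < j \<and> j \<le> Suc n + k \<and> w j = base \<and> (\<forall>i. Suc n < i \<and> i \<le> j \<longrightarrow> w i \<in> K)"
        using j wK by (intro exI[of _ j]) simp
      then have "(\<forall>i\<le>Suc n. w i = a' ?z i) \<and>
          (\<exists>j. Suc n < j \<and> j \<le> Suc n + k \<and> w j = base \<and> (\<forall>i. Suc n < i \<and> i \<le> j \<longrightarrow> w i \<in> K))"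
        using cyl by (rule conjI[rotated])
      then show ?thesis unfolding E_def mem_Collect_eq by (rule conjI[OF w(1)])
    qed
    moreover have "w \<in> Z (Suc n) (a' ?z)"
      unfolding Z_def mem_Collect_eq by (rule conjI[OF w(1) cyl])
    ultimately have "w \<in> (if ?z = base then Z (Suc n) (a' ?z) else E k (Suc n) (a' ?z))"
      by (cases "?z = base") simp_all
    then show "w \<in> (\<Union>z\<in>K. if z = base then Z (Suc n) (a' z) else E k (Suc n) (a' z))"
      by (rule UN_I[OF z])
  qed
  have "measure M (E (Suc k) n a) \<le>
      measure M (\<Union>z\<in>K. if z = base then Z (Suc n) (a' z) else E k (Suc n) (a' z))"
    using K by (intro finite_measure_mono[OF sub]) (auto intro!: sets.finite_UN E_meas Z_meas)
  also have "\<dots> \<le> (\<Sum>z\<in>K. measure M (if z = base then Z (Suc n) (a' z) else E k (Suc n) (a' z)))"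
    using K by (intro finite_measure_subadditive_finite) (auto intro!: E_meas Z_meas)
  also have "\<dots> \<le> (\<Sum>z\<in>K. measure M (Z n a) * (p (a n) z * (if z = base then 1 else return_prob p base K k z)))"
  proof (rule sum_mono)
    fix z assume z: "z \<in> K"
    have "measure M (E k (Suc n) (a' z)) \<le> measure M (Z (Suc n) (a' z)) * return_prob p base K k (a' z (Suc n))"
      unfolding E_def Z_def by (rule Suc.IH) (rule a'[OF z])
    then show "measure M (if z = base then Z (Suc n) (a' z) else E k (Suc n) (a' z))
        \<le> measure M (Z n a) * (p (a n) z * (if z = base then 1 else return_prob p base K k z))"
      using Z'[OF z] by (cases "z = base") (simp_all add: a'_def mult.assoc)
  qed
  also have "\<dots> = measure M (Z n a) * return_prob p base K (Suc k) (a n)"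
    by (simp add: sum_distrib_left)
  finally show ?case unfolding E_def Z_def .
qed

text \<open>A path that returns to the base vertex does so after finitely many steps and visits finitely
many vertices until then. Hence the events of returning within \<open>n\<close> steps inside \<open>K n\<close> exhaust the event of returning at all.\<close>

lemma recurrence_imp_return_prob_tendsto:
  assumes M: "markov_chain_law C p x M" and x: "x \<in> C"
    and rec: "measure M {w \<in> space M. \<exists>k>0. w k = base} = 1"
    and K: "\<And>n. finite (K n)" "\<And>n. K n \<subseteq> C" "incseq K" "(\<Union>n. K n) = C"
    and bound: "\<forall>\<^sub>F n in sequentially. return_prob p base (K n) n x \<le> 1"
  shows "(\<lambda>n. return_prob p base (K n) n x) \<longlonglongrightarrow> 1"
proof -
  interpret prob_space M using M by (simp add: markov_chain_law_def)
  have sM: "sets M = sets (Pi\<^sub>M UNIV (\<lambda>_. count_space C))"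
    using M by (simp add: markov_chain_law_def)
  have wC: "w i \<in> C" if "w \<in> space M" for w i
    using that sets_eq_imp_space_eq[OF sM] by (auto simp: space_PiM PiE_iff)
  have [measurable]: "Measurable.pred M (\<lambda>w. w i \<in> A)" for i A
    using markov_event_sets[OF sM] by (simp add: pred_def)
  have [measurable]: "Measurable.pred M (\<lambda>w. w i = c)" for i c
    using markov_event_sets[OF sM, of i "{c}"] by (simp add: pred_def)
  define E where "E n = {w \<in> space M. \<exists>j. 0 < j \<and> j \<le> n \<and> w j = base \<and> (\<forall>i. 0 < i \<and> i \<le> j \<longrightarrow> w i \<in> K n)}" for n
  have E_meas: "range E \<subseteq> sets M" unfolding E_def by (auto; measurable)
  have "incseq E"
    unfolding incseq_def
  proof (intro allI impI subsetI)
    fix l n w assume le: "l \<le> n" and "w \<in> E l"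
    then obtain j where w: "w \<in> space M" "0 < j" "j \<le> l" "w j = base" "\<forall>i. 0 < i \<and> i \<le> j \<longrightarrow> w i \<in> K l"
      by (auto simp: E_def)
    have "K l \<subseteq> K n" using K(3) le by (rule incseqD)
    then have "0 < j \<and> j \<le> n \<and> w j = base \<and> (\<forall>i. 0 < i \<and> i \<le> j \<longrightarrow> w i \<in> K n)"
      using w le by auto
    then show "w \<in> E n" using w(1) unfolding E_def by blast
  qed
  then have lim: "(\<lambda>n. measure M (E n)) \<longlonglongrightarrow> measure M (\<Union>n. E n)"
    by (rule finite_Lim_measure_incseq[OF E_meas])
  have "(\<Union>n. E n) = {w \<in> space M. \<exists>k>0. w k = base}"
  proof (intro equalityI subsetI)
    fix w assume "w \<in> {w \<in> space M. \<exists>k>0. w k = base}"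
    then obtain k where w: "w \<in> space M" and k: "0 < k" "w k = base" by auto
    have "\<exists>N. \<forall>i\<in>{0<..k}. w i \<in> K N"
    proof -
      have "\<forall>i. \<exists>n. w i \<in> K n" using wC[OF w] K(4) by auto
      then obtain N where N: "\<And>i. w i \<in> K (N i)" by metis
      have "w i \<in> K (Max (N ` {0<..k}))" if "i \<in> {0<..k}" for i
        using N[of i] that K(3) by (meson Max_ge finite_greaterThanAtMost finite_imageI image_eqI incseqD subsetD)
      then show ?thesis by blast
    qed
    then obtain N where N: "\<forall>i\<in>{0<..k}. w i \<in> K N" ..
    have "w i \<in> K (max N k)" if "0 < i" "i \<le> k" for i
      using N that K(3) by (meson greaterThanAtMost_iff incseqD max.cobounded1 subsetD)
    then have "w \<in> E (max N k)" using w k by (auto simp: E_def intro!: exI[of _ k])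
    then show "w \<in> (\<Union>n. E n)" by blast
  qed (auto simp: E_def)
  then have lim1: "(\<lambda>n. measure M (E n)) \<longlonglongrightarrow> 1" using lim rec by simp
  define S where "S = {w \<in> space M. w 0 = x}"
  have S: "S \<in> sets M" "measure M S = 1"
    using M by (auto simp: S_def markov_chain_law_def)
  have le: "measure M (E n) \<le> return_prob p base (K n) n x" for n
  proof -
    have "AE w in M. w 0 = x"
      using AE_prob_1[OF S(2)] by (auto simp: S_def)
    then have "measure M (E n) = measure M (E n \<inter> S)"
      using E_meas S by (intro finite_measure_eq_AE) (auto simp: S_def E_def)
    also have "E n \<inter> S = {w \<in> space M. (\<forall>i\<le>0. w i = (\<lambda>_. x) i) \<and>
            (\<exists>j. 0 < j \<and> j \<le> 0 + n \<and> w j = base \<and> (\<forall>i. 0 < i \<and> i \<le> j \<longrightarrow> w i \<in> K n))}"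
      by (auto simp: E_def S_def)
    also have "measure M \<dots> \<le> measure M {w \<in> space M. \<forall>i\<le>0. w i = (\<lambda>_. x) i} *
        return_prob p base (K n) n x"
      using x K by (intro markov_cylinder_le_return_prob[OF M]) auto
    also have "\<dots> = return_prob p base (K n) n x" using S by (simp add: S_def)
    finally show ?thesis .
  qed
  show ?thesis
    by (rule tendsto_sandwich[OF always_eventually bound lim1 tendsto_const]) (use le in auto)
qed

lemma transition_prob_mult:
  assumes "b x summable_on C" "\<And>z. z \<in> C \<Longrightarrow> 0 \<le> b x z" "z \<in> C"
  shows "(\<Sum>\<^sub>\<infinity>z\<in>C. b x z) * transition_prob C b x z = b x z"
proof (cases "(\<Sum>\<^sub>\<infinity>z\<in>C. b x z) = 0")
  case True
  then have "b x z = 0" using assms by (intro nonneg_infsum_le_0D[of "b x" C]) auto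
  then show ?thesis by (simp add: transition_prob_def)
qed (simp add: transition_prob_def)

text \<open>The double sum in the conclusion is the energy of \<open>\<phi> n\<close>, in the form \<open>\<Sum>v. \<phi> v * (L\<phi>) v\<close> with the graph
Laplacian \<open>L\<close>. Subharmonicity makes all its terms away from the base vertex nonpositive,
and the term at the base vertex is the degree times the probability of not returning. A component
with a single vertex is treated separately since its chain has no transitions.\<close>

theorem recurrent_imp_null_sequence:
  fixes b :: "'v \<Rightarrow> 'v \<Rightarrow> real"
  assumes rec: "recurrent_graph C b" and C: "countable C" "C \<noteq> {}"
    and nonneg: "\<And>x y. x \<in> C \<Longrightarrow> y \<in> C \<Longrightarrow> 0 \<le> b x y"
    and loop: "\<And>x. x \<in> C \<Longrightarrow> b x x = 0"
    and summable: "\<And>x. x \<in> C \<Longrightarrow> b x summable_on C"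
  obtains K and \<phi> :: "nat \<Rightarrow> 'v \<Rightarrow> real" and e
  where "\<And>n. finite (K n)" "\<And>n. K n \<subseteq> C"
    "\<And>n v. 0 \<le> \<phi> n v" "\<And>n v. \<phi> n v \<le> 1" "\<And>n v. v \<notin> K n \<Longrightarrow> \<phi> n v = 0"
    "\<And>v. v \<in> C \<Longrightarrow> (\<lambda>n. \<phi> n v) \<longlonglongrightarrow> 1" "e \<longlonglongrightarrow> 0"
    "\<And>n. (\<Sum>v\<in>K n. \<phi> n v * ((\<Sum>\<^sub>\<infinity>z\<in>C. b v z) * \<phi> n v - (\<Sum>z\<in>K n. b v z * \<phi> n z))) \<le> e n"
proof (cases "\<exists>v. C = {v}")
  case True
  then obtain v where v: "C = {v}" by blast
  define \<phi> :: "nat \<Rightarrow> 'v \<Rightarrow> real" where "\<phi> = (\<lambda>_ w. if w = v then 1 else 0)"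
  define K where "K = (\<lambda>_::nat. {v})"
  have "b v v = 0" using loop v by simp
  show thesis
  proof (rule that[of K \<phi> "\<lambda>_. 0"])
    show "(\<Sum>w\<in>K n. \<phi> n w * ((\<Sum>\<^sub>\<infinity>z\<in>C. b w z) * \<phi> n w - (\<Sum>z\<in>K n. b w z * \<phi> n z))) \<le> 0" for n
      using \<open>b v v = 0\<close> by (simp add: \<phi>_def K_def v)
  qed (simp_all add: \<phi>_def K_def v)
next
  case False
  obtain base where base: "base \<in> C" using C by blast
  define q where "q = transition_prob C b"
  define L where "L n = insert base (from_nat_into C ` {..n})" for n :: nat
  have finL: "finite (L n)" for n by (simp add: L_def)
  have LC: "L n \<subseteq> C" for n
    unfolding L_def using base from_nat_into[OF C(2)] by (simp add: image_subset_iff)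
  have incL: "incseq L"
    unfolding L_def incseq_def by (intro allI impI) fastforce
  have UL: "(\<Union>n. L n) = C"
  proof
    show "C \<subseteq> (\<Union>n. L n)"
    proof
      fix v assume "v \<in> C"
      with C(1) have "\<exists>n. from_nat_into C n = v" by (rule from_nat_into_surj)
      then obtain n where n: "from_nat_into C n = v" ..
      have "from_nat_into C n \<in> L n" unfolding L_def by simp
      then show "v \<in> (\<Union>n. L n)" unfolding n by (rule UN_I[OF UNIV_I])
    qed
  qed (use LC in blast)
  have walk: "finite_walk q base (L n)" for n
  proof
    show "finite (L n)" "base \<in> L n" by (auto simp: L_def)
    fix x assume "x \<in> L n"
    then have x: "x \<in> C" using LC by blast
    have deg: "0 \<le> (\<Sum>\<^sub>\<infinity>z\<in>C. b x z)" using nonneg x by (intro infsum_nonneg) auto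
    show "0 \<le> q x z" if "z \<in> L n" for z
      unfolding q_def transition_prob_def
      by (rule divide_nonneg_nonneg[OF nonneg deg]) (use x that LC in blast)+
    have "(\<Sum>z\<in>L n. b x z) \<le> (\<Sum>\<^sub>\<infinity>z\<in>C. b x z)"
      by (rule finite_sum_le_infsum[OF summable[OF x] finL LC]) (use nonneg x in blast)
    then show "(\<Sum>z\<in>L n. q x z) \<le> 1"
      using deg by (simp add: q_def transition_prob_def divide_le_eq_1 order_less_le flip: sum_divide_distrib)
  qed
  define \<phi> where "\<phi> n = hit_prob q base (L n) n" for n
  have ev_L: "\<forall>\<^sub>F n in sequentially. x \<in> L n" if x: "x \<in> C" for x
  proof -
    obtain N where N: "x \<in> L N" using x UL by blast
    have "x \<in> L n" if "N \<le> n" for n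
      using N incseqD[OF incL that] by blast
    then show ?thesis unfolding eventually_sequentially by blast
  qed
  have ret: "(\<lambda>n. return_prob q base (L n) n x) \<longlonglongrightarrow> 1" if x: "x \<in> C" for x
  proof -
    obtain M where M: "markov_chain_law C q x M" "measure M {w \<in> space M. \<exists>k>0. w k = base} = 1"
      using rec False x base unfolding recurrent_graph_def q_def by meson
    have "return_prob q base (L n) n x \<le> 1" if "x \<in> L n" for n
      using finite_walk.return_prob_bounds[OF walk that] by blast
    with ev_L[OF x] have "\<forall>\<^sub>F n in sequentially. return_prob q base (L n) n x \<le> 1"
      by (rule eventually_mono)
    then show ?thesis
      by (intro recurrence_imp_return_prob_tendsto[OF M(1) x M(2) finL LC incL UL])
  qed
  have \<phi>_lim: "(\<lambda>n. \<phi> n x) \<longlonglongrightarrow> 1" if x: "x \<in> C" for x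
  proof (cases "x = base")
    case False
    have "\<forall>\<^sub>F n in sequentially. return_prob q base (L n) n x = \<phi> n x"
      using ev_L[OF x] by eventually_elim (simp add: \<phi>_def hit_prob_def False)
    then show ?thesis using ret[OF x] by (rule Lim_transform_eventually[rotated])
  qed (simp add: \<phi>_def hit_prob_def)
  define deg where "deg v = (\<Sum>\<^sub>\<infinity>z\<in>C. b v z)" for v
  have energy: "(\<Sum>v\<in>L n. \<phi> n v * (deg v * \<phi> n v - (\<Sum>z\<in>L n. b v z * \<phi> n z)))
      \<le> deg base * (1 - return_prob q base (L n) (Suc n) base)" for n
  proof -
    interpret finite_walk q base "L n" by (rule walk)
    have eq: "\<phi> n v * (deg v * \<phi> n v - (\<Sum>z\<in>L n. b v z * \<phi> n z)) =
        deg v * (\<phi> n v * (\<phi> n v - (\<Sum>z\<in>L n. q v z * \<phi> n z)))" if "v \<in> L n" for v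
    proof -
      have "b v z = deg v * q v z" if "z \<in> L n" for z
        unfolding deg_def q_def
        by (rule transition_prob_mult[OF summable nonneg, symmetric]) (use that \<open>v \<in> L n\<close> LC in blast)+
      then have "(\<Sum>z\<in>L n. b v z * \<phi> n z) = deg v * (\<Sum>z\<in>L n. q v z * \<phi> n z)"
        by (simp add: sum_distrib_left mult.assoc)
      then show ?thesis by (simp add: algebra_simps)
    qed
    have deg: "0 \<le> deg v" if "v \<in> L n" for v
      unfolding deg_def by (rule infsum_nonneg[OF nonneg]) (use that LC in blast)+
    have "(\<Sum>v\<in>L n. \<phi> n v * (deg v * \<phi> n v - (\<Sum>z\<in>L n. b v z * \<phi> n z))) =
      (\<Sum>v\<in>L n. deg v * (\<phi> n v * (\<phi> n v - (\<Sum>z\<in>L n. q v z * \<phi> n z))))"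
      by (intro sum.cong eq) auto
    also have "\<dots> \<le> (\<Sum>v\<in>L n. if v = base then deg base * (1 - return_prob q base (L n) (Suc n) base) else 0)"
    proof (rule sum_mono)
      fix v assume v: "v \<in> L n"
      show "deg v * (\<phi> n v * (\<phi> n v - (\<Sum>z\<in>L n. q v z * \<phi> n z))) \<le>
          (if v = base then deg base * (1 - return_prob q base (L n) (Suc n) base) else 0)"
      proof (cases "v = base")
        case True
        have "\<phi> n base = 1" by (simp add: \<phi>_def hit_prob_def)
        then show ?thesis
          unfolding True return_prob_Suc \<phi>_def[symmetric] by simp
      next
        case False
        then have "\<phi> n v - (\<Sum>z\<in>L n. q v z * \<phi> n z) \<le> 0"
          using hit_prob_subharmonic[OF v] by (simp add: \<phi>_def)
        then have "deg v * (\<phi> n v * (\<phi> n v - (\<Sum>z\<in>L n. q v z * \<phi> n z))) \<le> 0"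
          using deg[OF v] hit_prob_bounds(1) unfolding \<phi>_def by (intro mult_nonneg_nonpos)
        then show ?thesis using False by simp
      qed
    qed
    also have "\<dots> = deg base * (1 - return_prob q base (L n) (Suc n) base)"
      using base_mem finite_K by simp
    finally show ?thesis .
  qed
  have ret_Suc: "(\<lambda>n. return_prob q base (L n) (Suc n) base) \<longlonglongrightarrow> 1"
  proof (rule tendsto_sandwich[OF always_eventually always_eventually ret[OF base] tendsto_const])
    show "\<forall>n. return_prob q base (L n) n base \<le> return_prob q base (L n) (Suc n) base"
      using finite_walk.return_prob_mono_step[OF walk] by (auto simp: L_def simp del: return_prob.simps)
    show "\<forall>n. return_prob q base (L n) (Suc n) base \<le> 1"
      using finite_walk.return_prob_bounds[OF walk] by (auto simp: L_def simp del: return_prob.simps)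
  qed
  have "(\<lambda>n. deg base * (1 - return_prob q base (L n) (Suc n) base)) \<longlonglongrightarrow> deg base * (1 - 1)"
    by (intro tendsto_intros ret_Suc)
  then have e: "(\<lambda>n. deg base * (1 - return_prob q base (L n) (Suc n) base)) \<longlonglongrightarrow> 0" by simp
  show thesis
  proof (rule that[of L \<phi> "\<lambda>n. deg base * (1 - return_prob q base (L n) (Suc n) base)"])
    show "0 \<le> \<phi> n v" "\<phi> n v \<le> 1" for n v
      unfolding \<phi>_def by (rule finite_walk.hit_prob_bounds[OF walk])+
    show "\<phi> n v = 0" if "v \<notin> L n" for n v
      using that by (auto simp: \<phi>_def hit_prob_def L_def)
    show "(\<Sum>v\<in>L n. \<phi> n v * ((\<Sum>\<^sub>\<infinity>z\<in>C. b v z) * \<phi> n v - (\<Sum>z\<in>L n. b v z * \<phi> n z)))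
        \<le> deg base * (1 - return_prob q base (L n) (Suc n) base)" for n
      using energy[of n] by (simp only: deg_def)
  qed (fact finL LC \<phi>_lim e)+
qed

text \<open>The components are defined as classes of the reflexive transitive closure on the whole type; they
stay inside \<open>V\<close> because a nontrivial step of that closure ends in \<open>V\<close>.\<close>

lemma graph_component_subset:
  assumes "C \<in> graph_components V b"
  shows "C \<subseteq> V" "C \<noteq> {}"
proof -
  let ?r = "{(x, y). x \<in> V \<and> y \<in> V \<and> 0 < b x y}"
  obtain x where x: "x \<in> V" "C = ?r\<^sup>* `` {x}"
    using assms unfolding graph_components_def by (elim quotientE)
  have "y \<in> V" if "(x, y) \<in> ?r\<^sup>*" for y
    using that by (induction rule: rtrancl_induct) (use x in auto)
  then show "C \<subseteq> V" using x by blast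
  show "C \<noteq> {}" using x by blast
qed

lemma graph_component_closed:
  assumes C: "C \<in> graph_components V b" and v: "v \<in> C" "v' \<in> V" "0 < b v v'"
  shows "v' \<in> C"
proof -
  let ?r = "{(x, y). x \<in> V \<and> y \<in> V \<and> 0 < b x y}"
  obtain x where x: "x \<in> V" "C = ?r\<^sup>* `` {x}"
    using C unfolding graph_components_def by (elim quotientE)
  have "(x, v) \<in> ?r\<^sup>*" using x v by blast
  moreover have "(v, v') \<in> ?r" using v graph_component_subset(1)[OF C] by blast
  ultimately show ?thesis using x by (auto intro: rtrancl_into_rtrancl)
qed

lemma graph_components_partition:
  assumes sym: "\<And>x y. b x y = b y x"
  shows "\<Union> (graph_components V b) = V"
    and "C \<in> graph_components V b \<Longrightarrow> C' \<in> graph_components V b \<Longrightarrow> C \<noteq> C' \<Longrightarrow> C \<inter> C' = {}"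
proof -
  let ?r = "{(x, y). x \<in> V \<and> y \<in> V \<and> 0 < b x y}"
  have "x \<in> \<Union> (graph_components V b)" if "x \<in> V" for x
    using that unfolding graph_components_def by (intro UnionI[OF quotientI[of x]]) auto
  then show "\<Union> (graph_components V b) = V" using graph_component_subset by blast
  have "sym (?r\<^sup>*)" using sym by (intro sym_rtrancl) (auto simp: sym_def)
  then have eq: "equiv UNIV (?r\<^sup>*)"
    by (intro equivI refl_rtrancl trans_rtrancl) auto
  show "C \<inter> C' = {}" if C: "C \<in> graph_components V b" "C' \<in> graph_components V b" "C \<noteq> C'"
  proof -
    have "graph_components V b \<subseteq> UNIV // ?r\<^sup>*"
      unfolding graph_components_def quotient_def by blast
    then show ?thesis using quotient_disj[OF eq] C by blast
  qed
qed

text \<open>Dominated convergence for unordered sums, obtained from the counting measure.\<close>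

lemma tendsto_infsum_dominated:
  fixes g :: "'a \<Rightarrow> complex"
  assumes g: "(\<lambda>x. norm (g x)) summable_on C"
    and bound: "\<And>n x. norm (\<phi> n x) \<le> (1::real)"
    and lim: "\<And>x. x \<in> C \<Longrightarrow> (\<lambda>n. \<phi> n x) \<longlonglongrightarrow> 1"
  shows "(\<lambda>n. \<Sum>\<^sub>\<infinity>x\<in>C. complex_of_real (\<phi> n x) * g x) \<longlonglongrightarrow> (\<Sum>\<^sub>\<infinity>x\<in>C. g x)"
proof -
  have int: "integrable (count_space C) f \<and> (\<Sum>\<^sub>\<infinity>x\<in>C. f x) = integral\<^sup>L (count_space C) f"
    if "(\<lambda>x. norm (f x)) summable_on C" for f :: "'a \<Rightarrow> complex"
  proof -
    have "Infinite_Set_Sum.abs_summable_on f C"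
      using that abs_summable_equivalent by blast
    then show ?thesis
      using infsetsum_infsum[of f C] by (simp add: infsetsum_def Infinite_Set_Sum.abs_summable_on_def)
  qed
  have norm_le: "norm (complex_of_real (\<phi> n x) * g x) \<le> norm (g x)" for n x
    using mult_right_mono[OF bound norm_ge_zero, of n x "g x"] by (simp add: norm_mult)
  have sum_n: "(\<lambda>x. norm (complex_of_real (\<phi> n x) * g x)) summable_on C" for n
    by (rule summable_on_comparison_test[OF g norm_le]) simp
  have "(\<lambda>n. integral\<^sup>L (count_space C) (\<lambda>x. complex_of_real (\<phi> n x) * g x)) \<longlonglongrightarrow>
      integral\<^sup>L (count_space C) g"
  proof (rule integral_dominated_convergence[where w = "\<lambda>x. norm (g x)"])
    show "integrable (count_space C) (\<lambda>x. norm (g x))" using int[OF g] by simp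
    show "AE x in count_space C. (\<lambda>n. complex_of_real (\<phi> n x) * g x) \<longlonglongrightarrow> g x"
    proof (rule AE_I2)
      fix x assume "x \<in> space (count_space C)"
      then have "(\<lambda>n. complex_of_real (\<phi> n x) * g x) \<longlonglongrightarrow> complex_of_real 1 * g x"
        by (intro tendsto_intros lim) simp
      then show "(\<lambda>n. complex_of_real (\<phi> n x) * g x) \<longlonglongrightarrow> g x" by simp
    qed
    show "AE x in count_space C. norm (complex_of_real (\<phi> n x) * g x) \<le> norm (g x)" for n
      using norm_le by simp
  qed simp_all
  then show ?thesis using int[OF g] int[OF sum_n] by simp
qed

section \<open>Coboundary and boundary operators\<close>

lemma face_iff: "face \<tau> \<sigma> \<longleftrightarrow> (\<exists>v. v \<notin> \<tau> \<and> \<sigma> = insert v \<tau>)"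
proof
  assume "face \<tau> \<sigma>"
  then have "\<tau> \<subseteq> \<sigma>" "card (\<sigma> - \<tau>) = 1" by (auto simp: face_def)
  then obtain v where "\<sigma> - \<tau> = {v}" by (auto simp: card_1_singleton_iff)
  then show "\<exists>v. v \<notin> \<tau> \<and> \<sigma> = insert v \<tau>" using \<open>\<tau> \<subseteq> \<sigma>\<close> by (intro exI[of _ v]) auto
next
  assume "\<exists>v. v \<notin> \<tau> \<and> \<sigma> = insert v \<tau>"
  then obtain v where "v \<notin> \<tau>" "\<sigma> = insert v \<tau>" by blast
  then have "\<sigma> - \<tau> = {v}" "\<tau> \<subseteq> \<sigma>" by auto
  then show "face \<tau> \<sigma>" by (simp add: face_def)
qed

text \<open>Between \<open>\<rho>\<close> and a simplex with two more vertices there are exactly two simplices. This is the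
combinatorial fact behind \<open>\<delta>\<delta> = 0\<close> and the reason why graphs on links appear.\<close>

lemma faces_between:
  assumes "v \<noteq> v'" "v \<notin> \<rho>" "v' \<notin> \<rho>"
  shows "face \<tau> (insert v (insert v' \<rho>)) \<and> face \<rho> \<tau> \<longleftrightarrow> \<tau> = insert v \<rho> \<or> \<tau> = insert v' \<rho>"
proof
  assume *: "face \<tau> (insert v (insert v' \<rho>)) \<and> face \<rho> \<tau>"
  then obtain u w where u: "u \<notin> \<rho>" "\<tau> = insert u \<rho>"
    and w: "w \<notin> \<tau>" "insert v (insert v' \<rho>) = insert w \<tau>"
    by (auto simp: face_iff)
  have "u \<in> insert v (insert v' \<rho>)" using u w by blast
  then show "\<tau> = insert v \<rho> \<or> \<tau> = insert v' \<rho>" using u by auto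
next
  assume "\<tau> = insert v \<rho> \<or> \<tau> = insert v' \<rho>"
  then show "face \<tau> (insert v (insert v' \<rho>)) \<and> face \<rho> \<tau>"
    using assms by (auto simp: face_iff insert_commute intro: exI[of _ v] exI[of _ v'])
qed

locale weighted_complex =
  fixes X :: "'v set" and \<Sigma> :: "'v set set" and m :: "'v set \<Rightarrow> real"
    and \<delta> :: "('v set \<Rightarrow> complex) \<Rightarrow> ('v set \<Rightarrow> complex)"
  assumes complex: "weighted_simplicial_complex X \<Sigma> m"
    and coboundary: "coboundary_operator \<Sigma> \<delta>"
begin

lemma simplex_finite: "\<sigma> \<in> \<Sigma> \<Longrightarrow> finite \<sigma>"
  and simplex_subset: "\<sigma> \<in> \<Sigma> \<Longrightarrow> \<sigma> \<subseteq> X"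
  and simplex_weight: "\<sigma> \<in> \<Sigma> \<Longrightarrow> 0 < m \<sigma>"
  using complex unfolding weighted_simplicial_complex_def simplicial_complex_def
  by (auto split: if_splits)

lemma nonempty_face_simplex:
  assumes "\<sigma> \<in> \<Sigma>" "\<tau> \<subseteq> \<sigma>" "\<tau> \<noteq> {}"
  shows "\<tau> \<in> \<Sigma>"
proof -
  obtain S where S: "simplicial_complex X S"
      "\<Sigma> = (if (\<lambda>x. m {x}) summable_on X then S else S - {{}})"
    using complex unfolding weighted_simplicial_complex_def by blast
  have "\<sigma> \<in> S" using assms(1) S(2) by (auto split: if_splits)
  then have "\<tau> \<in> S" using S(1) assms(2) unfolding simplicial_complex_def by blast
  then show ?thesis using S(2) assms(3) by simp
qed

lemma cofaces_summable: "\<tau> \<in> \<Sigma> \<Longrightarrow> m summable_on {\<sigma>\<in>\<Sigma>. face \<tau> \<sigma>}"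
  using complex unfolding weighted_simplicial_complex_def by blast

sublocale weighted_l2 \<Sigma> m
  by unfold_locales (rule simplex_weight)

abbreviation \<theta> :: "'v set \<Rightarrow> 'v set \<Rightarrow> complex" where
  "\<theta> \<equiv> incidence \<delta>"

abbreviation bd :: "('v set \<Rightarrow> complex) \<Rightarrow> ('v set \<Rightarrow> complex)" where
  "bd \<equiv> boundary \<Sigma> m \<delta>"

abbreviation D :: "('v set \<Rightarrow> complex) set" where
  "D \<equiv> dom_coboundary_D \<Sigma> m \<delta>"

abbreviation N :: "('v set \<Rightarrow> complex) set" where
  "N \<equiv> dom_boundary_N \<Sigma> m \<delta>"

abbreviation C_fin :: "('v set \<Rightarrow> complex) set" where
  "C_fin \<equiv> cochains_fin \<Sigma>"

abbreviation H_dim :: "int \<Rightarrow> ('v set \<Rightarrow> complex) set" where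
  "H_dim \<equiv> l2_dim \<Sigma> m"

lemma finite_faces: "\<sigma> \<in> \<Sigma> \<Longrightarrow> finite {\<tau> \<in> \<Sigma>. face \<tau> \<sigma>}"
  by (rule finite_subset[of _ "Pow \<sigma>"]) (auto simp: face_def simplex_finite)

lemma \<delta>_cochain: "\<omega> \<in> cochains \<Sigma> \<Longrightarrow> \<delta> \<omega> \<in> cochains \<Sigma>"
  and \<delta>_apply: "\<omega> \<in> cochains \<Sigma> \<Longrightarrow> \<sigma> \<in> \<Sigma> \<Longrightarrow> \<delta> \<omega> \<sigma> = (\<Sum>\<tau> | \<tau> \<in> \<Sigma> \<and> face \<tau> \<sigma>. \<theta> \<tau> \<sigma> * \<omega> \<tau>)"
  and \<theta>_cases: "\<sigma> \<in> \<Sigma> \<Longrightarrow> \<tau> \<in> \<Sigma> \<Longrightarrow> face \<tau> \<sigma> \<Longrightarrow> \<theta> \<tau> \<sigma> = 1 \<or> \<theta> \<tau> \<sigma> = -1"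
  and \<delta>\<delta>: "\<omega> \<in> cochains \<Sigma> \<Longrightarrow> \<delta> (\<delta> \<omega>) = 0"
  using coboundary unfolding coboundary_operator_def by blast+

lemma \<delta>_outside: "\<omega> \<in> cochains \<Sigma> \<Longrightarrow> \<sigma> \<notin> \<Sigma> \<Longrightarrow> \<delta> \<omega> \<sigma> = 0"
  using \<delta>_cochain unfolding cochains_def by blast

lemma cochains_add: "f \<in> cochains \<Sigma> \<Longrightarrow> g \<in> cochains \<Sigma> \<Longrightarrow> f + g \<in> cochains \<Sigma>"
  and cochains_diff: "f \<in> cochains \<Sigma> \<Longrightarrow> g \<in> cochains \<Sigma> \<Longrightarrow> f - g \<in> cochains \<Sigma>"
  and cochains_scale: "f \<in> cochains \<Sigma> \<Longrightarrow> (\<lambda>\<sigma>. c * f \<sigma>) \<in> cochains \<Sigma>"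
  and cochains_zero: "0 \<in> cochains \<Sigma>"
  by (simp_all add: cochains_def)

lemma \<delta>_add: "f \<in> cochains \<Sigma> \<Longrightarrow> g \<in> cochains \<Sigma> \<Longrightarrow> \<delta> (f + g) = \<delta> f + \<delta> g"
proof
  fix \<sigma> assume fg: "f \<in> cochains \<Sigma>" "g \<in> cochains \<Sigma>"
  show "\<delta> (f + g) \<sigma> = (\<delta> f + \<delta> g) \<sigma>"
    by (cases "\<sigma> \<in> \<Sigma>")
      (simp_all add: fg cochains_add \<delta>_apply \<delta>_outside algebra_simps sum.distrib)
qed

lemma \<delta>_diff: "f \<in> cochains \<Sigma> \<Longrightarrow> g \<in> cochains \<Sigma> \<Longrightarrow> \<delta> (f - g) = \<delta> f - \<delta> g"
proof
  fix \<sigma> assume fg: "f \<in> cochains \<Sigma>" "g \<in> cochains \<Sigma>"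
  show "\<delta> (f - g) \<sigma> = (\<delta> f - \<delta> g) \<sigma>"
    by (cases "\<sigma> \<in> \<Sigma>")
      (simp_all add: fg cochains_diff \<delta>_apply \<delta>_outside algebra_simps sum_subtractf)
qed

lemma \<delta>_scale: "f \<in> cochains \<Sigma> \<Longrightarrow> \<delta> (\<lambda>\<sigma>. c * f \<sigma>) = (\<lambda>\<sigma>. c * \<delta> f \<sigma>)"
proof
  fix \<sigma> assume f: "f \<in> cochains \<Sigma>"
  show "\<delta> (\<lambda>\<sigma>. c * f \<sigma>) \<sigma> = c * \<delta> f \<sigma>"
    by (cases "\<sigma> \<in> \<Sigma>")
      (simp_all add: f cochains_scale \<delta>_apply \<delta>_outside sum_distrib_left algebra_simps)
qed

lemma \<delta>_zero: "\<delta> 0 = 0"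
  using \<delta>_scale[OF cochains_zero, of 0] by (simp add: zero_fun_def)

abbreviation single :: "'v set \<Rightarrow> 'v set \<Rightarrow> complex" where
  "single \<tau> \<equiv> indicator {\<tau>}"

lemma single_cochain: "\<tau> \<in> \<Sigma> \<Longrightarrow> single \<tau> \<in> cochains \<Sigma>"
  by (auto simp: cochains_def indicator_def)

lemma \<delta>_single:
  assumes "\<tau> \<in> \<Sigma>"
  shows "\<delta> (single \<tau>) \<sigma> = (if \<sigma> \<in> \<Sigma> \<and> face \<tau> \<sigma> then \<theta> \<tau> \<sigma> else 0)"
proof (cases "\<sigma> \<in> \<Sigma>")
  case True
  have "\<delta> (single \<tau>) \<sigma> = (\<Sum>\<tau>' | \<tau>' \<in> \<Sigma> \<and> face \<tau>' \<sigma>. if \<tau>' = \<tau> then \<theta> \<tau> \<sigma> else 0)"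
    unfolding \<delta>_apply[OF single_cochain[OF assms] True]
    by (intro sum.cong refl) (simp add: indicator_def)
  then show ?thesis using finite_faces[OF True] True assms by simp
qed (simp add: \<delta>_outside single_cochain assms)

text \<open>Local summability is what makes this true: the coboundary of a single simplex may have infinite
support, but its squared norm is the total weight of the cofaces.\<close>

lemma \<delta>_single_l2:
  assumes "\<tau> \<in> \<Sigma>"
  shows "\<delta> (single \<tau>) \<in> H"
  unfolding l2_iff
proof
  show "\<delta> (single \<tau>) \<in> cochains \<Sigma>" by (intro \<delta>_cochain single_cochain assms)
  have "cmod (\<theta> \<tau> \<sigma>) = 1" if "\<sigma> \<in> \<Sigma>" "face \<tau> \<sigma>" for \<sigma>
    using \<theta>_cases[OF that(1) assms that(2)] by auto
  then have "(\<lambda>\<sigma>. m \<sigma> * (cmod (\<delta> (single \<tau>) \<sigma>))\<^sup>2) summable_on \<Sigma> \<longleftrightarrow> m summable_on {\<sigma>\<in>\<Sigma>. face \<tau> \<sigma>}"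
    by (intro summable_on_cong_neutral) (auto simp: \<delta>_single assms)
  then show "(\<lambda>\<sigma>. m \<sigma> * (cmod (\<delta> (single \<tau>) \<sigma>))\<^sup>2) summable_on \<Sigma>"
    using cofaces_summable[OF assms] by blast
qed

lemma cochains_fin_cochain: "f \<in> C_fin \<Longrightarrow> f \<in> cochains \<Sigma>"
  by (simp add: cochains_fin_def)

lemma single_fin: "\<tau> \<in> \<Sigma> \<Longrightarrow> single \<tau> \<in> C_fin"
  using single_cochain by (auto simp: cochains_fin_def indicator_def)

lemma cochains_fin_add: "f \<in> C_fin \<Longrightarrow> g \<in> C_fin \<Longrightarrow> f + g \<in> C_fin"
  by (auto simp: cochains_fin_def cochains_add intro: finite_subset[of _ "{\<sigma>. f \<sigma> \<noteq> 0} \<union> {\<sigma>. g \<sigma> \<noteq> 0}"])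

lemma cochains_fin_scale: "f \<in> C_fin \<Longrightarrow> (\<lambda>\<sigma>. c * f \<sigma>) \<in> C_fin"
  by (auto simp: cochains_fin_def cochains_scale intro: finite_subset[of _ "{\<sigma>. f \<sigma> \<noteq> 0}"])

lemma cochains_fin_zero: "0 \<in> C_fin"
  by (simp add: cochains_fin_def cochains_zero)

lemma cochains_fin_induct [consumes 1, case_names zero add]:
  assumes f: "f \<in> C_fin" and zero: "P 0"
    and add: "\<And>f c \<tau>. f \<in> C_fin \<Longrightarrow> P f \<Longrightarrow> \<tau> \<in> \<Sigma> \<Longrightarrow> P (f + (\<lambda>\<sigma>. c * single \<tau> \<sigma>))"
  shows "P f"
proof -
  have "P f" if "finite F" "f \<in> C_fin" "{\<sigma>. f \<sigma> \<noteq> 0} \<subseteq> F" for F f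
    using that
  proof (induction F arbitrary: f rule: finite_induct)
    case empty
    then have "f = 0" by (intro ext) auto
    then show ?case using zero by (simp only:)
  next
    case (insert \<tau> F)
    define g where "g = f(\<tau> := 0)"
    have supp: "{\<sigma>. g \<sigma> \<noteq> 0} \<subseteq> F" using insert.prems by (auto simp: g_def)
    have g: "g \<in> C_fin"
      using insert.prems(1) finite_subset[OF supp insert.hyps(1)]
      by (simp add: cochains_fin_def cochains_def g_def)
    have "P g" by (rule insert.IH[OF g supp])
    show ?case
    proof (cases "\<tau> \<in> \<Sigma>")
      case True
      have "f = g + (\<lambda>\<sigma>. f \<tau> * single \<tau> \<sigma>)" by (auto simp: g_def indicator_def)
      then show ?thesis using add[OF g \<open>P g\<close> True] by metis
    next
      case False
      then have "f = g" using insert.prems(1) by (auto simp: g_def cochains_fin_def cochains_def)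
      then show ?thesis using \<open>P g\<close> by simp
    qed
  qed
  then show ?thesis using f by (auto simp: cochains_fin_def)
qed

lemma cochains_fin_l2: "f \<in> C_fin \<Longrightarrow> f \<in> H"
proof -
  assume f: "f \<in> C_fin"
  then have "(\<lambda>\<sigma>. m \<sigma> * (cmod (f \<sigma>))\<^sup>2) summable_on \<Sigma>"
    by (intro finite_nonzero_values_imp_summable_on)
      (auto simp: cochains_fin_def intro: finite_subset[of _ "{\<sigma>. f \<sigma> \<noteq> 0}"])
  then show ?thesis using f by (simp add: l2_iff cochains_fin_cochain)
qed

lemma single_l2: "\<tau> \<in> \<Sigma> \<Longrightarrow> single \<tau> \<in> H"
  by (intro cochains_fin_l2 single_fin)

lemma linear_subspace_cochains_fin: "linear_subspace \<Sigma> m (C_fin)"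
  unfolding linear_subspace_def
  using cochains_fin_l2 cochains_fin_add cochains_fin_scale cochains_fin_zero by blast

lemma \<delta>_fin_l2: "f \<in> C_fin \<Longrightarrow> \<delta> f \<in> H"
proof (induction rule: cochains_fin_induct)
  case zero
  show ?case unfolding \<delta>_zero by (rule l2_zero)
next
  case (add f c \<tau>)
  have "\<delta> (f + (\<lambda>\<sigma>. c * single \<tau> \<sigma>)) = \<delta> f + (\<lambda>\<sigma>. c * \<delta> (single \<tau>) \<sigma>)"
    using add.hyps by (simp only: \<delta>_add \<delta>_scale cochains_fin_cochain cochains_scale single_cochain)
  also have "\<dots> \<in> H" by (intro l2_add l2_scale \<delta>_single_l2 add)
  finally show ?case .
qed

lemma ip_single_left: "\<tau> \<in> \<Sigma> \<Longrightarrow> ip (single \<tau>) g = m \<tau> * cnj (g \<tau>)"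
proof -
  assume \<tau>: "\<tau> \<in> \<Sigma>"
  have "ip (single \<tau>) g = (\<Sum>\<^sub>\<infinity>\<sigma>\<in>{\<tau>}. complex_of_real (m \<sigma>) * single \<tau> \<sigma> * cnj (g \<sigma>))"
    unfolding l2_inner_def by (intro infsum_cong_neutral) (auto simp: \<tau>)
  then show ?thesis by simp
qed

lemma ip_single_right:
  fixes g :: "'v set \<Rightarrow> complex"
  shows "\<tau> \<in> \<Sigma> \<Longrightarrow> ip g (single \<tau>) = m \<tau> * g \<tau>"
  using ip_single_left[of \<tau> g] cnj_ip[of "single \<tau>" g] by simp

text \<open>The boundary operator is made so that this holds. It determines \<open>bd \<eta>\<close> pointwise, so that linearity
of \<open>bd\<close> and the computation of adjoints reduce to properties of the inner product.\<close>

lemma ip_\<delta>_single: "\<tau> \<in> \<Sigma> \<Longrightarrow> ip \<eta> (\<delta> (single \<tau>)) = m \<tau> * bd \<eta> \<tau>"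
proof -
  assume \<tau>: "\<tau> \<in> \<Sigma>"
  have "ip \<eta> (\<delta> (single \<tau>)) =
      (\<Sum>\<^sub>\<infinity>\<sigma>\<in>{\<sigma>\<in>\<Sigma>. face \<tau> \<sigma>}. complex_of_real (m \<sigma>) * \<theta> \<tau> \<sigma> * \<eta> \<sigma>)"
    unfolding l2_inner_def
  proof (rule infsum_cong_neutral)
    fix \<sigma> assume "\<sigma> \<in> \<Sigma> \<inter> {\<sigma>\<in>\<Sigma>. face \<tau> \<sigma>}"
    then have \<sigma>: "\<sigma> \<in> \<Sigma>" "face \<tau> \<sigma>" by auto
    have "cnj (\<theta> \<tau> \<sigma>) = \<theta> \<tau> \<sigma>" using \<theta>_cases[OF \<sigma>(1) \<tau> \<sigma>(2)] by auto
    then show "complex_of_real (m \<sigma>) * \<eta> \<sigma> * cnj (\<delta> (single \<tau>) \<sigma>) =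
        complex_of_real (m \<sigma>) * \<theta> \<tau> \<sigma> * \<eta> \<sigma>"
      using \<sigma> by (simp add: \<delta>_single \<tau>)
  qed (auto simp: \<delta>_single \<tau>)
  also have "\<dots> = m \<tau> * bd \<eta> \<tau>"
    using simplex_weight[OF \<tau>] by (simp add: boundary_def \<tau>)
  finally show ?thesis .
qed

lemma bd_outside: "\<tau> \<notin> \<Sigma> \<Longrightarrow> bd \<eta> \<tau> = 0"
  by (simp add: boundary_def)

lemma bd_eqI:
  fixes g :: "'v set \<Rightarrow> complex"
  assumes "g \<in> cochains \<Sigma>" "\<And>\<tau>. \<tau> \<in> \<Sigma> \<Longrightarrow> ip \<eta> (\<delta> (single \<tau>)) = m \<tau> * g \<tau>"
  shows "bd \<eta> = g"
proof
  fix \<tau>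
  show "bd \<eta> \<tau> = g \<tau>"
  proof (cases "\<tau> \<in> \<Sigma>")
    case True
    have "m \<tau> * bd \<eta> \<tau> = m \<tau> * g \<tau>" using ip_\<delta>_single[OF True] assms(2)[OF True] by metis
    then show ?thesis using simplex_weight[OF True] by simp
  qed (use assms(1) bd_outside in \<open>simp add: cochains_def\<close>)
qed

lemma bd_cochain: "bd \<eta> \<in> cochains \<Sigma>"
  by (simp add: cochains_def bd_outside)

lemma bd_add: "f \<in> H \<Longrightarrow> g \<in> H \<Longrightarrow> bd (f + g) = bd f + bd g"
proof (rule bd_eqI)
  fix \<tau> assume f: "f \<in> H" "g \<in> H" and \<tau>: "\<tau> \<in> \<Sigma>"
  show "ip (f + g) (\<delta> (single \<tau>)) = m \<tau> * (bd f + bd g) \<tau>"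
    unfolding ip_add_left[OF f \<delta>_single_l2[OF \<tau>]] by (simp add: ip_\<delta>_single \<tau> algebra_simps)
qed (intro cochains_add bd_cochain)

lemma bd_scale: "f \<in> H \<Longrightarrow> bd (\<lambda>\<sigma>. c * f \<sigma>) = (\<lambda>\<sigma>. c * bd f \<sigma>)"
proof (rule bd_eqI)
  fix \<tau> assume f: "f \<in> H" and \<tau>: "\<tau> \<in> \<Sigma>"
  show "ip (\<lambda>\<sigma>. c * f \<sigma>) (\<delta> (single \<tau>)) = m \<tau> * (c * bd f \<tau>)"
    unfolding ip_scale_left[OF f \<delta>_single_l2[OF \<tau>]] by (simp add: ip_\<delta>_single \<tau>)
qed (intro cochains_scale bd_cochain)

lemma bd_zero: "bd 0 = 0"
  by (rule bd_eqI) (simp_all add: cochains_zero)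

text \<open>By linearity from \<open>ip_\<delta>_single\<close>. The right-hand side is a finite sum, so \<open>\<eta>\<close> may lie outside of \<open>N\<close>.\<close>

lemma ip_\<delta>_fin:
  assumes "\<eta> \<in> H" "f \<in> C_fin"
  shows "ip (\<delta> f) \<eta> = ip f (bd \<eta>)"
  using assms(2)
proof (induction rule: cochains_fin_induct)
  case zero
  show ?case unfolding \<delta>_zero ip_zero_left ..
next
  case (add f c \<tau>)
  have fin_summable: "(\<lambda>\<sigma>. complex_of_real (m \<sigma>) * g \<sigma> * cnj (bd \<eta> \<sigma>)) summable_on \<Sigma>"
    if "g \<in> C_fin" for g
    using that by (intro finite_nonzero_values_imp_summable_on)
      (auto simp: cochains_fin_def intro: finite_subset[of _ "{\<sigma>. g \<sigma> \<noteq> 0}"])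
  have \<tau>: "ip (\<delta> (single \<tau>)) \<eta> = ip (single \<tau>) (bd \<eta>)"
    using ip_\<delta>_single[OF add.hyps(2), of \<eta>] ip_single_left[OF add.hyps(2), of "bd \<eta>"]
      cnj_ip[of \<eta> "\<delta> (single \<tau>)"] by simp
  have "\<delta> (f + (\<lambda>\<sigma>. c * single \<tau> \<sigma>)) = \<delta> f + (\<lambda>\<sigma>. c * \<delta> (single \<tau>) \<sigma>)"
    using add.hyps by (simp only: \<delta>_add \<delta>_scale cochains_fin_cochain cochains_scale single_cochain)
  then have "ip (\<delta> (f + (\<lambda>\<sigma>. c * single \<tau> \<sigma>))) \<eta> = ip (\<delta> f) \<eta> + c * ip (\<delta> (single \<tau>)) \<eta>"
    using assms(1) add.hyps
    by (simp add: ip_add_left ip_scale_left \<delta>_fin_l2 \<delta>_single_l2 l2_scale)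
  also have "\<dots> = ip f (bd \<eta>) + c * ip (single \<tau>) (bd \<eta>)" using \<tau> add.IH by simp
  also have "\<dots> = ip f (bd \<eta>) + ip (\<lambda>\<sigma>. c * single \<tau> \<sigma>) (bd \<eta>)"
    unfolding l2_inner_def by (subst infsum_cmult_right'[symmetric]) (simp add: mult_ac)
  also have "\<dots> = ip (f + (\<lambda>\<sigma>. c * single \<tau> \<sigma>)) (bd \<eta>)"
    unfolding l2_inner_def
    by (subst infsum_add[symmetric])
      (simp_all only: fin_summable cochains_fin_scale single_fin add.hyps plus_fun_apply distrib_left distrib_right)
  finally show ?case .
qed

text \<open>From \<open>|\<eta>| \<le> 1 + |\<eta>|\<^sup>2\<close> and local summability. So inside \<open>H\<close> the domain \<open>N\<close> is cut out by
\<open>bd \<eta> \<in> H\<close> alone.\<close>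

lemma l2_dom_boundary: "\<eta> \<in> H \<Longrightarrow> \<eta> \<in> dom_boundary \<Sigma> m"
  unfolding dom_boundary_def
proof (intro CollectI conjI ballI)
  assume \<eta>: "\<eta> \<in> H"
  then show "\<eta> \<in> cochains \<Sigma>" by (rule l2_cochain)
  fix \<rho> assume \<rho>: "\<rho> \<in> \<Sigma>"
  show "(\<lambda>\<tau>. m \<tau> * cmod (\<eta> \<tau>)) summable_on {\<tau> \<in> \<Sigma>. face \<rho> \<tau>}"
  proof (rule summable_on_comparison_test)
    show "(\<lambda>\<tau>. m \<tau> + m \<tau> * (cmod (\<eta> \<tau>))\<^sup>2) summable_on {\<tau> \<in> \<Sigma>. face \<rho> \<tau>}"
      by (intro summable_on_add cofaces_summable[OF \<rho>] summable_on_subset_banach[OF l2_summable[OF \<eta>]]) blast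
    fix \<tau> assume "\<tau> \<in> {\<tau> \<in> \<Sigma>. face \<rho> \<tau>}"
    then have \<tau>: "0 < m \<tau>" using simplex_weight by auto
    have "cmod (\<eta> \<tau>) \<le> 1 + (cmod (\<eta> \<tau>))\<^sup>2"
      using sum_squares_bound[of 1 "cmod (\<eta> \<tau>)"] norm_ge_zero[of "\<eta> \<tau>"]
      by (simp del: norm_ge_zero)
    then have "m \<tau> * cmod (\<eta> \<tau>) \<le> m \<tau> * (1 + (cmod (\<eta> \<tau>))\<^sup>2)"
      using \<tau> by (intro mult_left_mono) auto
    then show "m \<tau> * cmod (\<eta> \<tau>) \<le> m \<tau> + m \<tau> * (cmod (\<eta> \<tau>))\<^sup>2" by (simp add: distrib_left)
    show "0 \<le> m \<tau> * cmod (\<eta> \<tau>)" using \<tau> by simp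
  qed
qed

lemma N_iff: "\<eta> \<in> N \<longleftrightarrow> \<eta> \<in> H \<and> bd \<eta> \<in> H"
  using l2_dom_boundary by (auto simp: dom_boundary_N_def)

lemma linear_subspace_N: "linear_subspace \<Sigma> m N"
  unfolding linear_subspace_def
  by (auto simp only: N_iff l2_add bd_add l2_scale bd_scale l2_zero bd_zero)

lemma linear_subspace_range_bd: "linear_subspace \<Sigma> m (bd ` N)"
  unfolding linear_subspace_def
proof (intro conjI ballI allI)
  show "bd ` N \<subseteq> H" using N_iff by blast
  show "0 \<in> bd ` N" using bd_zero linear_subspace_zero[OF linear_subspace_N] by (metis imageI)
  show "f + g \<in> bd ` N" if fg: "f \<in> bd ` N" "g \<in> bd ` N" for f g
  proof -
    obtain a b where "a \<in> N" "f = bd a" "b \<in> N" "g = bd b" using fg by blast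
    then show ?thesis
      using bd_add N_iff linear_subspace_add[OF linear_subspace_N, of a b] by (metis imageI)
  qed
  show "(\<lambda>\<sigma>. c * f \<sigma>) \<in> bd ` N" if f: "f \<in> bd ` N" for c f
  proof -
    obtain a where "a \<in> N" "f = bd a" using f by blast
    then show ?thesis
      using bd_scale[of a c] N_iff linear_subspace_scale[OF linear_subspace_N, of a c] by (metis imageI)
  qed
qed

lemma nsq_tendsto_pointwise:
  assumes u: "\<And>n. u n \<in> H" "f \<in> H" and lim: "l2_tendsto u f"
  shows "(\<lambda>n. u n \<sigma>) \<longlonglongrightarrow> f \<sigma>"
proof (cases "\<sigma> \<in> \<Sigma>")
  case True
  have "(\<lambda>n. sqrt (nsq (u n - f) / m \<sigma>)) \<longlonglongrightarrow> sqrt (0 / m \<sigma>)"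
    by (intro tendsto_intros lim) (use simplex_weight[OF True] in simp)
  then have lim0: "(\<lambda>n. sqrt (nsq (u n - f) / m \<sigma>)) \<longlonglongrightarrow> 0" by simp
  have "norm (u n \<sigma> - f \<sigma>) \<le> norm (sqrt (nsq (u n - f) / m \<sigma>)) * 1" for n
  proof -
    have "m \<sigma> * (cmod ((u n - f) \<sigma>))\<^sup>2 \<le> nsq (u n - f)"
      by (rule weight_sq_le_nsq[OF l2_diff[OF u] True])
    then have "(cmod (u n \<sigma> - f \<sigma>))\<^sup>2 \<le> nsq (u n - f) / m \<sigma>"
      using simplex_weight[OF True] by (simp add: field_simps)
    then have "cmod (u n \<sigma> - f \<sigma>) \<le> sqrt (nsq (u n - f) / m \<sigma>)" by (rule real_le_rsqrt)
    then show ?thesis by simp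
  qed
  then have "(\<lambda>n. u n \<sigma> - f \<sigma>) \<longlonglongrightarrow> 0"
    by (intro tendsto_0_le[OF lim0, of _ 1] always_eventually allI)
  then show ?thesis by (simp only: Lim_null[symmetric])
next
  case False
  then show ?thesis using u by (simp add: l2_outside)
qed

text \<open>The operator \<open>\<delta>\<close> is closed: each value of \<open>\<delta> f\<close> is a finite sum of values of \<open>f\<close>, so convergence in
norm on both sides can be compared pointwise.\<close>

lemma \<delta>_limit:
  assumes u: "\<And>n. u n \<in> H" "f \<in> H" "l2_tendsto u f"
    and v: "\<And>n. \<delta> (u n) \<in> H" "g \<in> H" "l2_tendsto (\<lambda>n. \<delta> (u n)) g"
  shows "\<delta> f = g"
proof
  fix \<sigma>
  show "\<delta> f \<sigma> = g \<sigma>"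
  proof (cases "\<sigma> \<in> \<Sigma>")
    case True
    have "(\<lambda>n. \<Sum>\<tau> | \<tau> \<in> \<Sigma> \<and> face \<tau> \<sigma>. \<theta> \<tau> \<sigma> * u n \<tau>) \<longlonglongrightarrow> (\<Sum>\<tau> | \<tau> \<in> \<Sigma> \<and> face \<tau> \<sigma>. \<theta> \<tau> \<sigma> * f \<tau>)"
      by (intro tendsto_intros nsq_tendsto_pointwise[OF u])
    then have "(\<lambda>n. \<delta> (u n) \<sigma>) \<longlonglongrightarrow> \<delta> f \<sigma>"
      by (simp only: \<delta>_apply[OF l2_cochain[OF u(1)] True] \<delta>_apply[OF l2_cochain[OF u(2)] True])
    then show ?thesis using nsq_tendsto_pointwise[OF v] by (rule LIMSEQ_unique)
  next
    case False
    then show ?thesis using \<delta>_outside l2_cochain[OF u(2)] l2_outside[OF v(2)] by simp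
  qed
qed

text \<open>The extended-valued norms in the domain can be replaced by real ones: convergence to \<open>0\<close> forces
\<open>\<delta> (u n - \<omega>)\<close> to have finite norm for some \<open>n\<close>, and \<open>\<delta> (u n)\<close> is square summable, so \<open>\<delta> \<omega>\<close> is too.\<close>

lemma D_iff:
  "\<omega> \<in> D \<longleftrightarrow> \<omega> \<in> H \<and> \<delta> \<omega> \<in> H \<and>
     (\<exists>u. (\<forall>n. u n \<in> C_fin) \<and> l2_tendsto u \<omega> \<and> l2_tendsto (\<lambda>n. \<delta> (u n)) (\<delta> \<omega>))"
proof -
  have key: "(\<lambda>n. l2_norm_sq \<Sigma> m (u n - \<omega>) + l2_norm_sq \<Sigma> m (\<delta> (u n - \<omega>))) \<longlonglongrightarrow> 0 \<longleftrightarrow>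
      \<delta> \<omega> \<in> H \<and> l2_tendsto u \<omega> \<and> l2_tendsto (\<lambda>n. \<delta> (u n)) (\<delta> \<omega>)" (is "?L \<longleftrightarrow> ?R")
    if \<omega>: "\<omega> \<in> H" and u: "\<forall>n. u n \<in> C_fin" for u :: "nat \<Rightarrow> _"
  proof -
    have uH: "u n \<in> H" and \<delta>u: "\<delta> (u n) \<in> H" and c: "u n \<in> cochains \<Sigma>" for n
      using u cochains_fin_l2 \<delta>_fin_l2 cochains_fin_cochain by blast+
    have \<delta>_eq: "\<delta> (u n - \<omega>) = \<delta> (u n) - \<delta> \<omega>" for n
      by (rule \<delta>_diff[OF c l2_cochain[OF \<omega>]])
    have conv: "(\<lambda>n. l2_norm_sq \<Sigma> m (u n - \<omega>) + l2_norm_sq \<Sigma> m (\<delta> (u n - \<omega>))) =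
        (\<lambda>n. ennreal (nsq (u n - \<omega>) + nsq (\<delta> (u n) - \<delta> \<omega>)))" if "\<delta> \<omega> \<in> H"
      using that by (simp add: \<delta>_eq l2_norm_sq_eq l2_diff uH \<omega> \<delta>u ennreal_plus nsq_nonneg)
    have iff: "?L \<longleftrightarrow> l2_tendsto u \<omega> \<and> l2_tendsto (\<lambda>n. \<delta> (u n)) (\<delta> \<omega>)" if "\<delta> \<omega> \<in> H"
    proof -
      have "?L \<longleftrightarrow> (\<lambda>n. ennreal (nsq (u n - \<omega>) + nsq (\<delta> (u n) - \<delta> \<omega>))) \<longlonglongrightarrow> ennreal 0"
        unfolding conv[OF that] by simp
      also have "\<dots> \<longleftrightarrow> (\<lambda>n. nsq (u n - \<omega>) + nsq (\<delta> (u n) - \<delta> \<omega>)) \<longlonglongrightarrow> 0"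
        by (rule tendsto_ennreal_iff) (simp_all add: nsq_nonneg)
      also have "\<dots> \<longleftrightarrow> l2_tendsto u \<omega> \<and> l2_tendsto (\<lambda>n. \<delta> (u n)) (\<delta> \<omega>)"
      proof
        assume L: "(\<lambda>n. nsq (u n - \<omega>) + nsq (\<delta> (u n) - \<delta> \<omega>)) \<longlonglongrightarrow> 0"
        show "l2_tendsto u \<omega> \<and> l2_tendsto (\<lambda>n. \<delta> (u n)) (\<delta> \<omega>)"
          by (intro conjI nsq_squeeze[OF _ L]) (simp_all add: nsq_nonneg)
      qed (use tendsto_add_zero[of "\<lambda>n. nsq (u n - \<omega>)" sequentially "\<lambda>n. nsq (\<delta> (u n) - \<delta> \<omega>)"] in blast)
      finally show ?thesis .
    qed
    have "\<delta> \<omega> \<in> H" if L: ?L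
    proof -
      have "\<forall>\<^sub>F n in sequentially.
          l2_norm_sq \<Sigma> m (u n - \<omega>) + l2_norm_sq \<Sigma> m (\<delta> (u n - \<omega>)) < 1"
        using L by (rule order_tendstoD) simp
      then obtain n where n: "l2_norm_sq \<Sigma> m (u n - \<omega>) + l2_norm_sq \<Sigma> m (\<delta> (u n - \<omega>)) < 1"
        by (auto simp: eventually_sequentially)
      have "l2_norm_sq \<Sigma> m (\<delta> (u n - \<omega>)) \<le> l2_norm_sq \<Sigma> m (u n - \<omega>) + l2_norm_sq \<Sigma> m (\<delta> (u n - \<omega>))"
        by (rule add_increasing) simp_all
      also note n
      also have "(1::ennreal) < \<infinity>" by simp
      finally have "\<delta> (u n - \<omega>) \<in> H"
        unfolding l2_def using \<delta>_cochain cochains_diff[OF c l2_cochain[OF \<omega>]] by blast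
      then have "\<delta> (u n) - (\<delta> (u n) - \<delta> \<omega>) \<in> H" unfolding \<delta>_eq by (rule l2_diff[OF \<delta>u])
      moreover have "\<delta> (u n) - (\<delta> (u n) - \<delta> \<omega>) = \<delta> \<omega>" by simp
      ultimately show ?thesis by (simp only:)
    qed
    with iff show ?thesis by blast
  qed
  show ?thesis
  proof
    assume "\<omega> \<in> D"
    then obtain u where \<omega>: "\<omega> \<in> H" and u: "\<forall>n. u n \<in> C_fin"
      and L: "(\<lambda>n. l2_norm_sq \<Sigma> m (u n - \<omega>) + l2_norm_sq \<Sigma> m (\<delta> (u n - \<omega>))) \<longlonglongrightarrow> 0"
      unfolding dom_coboundary_D_def by blast
    show "\<omega> \<in> H \<and> \<delta> \<omega> \<in> H \<and> (\<exists>u. (\<forall>n. u n \<in> C_fin) \<and> l2_tendsto u \<omega> \<and>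
        l2_tendsto (\<lambda>n. \<delta> (u n)) (\<delta> \<omega>))"
      using key[OF \<omega> u] L \<omega> u by blast
  next
    assume "\<omega> \<in> H \<and> \<delta> \<omega> \<in> H \<and> (\<exists>u. (\<forall>n. u n \<in> C_fin) \<and> l2_tendsto u \<omega> \<and>
        l2_tendsto (\<lambda>n. \<delta> (u n)) (\<delta> \<omega>))"
    then obtain u where \<omega>: "\<omega> \<in> H" and u: "\<forall>n. u n \<in> C_fin"
      and R: "\<delta> \<omega> \<in> H \<and> l2_tendsto u \<omega> \<and> l2_tendsto (\<lambda>n. \<delta> (u n)) (\<delta> \<omega>)"
      by blast
    show "\<omega> \<in> D"
      unfolding dom_coboundary_D_def using key[OF \<omega> u] R \<omega> u by blast
  qed
qed

lemma D_approximation: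
  assumes "\<omega> \<in> D"
  obtains u where "\<omega> \<in> H" "\<delta> \<omega> \<in> H" "\<And>n. u n \<in> C_fin"
    "l2_tendsto u \<omega>" "l2_tendsto (\<lambda>n. \<delta> (u n)) (\<delta> \<omega>)"
  using assms unfolding D_iff by (elim conjE exE) blast

lemma D_intro:
  assumes "\<omega> \<in> H" "\<delta> \<omega> \<in> H" "\<And>n. u n \<in> C_fin"
    "l2_tendsto u \<omega>" "l2_tendsto (\<lambda>n. \<delta> (u n)) (\<delta> \<omega>)"
  shows "\<omega> \<in> D"
  unfolding D_iff using assms(3) by (intro conjI exI[of _ u] assms allI)

lemma D_fin: "\<omega> \<in> C_fin \<Longrightarrow> \<omega> \<in> D"
  by (rule D_intro[of _ "\<lambda>_. \<omega>"]) (simp_all add: cochains_fin_l2 \<delta>_fin_l2 norm_sq_def)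

lemma linear_subspace_D: "linear_subspace \<Sigma> m D"
  unfolding linear_subspace_def
proof (intro conjI ballI allI)
  show "D \<subseteq> H" using D_iff by blast
  show "0 \<in> D" by (rule D_fin[OF cochains_fin_zero])
next
  fix f g assume f: "f \<in> D" and g: "g \<in> D"
  obtain u where u: "f \<in> H" "\<delta> f \<in> H" "\<And>n. u n \<in> C_fin"
    "l2_tendsto u f" "l2_tendsto (\<lambda>n. \<delta> (u n)) (\<delta> f)" by (rule D_approximation[OF f]) blast
  obtain v where v: "g \<in> H" "\<delta> g \<in> H" "\<And>n. v n \<in> C_fin"
    "l2_tendsto v g" "l2_tendsto (\<lambda>n. \<delta> (v n)) (\<delta> g)" by (rule D_approximation[OF g]) blast
  have sum_lim: "(\<lambda>n. nsq (a n + b n - (c + d))) \<longlonglongrightarrow> 0"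
    if ab: "\<And>n. a n \<in> H" "c \<in> H" "l2_tendsto a c"
      "\<And>n. b n \<in> H" "d \<in> H" "l2_tendsto b d" for a b :: "nat \<Rightarrow> _" and c d
  proof (rule nsq_squeeze)
    show "nsq (a n + b n - (c + d)) \<le> 2 * nsq (a n - c) + 2 * nsq (b n - d)" for n
    proof -
      have "a n + b n - (c + d) = (a n - c) + (b n - d)" by simp
      then show ?thesis
        using nsq_le_parallelogram[OF l2_diff[OF ab(1,2), of n] l2_diff[OF ab(4,5), of n]] by (simp only:)
    qed
    have "(\<lambda>n. 2 * nsq (a n - c) + 2 * nsq (b n - d)) \<longlonglongrightarrow> 2 * 0 + 2 * 0"
      by (intro tendsto_intros ab)
    then show "(\<lambda>n. 2 * nsq (a n - c) + 2 * nsq (b n - d)) \<longlonglongrightarrow> 0" by (simp only: mult_zero_right add_0_right)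
  qed
  have \<delta>_f: "\<delta> (f + g) = \<delta> f + \<delta> g" by (intro \<delta>_add l2_cochain u v)
  have \<delta>_u: "\<delta> (u n + v n) = \<delta> (u n) + \<delta> (v n)" for n by (intro \<delta>_add cochains_fin_cochain u v)
  show "f + g \<in> D"
  proof (rule D_intro[of _ "\<lambda>n. u n + v n"])
    show "f + g \<in> H" by (intro l2_add u v)
    show "\<delta> (f + g) \<in> H" unfolding \<delta>_f by (intro l2_add u v)
    show "u n + v n \<in> C_fin" for n by (intro cochains_fin_add u v)
    show "(\<lambda>n. nsq (u n + v n - (f + g))) \<longlonglongrightarrow> 0"
      by (intro sum_lim u v cochains_fin_l2)
    show "(\<lambda>n. nsq (\<delta> (u n + v n) - \<delta> (f + g))) \<longlonglongrightarrow> 0"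
      unfolding \<delta>_f \<delta>_u by (intro sum_lim u v \<delta>_fin_l2)
  qed
next
  fix c f assume f: "f \<in> D"
  obtain u where u: "f \<in> H" "\<delta> f \<in> H" "\<And>n. u n \<in> C_fin"
    "l2_tendsto u f" "l2_tendsto (\<lambda>n. \<delta> (u n)) (\<delta> f)" by (rule D_approximation[OF f]) blast
  have scale_lim: "(\<lambda>n. nsq ((\<lambda>\<sigma>. c * a n \<sigma>) - (\<lambda>\<sigma>. c * b \<sigma>))) \<longlonglongrightarrow> 0"
    if ab: "\<And>n. a n \<in> H" "b \<in> H" "l2_tendsto a b" for a :: "nat \<Rightarrow> _" and b
  proof -
    have "(\<lambda>\<sigma>. c * a n \<sigma>) - (\<lambda>\<sigma>. c * b \<sigma>) = (\<lambda>\<sigma>. c * (a n - b) \<sigma>)" for n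
      by (rule ext) (simp add: algebra_simps)
    then have "(\<lambda>n. nsq ((\<lambda>\<sigma>. c * a n \<sigma>) - (\<lambda>\<sigma>. c * b \<sigma>))) = (\<lambda>n. (cmod c)\<^sup>2 * nsq (a n - b))"
      by (simp only: nsq_scale[OF l2_diff[OF ab(1,2)]])
    moreover have "(\<lambda>n. (cmod c)\<^sup>2 * nsq (a n - b)) \<longlonglongrightarrow> (cmod c)\<^sup>2 * 0"
      by (intro tendsto_intros ab)
    ultimately show ?thesis by (simp only: mult_zero_right)
  qed
  have \<delta>_f: "\<delta> (\<lambda>\<sigma>. c * f \<sigma>) = (\<lambda>\<sigma>. c * \<delta> f \<sigma>)" by (intro \<delta>_scale l2_cochain u)
  have \<delta>_u: "\<delta> (\<lambda>\<sigma>. c * u n \<sigma>) = (\<lambda>\<sigma>. c * \<delta> (u n) \<sigma>)" for n by (intro \<delta>_scale cochains_fin_cochain u)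
  show "(\<lambda>\<sigma>. c * f \<sigma>) \<in> D"
  proof (rule D_intro[of _ "\<lambda>n \<sigma>. c * u n \<sigma>"])
    show "(\<lambda>\<sigma>. c * f \<sigma>) \<in> H" by (intro l2_scale u)
    show "\<delta> (\<lambda>\<sigma>. c * f \<sigma>) \<in> H" unfolding \<delta>_f by (intro l2_scale u)
    show "(\<lambda>\<sigma>. c * u n \<sigma>) \<in> C_fin" for n by (intro cochains_fin_scale u)
    show "(\<lambda>n. nsq ((\<lambda>\<sigma>. c * u n \<sigma>) - (\<lambda>\<sigma>. c * f \<sigma>))) \<longlonglongrightarrow> 0"
      by (intro scale_lim u cochains_fin_l2)
    show "(\<lambda>n. nsq (\<delta> (\<lambda>\<sigma>. c * u n \<sigma>) - \<delta> (\<lambda>\<sigma>. c * f \<sigma>))) \<longlonglongrightarrow> 0"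
      unfolding \<delta>_f \<delta>_u by (intro scale_lim u \<delta>_fin_l2)
  qed
qed

lemma linear_subspace_\<delta>_image:
  assumes V: "linear_subspace \<Sigma> m V" and VD: "V \<subseteq> D"
  shows "linear_subspace \<Sigma> m (\<delta> ` V)"
  unfolding linear_subspace_def
proof (intro conjI ballI allI)
  have c: "a \<in> cochains \<Sigma>" if "a \<in> V" for a
    using that linear_subspace_subset[OF V] l2_cochain by blast
  show "\<delta> ` V \<subseteq> H" using VD D_iff by blast
  show "0 \<in> \<delta> ` V" using \<delta>_zero linear_subspace_zero[OF V] by (metis imageI)
  show "f + g \<in> \<delta> ` V" if fg: "f \<in> \<delta> ` V" "g \<in> \<delta> ` V" for f g
  proof -
    obtain a b where ab: "a \<in> V" "f = \<delta> a" "b \<in> V" "g = \<delta> b" using fg by blast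
    have "f + g = \<delta> (a + b)" using ab \<delta>_add[OF c c] by simp
    then show ?thesis using linear_subspace_add[OF V ab(1,3)] by (simp only: imageI)
  qed
  show "(\<lambda>\<sigma>. c * f \<sigma>) \<in> \<delta> ` V" if f: "f \<in> \<delta> ` V" for c f
  proof -
    obtain a where a: "a \<in> V" "f = \<delta> a" using f by blast
    have "(\<lambda>\<sigma>. c * f \<sigma>) = \<delta> (\<lambda>\<sigma>. c * a \<sigma>)" using a \<delta>_scale l2_cochain linear_subspace_subset[OF V] by auto
    then show ?thesis using linear_subspace_scale[OF V a(1)] by (simp only: imageI)
  qed
qed

lemma \<delta>_bd_adjoint:
  assumes \<omega>: "\<omega> \<in> D" and \<eta>: "\<eta> \<in> N"
  shows "ip (\<delta> \<omega>) \<eta> = ip \<omega> (bd \<eta>)"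
proof -
  obtain u where u: "\<omega> \<in> H" "\<delta> \<omega> \<in> H" "\<And>n. u n \<in> C_fin"
    "l2_tendsto u \<omega>" "l2_tendsto (\<lambda>n. \<delta> (u n)) (\<delta> \<omega>)" by (rule D_approximation[OF \<omega>]) blast
  have \<eta>H: "\<eta> \<in> H" "bd \<eta> \<in> H" using \<eta> N_iff by blast+
  have "(\<lambda>n. ip (\<delta> (u n)) \<eta>) \<longlonglongrightarrow> ip (\<delta> \<omega>) \<eta>"
    by (rule tendsto_ip_left[OF \<delta>_fin_l2[OF u(3)] u(2) \<eta>H(1) u(5)])
  moreover have "(\<lambda>n. ip (\<delta> (u n)) \<eta>) = (\<lambda>n. ip (u n) (bd \<eta>))"
    using ip_\<delta>_fin[OF \<eta>H(1) u(3)] by (rule ext)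
  moreover have "(\<lambda>n. ip (u n) (bd \<eta>)) \<longlonglongrightarrow> ip \<omega> (bd \<eta>)"
    by (rule tendsto_ip_left[OF cochains_fin_l2[OF u(3)] u(1) \<eta>H(2) u(4)])
  ultimately show ?thesis by (metis LIMSEQ_unique)
qed

text \<open>The boundary operator on \<open>N\<close> is the full adjoint of \<open>\<delta>\<close> on \<open>D\<close>: orthogonality to the coboundaries of
single simplices already forces \<open>bd \<eta> = 0\<close>.\<close>

lemma kernel_bd_eq_ortho: "{\<eta> \<in> N. bd \<eta> = 0} = ortho (\<delta> ` D)"
proof (intro equalityI subsetI)
  fix \<eta> assume "\<eta> \<in> {\<eta> \<in> N. bd \<eta> = 0}"
  then have \<eta>: "\<eta> \<in> N" "bd \<eta> = 0" by auto
  show "\<eta> \<in> ortho (\<delta> ` D)"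
  proof (rule orthoI)
    show "\<eta> \<in> H" using \<eta> N_iff by blast
    fix a assume "a \<in> \<delta> ` D"
    then obtain \<omega> where \<omega>: "\<omega> \<in> D" "a = \<delta> \<omega>" by blast
    have "ip a \<eta> = 0" using \<delta>_bd_adjoint[OF \<omega>(1) \<eta>(1)] \<omega> \<eta> by simp
    then show "ip \<eta> a = 0" using ip_zero_commute by blast
  qed
next
  fix \<eta> assume \<eta>: "\<eta> \<in> ortho (\<delta> ` D)"
  have "bd \<eta> = 0"
  proof (rule bd_eqI[OF cochains_zero])
    fix \<tau> assume \<tau>: "\<tau> \<in> \<Sigma>"
    show "ip \<eta> (\<delta> (single \<tau>)) = complex_of_real (m \<tau>) * 0 \<tau>"
      using orthoD[OF \<eta> imageI[OF D_fin[OF single_fin[OF \<tau>]]]] by simp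
  qed
  then show "\<eta> \<in> {\<eta> \<in> N. bd \<eta> = 0}"
    using \<eta> ortho_subset l2_zero by (auto simp only: N_iff)
qed

text \<open>The nontrivial inclusion expresses that the adjoint of the adjoint of a closed operator is the
operator itself. For \<open>f\<close> orthogonal to the range of \<open>bd\<close>, regularized projection onto the graph of
\<open>\<delta>\<close> splits \<open>f = p + bd (\<delta> p)\<close> with \<open>p \<in> D\<close>. Pairing this with \<open>bd (\<delta> p)\<close> gives
\<open>\<parallel>\<delta> p\<parallel>\<^sup>2 + \<parallel>bd (\<delta> p)\<parallel>\<^sup>2 = 0\<close>, so \<open>f = p\<close> and \<open>\<delta> f = 0\<close>.\<close>

lemma kernel_\<delta>_eq_ortho: "{\<omega> \<in> D. \<delta> \<omega> = 0} = ortho (bd ` N)"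
proof (intro equalityI subsetI)
  fix \<omega> assume "\<omega> \<in> {\<omega> \<in> D. \<delta> \<omega> = 0}"
  then have \<omega>: "\<omega> \<in> D" "\<delta> \<omega> = 0" by auto
  show "\<omega> \<in> ortho (bd ` N)"
  proof (rule orthoI)
    show "\<omega> \<in> H" using \<omega> D_iff by blast
    fix a assume "a \<in> bd ` N"
    then obtain \<eta> where \<eta>: "\<eta> \<in> N" "a = bd \<eta>" by blast
    show "ip \<omega> a = 0" using \<delta>_bd_adjoint[OF \<omega>(1) \<eta>(1)] \<omega> \<eta> by simp
  qed
next
  fix f assume f: "f \<in> ortho (bd ` N)"
  then have fH: "f \<in> H" using ortho_subset by blast
  have "\<exists>u p q. (\<forall>n. u n \<in> C_fin) \<and> p \<in> H \<and> q \<in> H \<and> l2_tendsto u p \<and>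
      l2_tendsto (\<lambda>n. \<delta> (u n)) q \<and> (\<forall>v\<in>C_fin. ip (f - p) v = ip q (\<delta> v))"
    by (rule regularized_projection[OF linear_subspace_cochains_fin fH])
      (simp_all only: \<delta>_fin_l2 \<delta>_add \<delta>_scale cochains_fin_cochain)
  then obtain u p q where u: "\<forall>n. u n \<in> C_fin" and p: "p \<in> H" and q: "q \<in> H"
    and lim: "l2_tendsto u p" "l2_tendsto (\<lambda>n. \<delta> (u n)) q"
    and adj: "\<forall>v\<in>C_fin. ip (f - p) v = ip q (\<delta> v)" by (elim exE conjE)
  have uf: "u n \<in> C_fin" for n using u by blast
  have \<delta>p: "\<delta> p = q"
    by (rule \<delta>_limit[OF cochains_fin_l2[OF uf] p lim(1) \<delta>_fin_l2[OF uf] q lim(2)])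
  have pD: "p \<in> D"
    by (rule D_intro[of p u]) (use \<delta>p p q uf lim in simp_all)
  have bdq: "bd q = f - p"
  proof (rule bd_eqI)
    show "f - p \<in> cochains \<Sigma>" by (intro cochains_diff l2_cochain fH p)
    fix \<tau> assume \<tau>: "\<tau> \<in> \<Sigma>"
    have "ip (f - p) (single \<tau>) = ip q (\<delta> (single \<tau>))" using adj single_fin[OF \<tau>] by blast
    then show "ip q (\<delta> (single \<tau>)) = m \<tau> * (f - p) \<tau>" using ip_single_right[OF \<tau>, of "f - p"] by (rule trans[OF sym])
  qed
  have fp: "f - p \<in> H" by (rule l2_diff[OF fH p])
  have qN: "q \<in> N" unfolding N_iff bdq using q fp by blast
  have "ip f (bd q) = 0" by (rule orthoD[OF f imageI[OF qN]])
  moreover have "ip p (bd q) = nsq q"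
    using \<delta>_bd_adjoint[OF pD qN] \<delta>p ip_self by simp
  moreover have "ip (f - p) (bd q) = nsq (f - p)" unfolding bdq by (rule ip_self)
  moreover have "ip (f - p) (bd q) = ip f (bd q) - ip p (bd q)"
    unfolding bdq by (rule ip_diff_left[OF fH p fp])
  ultimately have "complex_of_real (nsq (f - p)) = complex_of_real (- nsq q)" by simp
  then have "nsq (f - p) = - nsq q" by (simp only: of_real_eq_iff)
  then have "nsq q = 0" "nsq (f - p) = 0" using nsq_nonneg[of q] nsq_nonneg[of "f - p"] by linarith+
  then have "q = 0" "f - p = 0" using nsq_eq_0 q fp by blast+
  then have "f = p" "\<delta> f = 0" using \<delta>p by simp_all
  then show "f \<in> {\<omega> \<in> D. \<delta> \<omega> = 0}" using pD by simp
qed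

section \<open>Links of simplices and the relation \<open>\<partial>\<partial> = 0\<close>\<close>

abbreviation lk :: "'v set \<Rightarrow> 'v set" where
  "lk \<equiv> link X \<Sigma>"

abbreviation lg :: "'v set \<Rightarrow> 'v \<Rightarrow> 'v \<Rightarrow> real" where
  "lg \<equiv> link_graph \<Sigma> m"

lemma link_iff: "v \<in> lk \<rho> \<longleftrightarrow> v \<notin> \<rho> \<and> insert v \<rho> \<in> \<Sigma>"
proof -
  have "face \<rho> (insert v \<rho>) \<longleftrightarrow> v \<notin> \<rho>"
    by (cases "v \<in> \<rho>") (auto simp: face_iff insert_absorb)
  then show ?thesis using simplex_subset by (auto simp: link_def)
qed

lemma bij_link_cofaces:
  "bij_betw (\<lambda>v. insert v \<rho>) (lk \<rho>) {\<sigma> \<in> \<Sigma>. face \<rho> \<sigma>}"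
  unfolding bij_betw_def
proof
  show "inj_on (\<lambda>v. insert v \<rho>) (lk \<rho>)"
    by (rule inj_onI) (auto simp: link_iff)
  show "(\<lambda>v. insert v \<rho>) ` lk \<rho> = {\<sigma> \<in> \<Sigma>. face \<rho> \<sigma>}"
    by (auto simp: link_iff face_iff)
qed

lemma link_weight_summable: "\<rho> \<in> \<Sigma> \<Longrightarrow> (\<lambda>v. m (insert v \<rho>)) summable_on lk \<rho>"
  using summable_on_reindex_bij_betw[OF bij_link_cofaces, of m \<rho>] cofaces_summable by blast

lemma link_countable: "\<rho> \<in> \<Sigma> \<Longrightarrow> countable (lk \<rho>)"
proof -
  assume "\<rho> \<in> \<Sigma>"
  then have "countable {v \<in> lk \<rho>. m (insert v \<rho>) \<noteq> 0}"
    by (rule summable_countable_real[OF link_weight_summable])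
  moreover have "m (insert v \<rho>) \<noteq> 0" if "v \<in> lk \<rho>" for v
    using that simplex_weight[of "insert v \<rho>"] by (auto simp: link_iff)
  then have "{v \<in> lk \<rho>. m (insert v \<rho>) \<noteq> 0} = lk \<rho>" by blast
  ultimately show ?thesis by simp
qed

lemma link_graph_commute: "lg \<rho> v v' = lg \<rho> v' v"
  by (auto simp: link_graph_def insert_commute)

lemma link_graph_nonneg: "0 \<le> lg \<rho> v v'"
  using simplex_weight by (auto simp: link_graph_def intro: less_imp_le)

text \<open>The neighbours of \<open>v\<close> in the link graph of \<open>\<rho>\<close> form the link of \<open>v\<rho>\<close>, which turns sums over cofaces of
\<open>v\<rho>\<close> into sums over neighbours of \<open>v\<close>.\<close>

lemma link_graph_pos_iff:
  assumes v: "v \<in> lk \<rho>"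
  shows "v' \<in> lk (insert v \<rho>) \<longleftrightarrow> v' \<in> lk \<rho> \<and> 0 < lg \<rho> v v'"
    and "v' \<in> lk (insert v \<rho>) \<Longrightarrow> lg \<rho> v v' = m (insert v' (insert v \<rho>))"
proof -
  show 1: "lg \<rho> v v' = m (insert v' (insert v \<rho>))"
    if "v' \<in> lk (insert v \<rho>)"
    using that by (auto simp: link_graph_def link_iff insert_commute)
  show "v' \<in> lk (insert v \<rho>) \<longleftrightarrow> v' \<in> lk \<rho> \<and> 0 < lg \<rho> v v'"
  proof
    assume *: "v' \<in> lk (insert v \<rho>)"
    then have "insert v' \<rho> \<in> \<Sigma>" "v' \<notin> \<rho>"
      using nonempty_face_simplex[of "insert v' (insert v \<rho>)" "insert v' \<rho>"]
      by (auto simp: link_iff)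
    moreover have "0 < lg \<rho> v v'"
      unfolding 1[OF *] using * simplex_weight by (simp add: link_iff)
    ultimately show "v' \<in> lk \<rho> \<and> 0 < lg \<rho> v v'" by (simp add: link_iff)
  next
    assume "v' \<in> lk \<rho> \<and> 0 < lg \<rho> v v'"
    then show "v' \<in> lk (insert v \<rho>)"
      by (auto simp: link_iff link_graph_def insert_commute split: if_splits)
  qed
qed

lemma link_graph_zero:
  assumes "v \<in> lk \<rho>" "v' \<in> lk \<rho>" "v' \<notin> lk (insert v \<rho>)"
  shows "lg \<rho> v v' = 0"
proof -
  have "\<not> 0 < lg \<rho> v v'"
    using link_graph_pos_iff(1)[OF assms(1)] assms(2,3) by blast
  then show ?thesis using link_graph_nonneg[of \<rho> v v'] by linarith
qed

lemma link_graph_summable: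
  assumes C: "C \<subseteq> lk \<rho>" and v: "v \<in> lk \<rho>"
  shows "lg \<rho> v summable_on C"
proof -
  have "(\<lambda>v'. m (insert v' (insert v \<rho>))) summable_on lk (insert v \<rho>)"
    using v by (intro link_weight_summable) (simp add: link_iff)
  then have "lg \<rho> v summable_on lk (insert v \<rho>)"
    by (rule summable_on_cong[THEN iffD1, rotated]) (simp add: link_graph_pos_iff(2)[OF v])
  then have "lg \<rho> v summable_on lk \<rho>"
    by (rule summable_on_cong_neutral[THEN iffD1, rotated -1])
      (use link_graph_zero[OF v] link_graph_pos_iff(1)[OF v] in blast)+
  then show ?thesis using C by (rule summable_on_subset_banach)
qed

text \<open>The function \<open>\<phi>\<close> on the link of \<open>\<rho>\<close>, moved to the cofaces of \<open>\<rho>\<close>. The factor \<open>\<theta> \<rho> \<tau>\<close> makes it the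
coboundary of \<open>1_\<rho>\<close> if \<open>\<phi>\<close> is constantly \<open>1\<close>.\<close>

definition star_cochain :: "'v set \<Rightarrow> ('v \<Rightarrow> real) \<Rightarrow> 'v set \<Rightarrow> complex" where
  "star_cochain \<rho> \<phi> \<tau> =
     (if \<tau> \<in> \<Sigma> \<and> face \<rho> \<tau> then complex_of_real (\<phi> (the_elem (\<tau> - \<rho>))) * \<theta> \<rho> \<tau> else 0)"

lemma star_cochain_insert:
  assumes "v \<in> lk \<rho>"
  shows "star_cochain \<rho> \<phi> (insert v \<rho>) = complex_of_real (\<phi> v) * \<theta> \<rho> (insert v \<rho>)"
proof -
  have "insert v \<rho> - \<rho> = {v}" "insert v \<rho> \<in> \<Sigma>" "face \<rho> (insert v \<rho>)"
    using assms by (auto simp: link_iff face_iff)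
  then show ?thesis by (simp add: star_cochain_def)
qed

lemma star_cochain_cochain: "star_cochain \<rho> \<phi> \<in> cochains \<Sigma>"
  by (simp add: cochains_def star_cochain_def)

lemma star_cochain_fin:
  assumes K: "finite K" "K \<subseteq> lk \<rho>" and \<phi>: "\<And>v. v \<notin> K \<Longrightarrow> \<phi> v = 0"
  shows "star_cochain \<rho> \<phi> \<in> C_fin"
    and "ip (star_cochain \<rho> \<phi>) g =
      (\<Sum>v\<in>K. complex_of_real (m (insert v \<rho>) * \<phi> v) * \<theta> \<rho> (insert v \<rho>) * cnj (g (insert v \<rho>)))"
proof -
  have supp: "star_cochain \<rho> \<phi> \<tau> = 0" if "\<tau> \<notin> (\<lambda>v. insert v \<rho>) ` K" for \<tau>
  proof (cases "\<tau> \<in> \<Sigma> \<and> face \<rho> \<tau>")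
    case True
    then obtain v where v: "v \<notin> \<rho>" "\<tau> = insert v \<rho>" by (auto simp: face_iff)
    then have "v \<in> lk \<rho>" "v \<notin> K" using True that by (auto simp: link_iff)
    then show ?thesis using v \<phi> by (simp add: star_cochain_insert)
  qed (auto simp: star_cochain_def)
  have "{\<tau>. star_cochain \<rho> \<phi> \<tau> \<noteq> 0} \<subseteq> (\<lambda>v. insert v \<rho>) ` K" using supp by blast
  then show "star_cochain \<rho> \<phi> \<in> C_fin"
    using star_cochain_cochain finite_subset[OF _ finite_imageI[OF K(1)]]
    by (simp add: cochains_fin_def)
  have sub: "(\<lambda>v. insert v \<rho>) ` K \<subseteq> \<Sigma>" using K by (auto simp: link_iff)
  have "ip (star_cochain \<rho> \<phi>) g =
      (\<Sum>\<^sub>\<infinity>\<tau>\<in>(\<lambda>v. insert v \<rho>) ` K. complex_of_real (m \<tau>) * star_cochain \<rho> \<phi> \<tau> * cnj (g \<tau>))"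
    unfolding l2_inner_def using sub supp by (intro infsum_cong_neutral) auto
  also have "\<dots> = (\<Sum>\<tau>\<in>(\<lambda>v. insert v \<rho>) ` K. complex_of_real (m \<tau>) * star_cochain \<rho> \<phi> \<tau> * cnj (g \<tau>))"
    using K by (intro infsum_finite) simp
  also have "\<dots> = (\<Sum>v\<in>K. complex_of_real (m (insert v \<rho>)) * star_cochain \<rho> \<phi> (insert v \<rho>) * cnj (g (insert v \<rho>)))"
    by (rule sum.reindex_cong[OF _ refl refl])
      (rule inj_on_subset[OF bij_betw_imp_inj_on[OF bij_link_cofaces] K(2)])
  also have "\<dots> = (\<Sum>v\<in>K. complex_of_real (m (insert v \<rho>) * \<phi> v) * \<theta> \<rho> (insert v \<rho>) * cnj (g (insert v \<rho>)))"
    using K(2) by (intro sum.cong) (auto simp: star_cochain_insert)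
  finally show "ip (star_cochain \<rho> \<phi>) g =
      (\<Sum>v\<in>K. complex_of_real (m (insert v \<rho>) * \<phi> v) * \<theta> \<rho> (insert v \<rho>) * cnj (g (insert v \<rho>)))" .
qed

lemma \<delta>_two_faces:
  assumes \<omega>: "\<omega> \<in> cochains \<Sigma>" and supp: "\<And>\<tau>. \<omega> \<tau> \<noteq> 0 \<Longrightarrow> face \<rho> \<tau>"
    and v: "v \<in> lk \<rho>" and v': "v' \<in> lk (insert v \<rho>)"
  shows "\<delta> \<omega> (insert v' (insert v \<rho>)) =
     \<theta> (insert v \<rho>) (insert v' (insert v \<rho>)) * \<omega> (insert v \<rho>) +
     \<theta> (insert v' \<rho>) (insert v' (insert v \<rho>)) * \<omega> (insert v' \<rho>)"
proof -
  let ?\<sigma> = "insert v' (insert v \<rho>)"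
  have ne: "v' \<noteq> v" "v' \<notin> \<rho>" "v \<notin> \<rho>" and \<sigma>: "?\<sigma> \<in> \<Sigma>" using v v' by (auto simp: link_iff)
  have v'\<rho>: "insert v' \<rho> \<in> \<Sigma>"
    using link_graph_pos_iff(1)[OF v] v' by (simp add: link_iff)
  have faces: "face \<tau> ?\<sigma> \<and> face \<rho> \<tau> \<longleftrightarrow> \<tau> = insert v' \<rho> \<or> \<tau> = insert v \<rho>" for \<tau>
    by (rule faces_between[OF ne])
  have "\<delta> \<omega> ?\<sigma> = (\<Sum>\<tau> | \<tau> \<in> \<Sigma> \<and> face \<tau> ?\<sigma>. \<theta> \<tau> ?\<sigma> * \<omega> \<tau>)" by (rule \<delta>_apply[OF \<omega> \<sigma>])
  also have "\<dots> = (\<Sum>\<tau>\<in>{insert v \<rho>, insert v' \<rho>}. \<theta> \<tau> ?\<sigma> * \<omega> \<tau>)"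
  proof (rule sum.mono_neutral_right)
    show "finite {\<tau> \<in> \<Sigma>. face \<tau> ?\<sigma>}" by (rule finite_faces[OF \<sigma>])
    have "face (insert v \<rho>) ?\<sigma>" "face (insert v' \<rho>) ?\<sigma>" using faces by blast+
    then show "{insert v \<rho>, insert v' \<rho>} \<subseteq> {\<tau> \<in> \<Sigma>. face \<tau> ?\<sigma>}"
      using v v'\<rho> unfolding link_iff by blast
    show "\<forall>\<tau>\<in>{\<tau> \<in> \<Sigma>. face \<tau> ?\<sigma>} - {insert v \<rho>, insert v' \<rho>}. \<theta> \<tau> ?\<sigma> * \<omega> \<tau> = 0"
    proof
      fix \<tau> assume "\<tau> \<in> {\<tau> \<in> \<Sigma>. face \<tau> ?\<sigma>} - {insert v \<rho>, insert v' \<rho>}"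
      then have "\<not> face \<rho> \<tau>" using faces by blast
      then have "\<omega> \<tau> = 0" using supp by blast
      then show "\<theta> \<tau> ?\<sigma> * \<omega> \<tau> = 0" by simp
    qed
  qed
  also have "insert v \<rho> \<noteq> insert v' \<rho>" using ne by blast
  then have "(\<Sum>\<tau>\<in>{insert v \<rho>, insert v' \<rho>}. \<theta> \<tau> ?\<sigma> * \<omega> \<tau>) =
      \<theta> (insert v \<rho>) ?\<sigma> * \<omega> (insert v \<rho>) + \<theta> (insert v' \<rho>) ?\<sigma> * \<omega> (insert v' \<rho>)"
    by simp
  finally show ?thesis .
qed

text \<open>Applying \<open>\<delta>\<delta> = 0\<close> to \<open>1_\<rho>\<close> at \<open>vv'\<rho>\<close> shows that the two paths from \<open>\<rho>\<close> to \<open>vv'\<rho>\<close> carry opposite signs.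
So the coboundary of \<open>star_cochain \<rho> \<phi>\<close> is, up to sign, the gradient of \<open>\<phi>\<close> on the link graph.\<close>

lemma \<delta>_star_cochain:
  assumes \<rho>: "\<rho> \<in> \<Sigma>" and v: "v \<in> lk \<rho>" and v': "v' \<in> lk (insert v \<rho>)"
  shows "\<theta> (insert v \<rho>) (insert v' (insert v \<rho>)) * \<delta> (star_cochain \<rho> \<phi>) (insert v' (insert v \<rho>)) =
     \<theta> \<rho> (insert v \<rho>) * complex_of_real (\<phi> v - \<phi> v')"
proof -
  let ?\<sigma> = "insert v' (insert v \<rho>)"
  define s s' t t' where s_def: "s = \<theta> \<rho> (insert v \<rho>)" "s' = \<theta> \<rho> (insert v' \<rho>)"
    "t = \<theta> (insert v \<rho>) ?\<sigma>" "t' = \<theta> (insert v' \<rho>) ?\<sigma>"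
  have v'l: "v' \<in> lk \<rho>" using link_graph_pos_iff(1)[OF v] v' by blast
  have v\<rho>: "insert v \<rho> \<in> \<Sigma>" "insert v' \<rho> \<in> \<Sigma>" "?\<sigma> \<in> \<Sigma>" using v v' v'l by (auto simp: link_iff)
  have f: "face \<rho> (insert v \<rho>)" "face \<rho> (insert v' \<rho>)" "face (insert v \<rho>) ?\<sigma>"
    using v v' v'l by (auto simp: link_iff face_iff)
  have "\<delta> (\<delta> (single \<rho>)) ?\<sigma> = t * \<delta> (single \<rho>) (insert v \<rho>) + t' * \<delta> (single \<rho>) (insert v' \<rho>)"
    unfolding s_def
    by (rule \<delta>_two_faces[OF \<delta>_cochain[OF single_cochain[OF \<rho>]] _ v v'])
      (simp add: \<delta>_single \<rho> split: if_splits)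
  then have rel: "t * s + t' * s' = 0"
    using \<delta>\<delta>[OF single_cochain[OF \<rho>]] v\<rho> f \<rho> by (simp add: \<delta>_single s_def)
  have tt: "t * t = 1" using \<theta>_cases[OF v\<rho>(3) v\<rho>(1) f(3)] by (auto simp: s_def)
  have "\<delta> (star_cochain \<rho> \<phi>) ?\<sigma> = t * star_cochain \<rho> \<phi> (insert v \<rho>) + t' * star_cochain \<rho> \<phi> (insert v' \<rho>)"
    unfolding s_def
    by (rule \<delta>_two_faces[OF star_cochain_cochain _ v v']) (simp add: star_cochain_def split: if_splits)
  also have "\<dots> = t * (\<phi> v * s) + t' * (\<phi> v' * s')"
    by (simp add: star_cochain_insert v v'l s_def)
  also have "\<dots> = t * s * (complex_of_real (\<phi> v) - \<phi> v') + (t * s + t' * s') * \<phi> v'"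
    by (simp add: algebra_simps)
  also have "\<dots> = t * s * complex_of_real (\<phi> v - \<phi> v')" using rel by simp
  finally have "t * \<delta> (star_cochain \<rho> \<phi>) ?\<sigma> = (t * t) * (s * complex_of_real (\<phi> v - \<phi> v'))"
    by (simp only: mult.assoc)
  then have "t * \<delta> (star_cochain \<rho> \<phi>) ?\<sigma> = s * complex_of_real (\<phi> v - \<phi> v')"
    unfolding tt by (simp only: mult_1)
  then show ?thesis by (simp only: s_def)
qed

text \<open>Summation by parts: \<open>\<langle>\<delta>\<omega>, \<delta>\<omega>\<rangle> = \<langle>\<omega>, \<partial>\<delta>\<omega>\<rangle>\<close> is a finite sum over the support of \<open>\<phi>\<close>, and \<open>\<partial>\<delta>\<omega>\<close> at \<open>v\<rho>\<close> is
the graph Laplacian of \<open>\<phi>\<close> at \<open>v\<close>, up to the factor \<open>\<theta>(\<rho>,v\<rho>) / m(v\<rho>)\<close>. Since \<open>\<phi>\<close> lives on a single component \<open>C\<close>, only neighbours in \<open>C\<close>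
contribute.\<close>

lemma energy_star_cochain:
  assumes \<rho>: "\<rho> \<in> \<Sigma>" and C: "C \<in> graph_components (lk \<rho>) (lg \<rho>)"
    and K: "finite K" "K \<subseteq> C" and \<phi>: "\<And>v. v \<notin> K \<Longrightarrow> \<phi> v = 0"
  shows "nsq (\<delta> (star_cochain \<rho> \<phi>)) = (\<Sum>v\<in>K. \<phi> v *
     ((\<Sum>\<^sub>\<infinity>z\<in>C. lg \<rho> v z) * \<phi> v - (\<Sum>z\<in>K. lg \<rho> v z * \<phi> z)))"
proof -
  let ?\<omega> = "star_cochain \<rho> \<phi>" and ?b = "lg \<rho>"
  define E where "E v = (\<Sum>\<^sub>\<infinity>z\<in>C. ?b v z) * \<phi> v - (\<Sum>z\<in>K. ?b v z * \<phi> z)" for v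
  have CL: "C \<subseteq> lk \<rho>" by (rule graph_component_subset(1)[OF C])
  have KL: "K \<subseteq> lk \<rho>" using K CL by blast
  note fin = star_cochain_fin[where \<phi> = \<phi>, OF K(1) KL \<phi>]
  have \<delta>\<omega>: "\<delta> ?\<omega> \<in> H" by (rule \<delta>_fin_l2[OF fin(1)])
  have bd_val: "complex_of_real (m (insert v \<rho>)) * bd (\<delta> ?\<omega>) (insert v \<rho>) =
      \<theta> \<rho> (insert v \<rho>) * complex_of_real (E v)" if vC: "v \<in> C" for v
  proof -
    have v: "v \<in> lk \<rho>" using vC CL by blast
    then have v\<rho>: "insert v \<rho> \<in> \<Sigma>" by (simp add: link_iff)
    have "complex_of_real (m (insert v \<rho>)) * bd (\<delta> ?\<omega>) (insert v \<rho>) =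
        (\<Sum>\<^sub>\<infinity>\<sigma>\<in>{\<sigma> \<in> \<Sigma>. face (insert v \<rho>) \<sigma>}. complex_of_real (m \<sigma>) * \<theta> (insert v \<rho>) \<sigma> * \<delta> ?\<omega> \<sigma>)"
      using simplex_weight[OF v\<rho>] by (simp add: boundary_def v\<rho>)
    also have "\<dots> = (\<Sum>\<^sub>\<infinity>z\<in>lk (insert v \<rho>). complex_of_real (m (insert z (insert v \<rho>))) *
        \<theta> (insert v \<rho>) (insert z (insert v \<rho>)) * \<delta> ?\<omega> (insert z (insert v \<rho>)))"
      by (rule infsum_reindex_bij_betw[OF bij_link_cofaces, symmetric])
    also have "\<dots> = (\<Sum>\<^sub>\<infinity>z\<in>lk (insert v \<rho>).
        \<theta> \<rho> (insert v \<rho>) * complex_of_real (?b v z * (\<phi> v - \<phi> z)))"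
    proof (rule infsum_cong)
      fix z assume z: "z \<in> lk (insert v \<rho>)"
      show "complex_of_real (m (insert z (insert v \<rho>))) *
          \<theta> (insert v \<rho>) (insert z (insert v \<rho>)) * \<delta> ?\<omega> (insert z (insert v \<rho>)) =
          \<theta> \<rho> (insert v \<rho>) * complex_of_real (?b v z * (\<phi> v - \<phi> z))"
        unfolding link_graph_pos_iff(2)[OF v z] mult.assoc \<delta>_star_cochain[OF \<rho> v z]
        by (simp add: mult_ac)
    qed
    also have "\<dots> = \<theta> \<rho> (insert v \<rho>) *
        (\<Sum>\<^sub>\<infinity>z\<in>lk (insert v \<rho>). complex_of_real (?b v z * (\<phi> v - \<phi> z)))"
      by (rule infsum_cmult_right')
    also have "(\<Sum>\<^sub>\<infinity>z\<in>lk (insert v \<rho>). complex_of_real (?b v z * (\<phi> v - \<phi> z))) =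
        complex_of_real (\<Sum>\<^sub>\<infinity>z\<in>lk (insert v \<rho>). ?b v z * (\<phi> v - \<phi> z))"
      by (rule infsum_complex_of_real)
    also have "(\<Sum>\<^sub>\<infinity>z\<in>lk (insert v \<rho>). ?b v z * (\<phi> v - \<phi> z)) =
        (\<Sum>\<^sub>\<infinity>z\<in>C. ?b v z * (\<phi> v - \<phi> z))"
    proof (rule infsum_cong_neutral)
      fix z assume "z \<in> C - lk (insert v \<rho>)"
      then show "?b v z * (\<phi> v - \<phi> z) = 0" using link_graph_zero[OF v] CL by auto
    next
      fix z assume z: "z \<in> lk (insert v \<rho>) - C"
      then have "z \<in> lk \<rho>" "0 < ?b v z" using link_graph_pos_iff(1)[OF v] by blast+
      then have "z \<in> C" by (rule graph_component_closed[OF C vC])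
      then show "?b v z * (\<phi> v - \<phi> z) = 0" using z by blast
    qed simp
    also have "\<dots> = E v"
    proof -
      have 1: "(\<lambda>z. ?b v z * \<phi> v) summable_on C"
        by (intro summable_on_cmult_left link_graph_summable[OF CL v])
      have 2: "(\<lambda>z. - (?b v z * \<phi> z)) summable_on C"
        by (rule finite_nonzero_values_imp_summable_on, rule finite_subset[OF _ K(1)])
          (use \<phi> in auto)
      have "(\<Sum>\<^sub>\<infinity>z\<in>C. ?b v z * (\<phi> v - \<phi> z)) = (\<Sum>\<^sub>\<infinity>z\<in>C. ?b v z * \<phi> v + - (?b v z * \<phi> z))"
        by (simp add: right_diff_distrib)
      also have "\<dots> = (\<Sum>\<^sub>\<infinity>z\<in>C. ?b v z * \<phi> v) + (\<Sum>\<^sub>\<infinity>z\<in>C. - (?b v z * \<phi> z))"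
        by (rule infsum_add[OF 1 2])
      also have "(\<Sum>\<^sub>\<infinity>z\<in>C. ?b v z * \<phi> v) = (\<Sum>\<^sub>\<infinity>z\<in>C. ?b v z) * \<phi> v" by (rule infsum_cmult_left')
      also have "(\<Sum>\<^sub>\<infinity>z\<in>C. - (?b v z * \<phi> z)) = (\<Sum>\<^sub>\<infinity>z\<in>K. - (?b v z * \<phi> z))"
        by (rule infsum_cong_neutral) (use \<phi> K in auto)
      also have "\<dots> = - (\<Sum>z\<in>K. ?b v z * \<phi> z)" using K by (simp add: sum_negf)
      finally show ?thesis by (simp add: E_def)
    qed
    finally show ?thesis .
  qed
  have "complex_of_real (nsq (\<delta> ?\<omega>)) = ip ?\<omega> (bd (\<delta> ?\<omega>))"
    unfolding ip_self[symmetric] by (rule ip_\<delta>_fin[OF \<delta>\<omega> fin(1)])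
  also have "\<dots> = (\<Sum>v\<in>K. complex_of_real (m (insert v \<rho>) * \<phi> v) * \<theta> \<rho> (insert v \<rho>) *
      cnj (bd (\<delta> ?\<omega>) (insert v \<rho>)))" by (rule fin(2))
  also have "\<dots> = (\<Sum>v\<in>K. complex_of_real (\<phi> v * E v))"
  proof (rule sum.cong[OF refl])
    fix v assume vK: "v \<in> K"
    then have v: "v \<in> lk \<rho>" and vC: "v \<in> C" using K KL by blast+
    have "face \<rho> (insert v \<rho>)" "insert v \<rho> \<in> \<Sigma>" using v by (auto simp: link_iff face_iff)
    then have s: "\<theta> \<rho> (insert v \<rho>) = 1 \<or> \<theta> \<rho> (insert v \<rho>) = - 1"
      using \<theta>_cases \<rho> by blast
    have "complex_of_real (m (insert v \<rho>) * \<phi> v) * \<theta> \<rho> (insert v \<rho>) * cnj (bd (\<delta> ?\<omega>) (insert v \<rho>)) =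
        \<phi> v * \<theta> \<rho> (insert v \<rho>) * cnj (complex_of_real (m (insert v \<rho>)) * bd (\<delta> ?\<omega>) (insert v \<rho>))"
      by simp
    also have "\<dots> = \<phi> v * (\<theta> \<rho> (insert v \<rho>) * cnj (\<theta> \<rho> (insert v \<rho>))) * E v"
      unfolding bd_val[OF vC] by simp
    also have "\<theta> \<rho> (insert v \<rho>) * cnj (\<theta> \<rho> (insert v \<rho>)) = 1" using s by auto
    finally show "complex_of_real (m (insert v \<rho>) * \<phi> v) * \<theta> \<rho> (insert v \<rho>) *
        cnj (bd (\<delta> ?\<omega>) (insert v \<rho>)) = complex_of_real (\<phi> v * E v)" by simp
  qed
  also have "\<dots> = complex_of_real (\<Sum>v\<in>K. \<phi> v * E v)" by simp
  finally have "nsq (\<delta> ?\<omega>) = (\<Sum>v\<in>K. \<phi> v * E v)" by (simp only: of_real_eq_iff)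
  then show ?thesis by (simp add: E_def)
qed

lemma link_weighted_summable:
  assumes \<rho>: "\<rho> \<in> \<Sigma>" and g: "g \<in> H"
  shows "(\<lambda>v. norm (complex_of_real (m (insert v \<rho>)) * \<theta> \<rho> (insert v \<rho>) * cnj (g (insert v \<rho>))))
           summable_on lk \<rho>"
proof -
  have "(\<lambda>\<tau>. m \<tau> * cmod (g \<tau>)) summable_on {\<tau> \<in> \<Sigma>. face \<rho> \<tau>}"
    using l2_dom_boundary[OF g] \<rho> unfolding dom_boundary_def by blast
  then have "(\<lambda>v. m (insert v \<rho>) * cmod (g (insert v \<rho>))) summable_on lk \<rho>"
    using summable_on_reindex_bij_betw[OF bij_link_cofaces, of "\<lambda>\<tau>. m \<tau> * cmod (g \<tau>)" \<rho>] by simp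
  moreover have "norm (complex_of_real (m (insert v \<rho>)) * \<theta> \<rho> (insert v \<rho>) * cnj (g (insert v \<rho>))) =
      m (insert v \<rho>) * cmod (g (insert v \<rho>))" if v: "v \<in> lk \<rho>" for v
  proof -
    have f: "face \<rho> (insert v \<rho>)" "insert v \<rho> \<in> \<Sigma>" using v by (auto simp: link_iff face_iff)
    then have "cmod (\<theta> \<rho> (insert v \<rho>)) = 1" using \<theta>_cases[OF f(2) \<rho> f(1)] by auto
    then show ?thesis using simplex_weight[OF f(2)] by (simp add: norm_mult)
  qed
  ultimately show ?thesis by (simp cong: summable_on_cong)
qed

text \<open>Tested against the star cochains of a null sequence on \<open>C\<close>, the boundary of \<open>\<eta>\<close> gives
\<open>\<langle>\<omega>_n, \<partial>\<eta>\<rangle> = \<langle>\<delta>\<omega>_n, \<eta>\<rangle>\<close>, which tends to \<open>0\<close> since the energies do. The left-hand sides converge to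
the sum over the whole component.\<close>

lemma component_sum_zero:
  assumes \<rho>: "\<rho> \<in> \<Sigma>" and C: "C \<in> graph_components (lk \<rho>) (lg \<rho>)"
    and rec: "recurrent_graph C (lg \<rho>)" and \<eta>: "\<eta> \<in> N"
  shows "(\<Sum>\<^sub>\<infinity>v\<in>C. complex_of_real (m (insert v \<rho>)) * \<theta> \<rho> (insert v \<rho>) * cnj (bd \<eta> (insert v \<rho>))) = 0"
proof -
  let ?b = "lg \<rho>"
  define g where "g v = complex_of_real (m (insert v \<rho>)) * \<theta> \<rho> (insert v \<rho>) * cnj (bd \<eta> (insert v \<rho>))" for v
  have CL: "C \<subseteq> lk \<rho>" "C \<noteq> {}" by (rule graph_component_subset[OF C])+
  have \<eta>H: "\<eta> \<in> H" "bd \<eta> \<in> H" using \<eta> N_iff by blast+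
  have g_sum: "(\<lambda>v. norm (g v)) summable_on C"
    unfolding g_def by (rule summable_on_subset_banach[OF link_weighted_summable[OF \<rho> \<eta>H(2)] CL(1)])
  have C_count: "countable C" using countable_subset[OF CL(1) link_countable[OF \<rho>]] .
  have loop: "?b x x = 0" for x by (simp add: link_graph_def)
  have b_sum: "?b x summable_on C" if "x \<in> C" for x
    by (rule link_graph_summable[OF CL(1)]) (use that CL in blast)
  show ?thesis
  proof (rule recurrent_imp_null_sequence[OF rec C_count CL(2) link_graph_nonneg loop b_sum])
    fix K and \<phi> :: "nat \<Rightarrow> 'v \<Rightarrow> real" and e
    assume K: "\<And>n. finite (K n)" "\<And>n. K n \<subseteq> C"
      and \<phi>: "\<And>n v. 0 \<le> \<phi> n v" "\<And>n v. \<phi> n v \<le> 1" "\<And>n v. v \<notin> K n \<Longrightarrow> \<phi> n v = 0"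
      and lim: "\<And>v. v \<in> C \<Longrightarrow> (\<lambda>n. \<phi> n v) \<longlonglongrightarrow> 1" and e: "e \<longlonglongrightarrow> 0"
      and energy: "\<And>n. (\<Sum>v\<in>K n. \<phi> n v * ((\<Sum>\<^sub>\<infinity>z\<in>C. ?b v z) * \<phi> n v - (\<Sum>z\<in>K n. ?b v z * \<phi> n z))) \<le> e n"
    define \<omega> where "\<omega> n = star_cochain \<rho> (\<phi> n)" for n
    have KL: "K n \<subseteq> lk \<rho>" for n using K CL by blast
    have fin: "\<omega> n \<in> C_fin" for n
      unfolding \<omega>_def by (rule star_cochain_fin(1)[OF K(1) KL \<phi>(3)])
    have nsq_le: "nsq (\<delta> (\<omega> n)) \<le> e n" for n
      unfolding \<omega>_def
      by (rule ord_eq_le_trans[OF energy_star_cochain[OF \<rho> C K(1)[of n] K(2) \<phi>(3)] energy])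
    have ip_eq: "ip (\<delta> (\<omega> n)) \<eta> = (\<Sum>\<^sub>\<infinity>v\<in>C. complex_of_real (\<phi> n v) * g v)" for n
    proof -
      have "ip (\<delta> (\<omega> n)) \<eta> = ip (\<omega> n) (bd \<eta>)" by (rule ip_\<delta>_fin[OF \<eta>H(1) fin])
      also have "\<dots> = (\<Sum>v\<in>K n. complex_of_real (m (insert v \<rho>) * \<phi> n v) * \<theta> \<rho> (insert v \<rho>) *
          cnj (bd \<eta> (insert v \<rho>)))"
        unfolding \<omega>_def by (rule star_cochain_fin(2)[OF K(1) KL]) (rule \<phi>(3))
      also have "\<dots> = (\<Sum>v\<in>K n. complex_of_real (\<phi> n v) * g v)"
        unfolding g_def by (intro sum.cong refl) (simp add: mult_ac)
      also have "\<dots> = (\<Sum>\<^sub>\<infinity>v\<in>K n. complex_of_real (\<phi> n v) * g v)" using K(1) by simp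
      also have "\<dots> = (\<Sum>\<^sub>\<infinity>v\<in>C. complex_of_real (\<phi> n v) * g v)"
        by (rule infsum_cong_neutral) (use K \<phi> in auto)
      finally show ?thesis .
    qed
    have "(\<lambda>n. \<Sum>\<^sub>\<infinity>v\<in>C. complex_of_real (\<phi> n v) * g v) \<longlonglongrightarrow> (\<Sum>\<^sub>\<infinity>v\<in>C. g v)"
      by (rule tendsto_infsum_dominated[OF g_sum _ lim]) (simp add: \<phi>)
    then have lim_g: "(\<lambda>n. ip (\<delta> (\<omega> n)) \<eta>) \<longlonglongrightarrow> (\<Sum>\<^sub>\<infinity>v\<in>C. g v)" by (simp only: ip_eq)
    have "(\<lambda>n. sqrt (e n * nsq \<eta>)) \<longlonglongrightarrow> sqrt (0 * nsq \<eta>)" by (intro tendsto_intros e)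
    then have lim0: "(\<lambda>n. sqrt (e n * nsq \<eta>)) \<longlonglongrightarrow> 0" by simp
    have "(\<lambda>n. ip (\<delta> (\<omega> n)) \<eta>) \<longlonglongrightarrow> 0"
    proof (rule Lim_null_comparison[OF always_eventually lim0], rule allI)
      fix n
      have "(cmod (ip (\<delta> (\<omega> n)) \<eta>))\<^sup>2 \<le> nsq (\<delta> (\<omega> n)) * nsq \<eta>"
        by (rule Cauchy_Schwarz[OF \<delta>_fin_l2[OF fin] \<eta>H(1)])
      also have "\<dots> \<le> e n * nsq \<eta>" using nsq_le nsq_nonneg by (intro mult_right_mono)
      finally show "norm (ip (\<delta> (\<omega> n)) \<eta>) \<le> sqrt (e n * nsq \<eta>)" by (rule real_le_rsqrt)
    qed
    then show ?thesis using LIMSEQ_unique[OF lim_g] unfolding g_def by blast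
  qed
qed

text \<open>The sum over the link that defines \<open>\<partial>\<partial>\<eta>(\<rho>)\<close> converges absolutely, so it may be split into the
sums over the components, which all vanish.\<close>

theorem bd_bd_zero:
  assumes rec: "\<And>\<rho> C. \<rho> \<in> \<Sigma> \<Longrightarrow> C \<in> graph_components (lk \<rho>) (lg \<rho>) \<Longrightarrow>
      recurrent_graph C (lg \<rho>)"
    and \<eta>: "\<eta> \<in> N"
  shows "bd (bd \<eta>) = 0"
proof (rule bd_eqI[OF cochains_zero])
  fix \<rho> assume \<rho>: "\<rho> \<in> \<Sigma>"
  let ?G = "graph_components (lk \<rho>) (lg \<rho>)"
  define g where "g v = complex_of_real (m (insert v \<rho>)) * \<theta> \<rho> (insert v \<rho>) * cnj (bd \<eta> (insert v \<rho>))" for v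
  have \<eta>H: "bd \<eta> \<in> H" using \<eta> N_iff by blast
  have part: "\<Union> ?G = lk \<rho>"
    by (rule graph_components_partition(1)) (rule link_graph_commute)
  have disj: "C \<inter> C' = {}" if "C \<in> ?G" "C' \<in> ?G" "C \<noteq> C'" for C C'
    by (rule graph_components_partition(2)[OF link_graph_commute that])
  have bij: "bij_betw snd (SIGMA C:?G. C) (lk \<rho>)"
    unfolding bij_betw_def
  proof
    show "inj_on snd (SIGMA C:?G. C)"
    proof (rule inj_onI)
      fix p q assume "p \<in> (SIGMA C:?G. C)" "q \<in> (SIGMA C:?G. C)" and eq: "snd p = snd q"
      then have "fst p \<in> ?G" "fst q \<in> ?G" "snd p \<in> fst p \<inter> fst q" by auto
      then have "fst p = fst q" using disj[of "fst p" "fst q"] by blast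
      with eq show "p = q" by (simp add: prod_eq_iff)
    qed
    have "snd ` (SIGMA C:?G. C) = \<Union> ?G" by force
    then show "snd ` (SIGMA C:?G. C) = lk \<rho>" unfolding part .
  qed
  have "g summable_on lk \<rho>"
    unfolding g_def by (rule abs_summable_summable[OF link_weighted_summable[OF \<rho> \<eta>H]])
  then have sum: "(\<lambda>p. g (snd p)) summable_on (SIGMA C:?G. C)"
    by (simp only: summable_on_reindex_bij_betw[OF bij])
  have "cnj (ip (bd \<eta>) (\<delta> (single \<rho>))) = complex_of_real (m \<rho>) * cnj (bd (bd \<eta>) \<rho>)"
    by (simp add: ip_\<delta>_single[OF \<rho>])
  also have "complex_of_real (m \<rho>) * cnj (bd (bd \<eta>) \<rho>) =
      cnj (\<Sum>\<^sub>\<infinity>\<tau>\<in>{\<tau> \<in> \<Sigma>. face \<rho> \<tau>}. complex_of_real (m \<tau>) * \<theta> \<rho> \<tau> * bd \<eta> \<tau>)"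
    using simplex_weight[OF \<rho>] by (simp add: boundary_def[of \<Sigma> m \<delta> "bd \<eta>"] \<rho>)
  also have "\<dots> = (\<Sum>\<^sub>\<infinity>\<tau>\<in>{\<tau> \<in> \<Sigma>. face \<rho> \<tau>}. cnj (complex_of_real (m \<tau>) * \<theta> \<rho> \<tau> * bd \<eta> \<tau>))"
    by (rule infsum_cnj[symmetric])
  also have "\<dots> = (\<Sum>\<^sub>\<infinity>\<tau>\<in>{\<tau> \<in> \<Sigma>. face \<rho> \<tau>}. complex_of_real (m \<tau>) * \<theta> \<rho> \<tau> * cnj (bd \<eta> \<tau>))"
  proof (rule infsum_cong)
    fix \<tau> assume "\<tau> \<in> {\<tau> \<in> \<Sigma>. face \<rho> \<tau>}"
    then have "\<theta> \<rho> \<tau> = 1 \<or> \<theta> \<rho> \<tau> = - 1" using \<theta>_cases \<rho> by blast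
    then show "cnj (complex_of_real (m \<tau>) * \<theta> \<rho> \<tau> * bd \<eta> \<tau>) =
        complex_of_real (m \<tau>) * \<theta> \<rho> \<tau> * cnj (bd \<eta> \<tau>)" by auto
  qed
  also have "\<dots> = (\<Sum>\<^sub>\<infinity>v\<in>lk \<rho>. g v)"
    unfolding g_def by (rule infsum_reindex_bij_betw[OF bij_link_cofaces, symmetric])
  also have "\<dots> = (\<Sum>\<^sub>\<infinity>p\<in>(SIGMA C:?G. C). g (snd p))"
    by (rule infsum_reindex_bij_betw[OF bij, symmetric])
  also have "\<dots> = (\<Sum>\<^sub>\<infinity>C\<in>?G. \<Sum>\<^sub>\<infinity>v\<in>C. g v)"
    using infsum_Sigma_banach[OF sum] by simp
  also have "\<dots> = (\<Sum>\<^sub>\<infinity>C\<in>?G. 0)"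
    unfolding g_def by (intro infsum_cong component_sum_zero[OF \<rho> _ rec[OF \<rho>] \<eta>])
  finally have "cnj (ip (bd \<eta>) (\<delta> (single \<rho>))) = 0" by simp
  then show "ip (bd \<eta>) (\<delta> (single \<rho>)) = complex_of_real (m \<rho>) * 0 \<rho>" by simp
qed

section \<open>Hodge decomposition and harmonic representatives\<close>

text \<open>For \<open>\<Delta>\<omega> = 0\<close> the adjoint relations give \<open>0 = \<langle>\<Delta>\<omega>, \<omega>\<rangle> = \<parallel>\<partial>\<omega>\<parallel>\<^sup>2 + \<parallel>\<delta>\<omega>\<parallel>\<^sup>2\<close>.\<close>

lemma kernel_laplacian:
  "kernel_on (dom_laplacian \<Sigma> m \<delta>) (laplacian \<Sigma> m \<delta>) = {\<omega> \<in> D. \<delta> \<omega> = 0} \<inter> {\<omega> \<in> N. bd \<omega> = 0}"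
proof (intro equalityI subsetI)
  fix \<omega> assume "\<omega> \<in> kernel_on (dom_laplacian \<Sigma> m \<delta>) (laplacian \<Sigma> m \<delta>)"
  then have dom: "\<omega> \<in> D" "\<omega> \<in> N" "\<delta> \<omega> \<in> N" "bd \<omega> \<in> D" and zero: "\<delta> (bd \<omega>) + bd (\<delta> \<omega>) = 0"
    by (auto simp: kernel_on_def dom_laplacian_def laplacian_def)
  have H: "\<omega> \<in> H" "\<delta> \<omega> \<in> H" "bd \<omega> \<in> H" "\<delta> (bd \<omega>) \<in> H" "bd (\<delta> \<omega>) \<in> H"
    using dom D_iff N_iff by blast+
  have "ip (\<delta> (bd \<omega>)) \<omega> = nsq (bd \<omega>)" using \<delta>_bd_adjoint[OF dom(4,2)] ip_self by simp
  moreover have "ip (bd (\<delta> \<omega>)) \<omega> = nsq (\<delta> \<omega>)"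
  proof -
    have "ip \<omega> (bd (\<delta> \<omega>)) = nsq (\<delta> \<omega>)" using \<delta>_bd_adjoint[OF dom(1,3)] ip_self by simp
    then have "cnj (ip \<omega> (bd (\<delta> \<omega>))) = nsq (\<delta> \<omega>)" by simp
    then show ?thesis unfolding cnj_ip .
  qed
  moreover have "ip (\<delta> (bd \<omega>)) \<omega> + ip (bd (\<delta> \<omega>)) \<omega> = 0"
    using ip_add_left[OF H(4,5,1)] zero by simp
  ultimately have "complex_of_real (nsq (bd \<omega>) + nsq (\<delta> \<omega>)) = 0" by simp
  then have "nsq (bd \<omega>) + nsq (\<delta> \<omega>) = 0" by (simp only: of_real_eq_0_iff)
  then have "nsq (bd \<omega>) = 0" "nsq (\<delta> \<omega>) = 0"
    using nsq_nonneg[of "bd \<omega>"] nsq_nonneg[of "\<delta> \<omega>"] by linarith+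
  then show "\<omega> \<in> {\<omega> \<in> D. \<delta> \<omega> = 0} \<inter> {\<omega> \<in> N. bd \<omega> = 0}"
    using nsq_eq_0 H dom by blast
next
  fix \<omega> assume "\<omega> \<in> {\<omega> \<in> D. \<delta> \<omega> = 0} \<inter> {\<omega> \<in> N. bd \<omega> = 0}"
  then have \<omega>: "\<omega> \<in> D" "\<delta> \<omega> = 0" "\<omega> \<in> N" "bd \<omega> = 0" by auto
  have "0 \<in> N" "0 \<in> D"
    by (rule linear_subspace_zero[OF linear_subspace_N], rule linear_subspace_zero[OF linear_subspace_D])
  then have "\<omega> \<in> dom_laplacian \<Sigma> m \<delta>"
    unfolding dom_laplacian_def mem_Collect_eq \<omega>(2,4) using \<omega> by blast
  moreover have "laplacian \<Sigma> m \<delta> \<omega> = 0"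
    unfolding laplacian_def \<omega>(2,4) \<delta>_zero bd_zero by simp
  ultimately show "\<omega> \<in> kernel_on (dom_laplacian \<Sigma> m \<delta>) (laplacian \<Sigma> m \<delta>)"
    unfolding kernel_on_def by blast
qed

lemma l2_dim_eq_ortho: "H_dim k = ortho (single ` (\<Sigma> - simplices_dim \<Sigma> k))"
proof (intro equalityI subsetI)
  fix f assume f: "f \<in> H_dim k"
  show "f \<in> ortho (single ` (\<Sigma> - simplices_dim \<Sigma> k))"
    using f by (intro orthoI) (auto simp: l2_dim_def ip_single_right)
next
  fix f assume f: "f \<in> ortho (single ` (\<Sigma> - simplices_dim \<Sigma> k))"
  have fH: "f \<in> H" using f ortho_subset by blast
  have "\<sigma> \<in> simplices_dim \<Sigma> k" if nz: "f \<sigma> \<noteq> 0" for \<sigma>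
  proof (rule ccontr)
    assume n: "\<sigma> \<notin> simplices_dim \<Sigma> k"
    have \<sigma>: "\<sigma> \<in> \<Sigma>" using nz l2_outside[OF fH] by blast
    have "ip f (single \<sigma>) = 0" using n \<sigma> by (intro orthoD[OF f]) blast
    then show False using nz simplex_weight[OF \<sigma>] by (simp add: ip_single_right[OF \<sigma>])
  qed
  then show "f \<in> H_dim k" using fH by (simp add: l2_dim_def)
qed

lemma closed_subspace_l2_dim: "closed_subspace \<Sigma> m (H_dim k)"
  unfolding l2_dim_eq_ortho by (rule closed_subspace_ortho) (auto intro: single_l2)

lemma face_dim:
  assumes "\<sigma> \<in> \<Sigma>" "face \<tau> \<sigma>" "\<tau> \<in> simplices_dim \<Sigma> (k - 1)"
  shows "\<sigma> \<in> simplices_dim \<Sigma> k"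
proof -
  obtain v where "v \<notin> \<tau>" "\<sigma> = insert v \<tau>" using assms(2) unfolding face_iff by blast
  moreover have "finite \<tau>" "int (card \<tau>) = k"
    using assms(3) simplex_finite by (auto simp: simplices_dim_def)
  ultimately show ?thesis using assms(1) by (simp add: simplices_dim_def)
qed

lemma \<delta>_l2_dim:
  assumes \<omega>: "\<omega> \<in> D" "\<omega> \<in> H_dim (k - 1)"
  shows "\<delta> \<omega> \<in> H_dim k"
proof -
  have H: "\<omega> \<in> H" "\<delta> \<omega> \<in> H" using \<omega> D_iff by blast+
  have "\<sigma> \<in> simplices_dim \<Sigma> k" if nz: "\<delta> \<omega> \<sigma> \<noteq> 0" for \<sigma>
  proof -
    have \<sigma>: "\<sigma> \<in> \<Sigma>" using nz l2_outside[OF H(2)] by blast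
    have "(\<Sum>\<tau> | \<tau> \<in> \<Sigma> \<and> face \<tau> \<sigma>. \<theta> \<tau> \<sigma> * \<omega> \<tau>) \<noteq> 0"
      using nz \<delta>_apply[OF l2_cochain[OF H(1)] \<sigma>] by simp
    then show ?thesis
    proof (rule sum.not_neutral_contains_not_neutral)
      fix \<tau> assume \<tau>: "\<tau> \<in> {\<tau>. \<tau> \<in> \<Sigma> \<and> face \<tau> \<sigma>}" "\<theta> \<tau> \<sigma> * \<omega> \<tau> \<noteq> 0"
      then have "\<omega> \<tau> \<noteq> 0" by simp
      then have "\<tau> \<in> simplices_dim \<Sigma> (k - 1)" using \<omega>(2) unfolding l2_dim_def by blast
      then show ?thesis using face_dim[OF \<sigma>] \<tau>(1) by blast
    qed
  qed
  then show ?thesis using H by (simp add: l2_dim_def)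
qed

text \<open>To see \<open>bd b = 0\<close> it suffices to test \<open>b\<close> against the coboundaries of single simplices. Those of
simplices of dimension \<open>k - 1\<close> are covered by the hypothesis, and all others are supported away
from the \<open>k\<close>-simplices.\<close>

lemma kernel_bd_if_ortho_lower_dim:
  assumes b: "b \<in> H_dim k" and orth: "b \<in> ortho (\<delta> ` (D \<inter> H_dim (k - 1)))"
  shows "b \<in> {\<eta> \<in> N. bd \<eta> = 0}"
proof -
  have bH: "b \<in> H" using orth ortho_subset by blast
  have "bd b = 0"
  proof (rule bd_eqI[OF cochains_zero])
    fix \<rho> assume \<rho>: "\<rho> \<in> \<Sigma>"
    have "ip b (\<delta> (single \<rho>)) = 0"
    proof (cases "\<rho> \<in> simplices_dim \<Sigma> (k - 1)")
      case True
      then have "single \<rho> \<in> H_dim (k - 1)"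
        using single_l2[OF \<rho>] by (auto simp: l2_dim_def indicator_def)
      then show ?thesis using D_fin[OF single_fin[OF \<rho>]] by (intro orthoD[OF orth]) blast
    next
      case False
      have "b \<sigma> = 0 \<or> \<delta> (single \<rho>) \<sigma> = 0" for \<sigma>
      proof (rule ccontr)
        assume nz: "\<not> (b \<sigma> = 0 \<or> \<delta> (single \<rho>) \<sigma> = 0)"
        then have f: "face \<rho> \<sigma>" using \<delta>_single[OF \<rho>, of \<sigma>] by presburger
        have "\<sigma> \<in> simplices_dim \<Sigma> k" using nz b unfolding l2_dim_def by blast
        moreover obtain v where "v \<notin> \<rho>" "\<sigma> = insert v \<rho>" using f unfolding face_iff by blast
        ultimately have "\<rho> \<in> simplices_dim \<Sigma> (k - 1)"
          using simplex_finite[OF \<rho>] \<rho> by (simp add: simplices_dim_def)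
        then show False using False by blast
      qed
      then have "complex_of_real (m \<sigma>) * b \<sigma> * cnj (\<delta> (single \<rho>) \<sigma>) = 0" for \<sigma>
        by (metis complex_cnj_zero mult_zero_left mult_zero_right)
      then show ?thesis unfolding l2_inner_def by (intro infsum_0)
    qed
    then show "ip b (\<delta> (single \<rho>)) = complex_of_real (m \<rho>) * 0 \<rho>" by simp
  qed
  then show ?thesis using bH l2_zero unfolding N_iff by simp
qed

text \<open>The hypothesis says that the range of \<open>\<partial>\<close> lies in \<open>ker \<partial>\<close>, which is the orthogonal complement of the
range of \<open>\<delta>\<close>.\<close>

theorem hodge_decomposition:
  assumes "\<And>\<eta>. \<eta> \<in> N \<Longrightarrow> bd (bd \<eta>) = 0"
  shows "orthogonal_sum3 \<Sigma> m H (kernel_on (dom_laplacian \<Sigma> m \<delta>) (laplacian \<Sigma> m \<delta>))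
    (cl (\<delta> ` D)) (cl (bd ` N))"
proof -
  have lin: "linear_subspace \<Sigma> m (\<delta> ` D)"
    by (rule linear_subspace_\<delta>_image[OF linear_subspace_D order_refl])
  have "bd \<eta> \<in> {\<eta> \<in> N. bd \<eta> = 0}" if \<eta>: "\<eta> \<in> N" for \<eta>
  proof -
    have "bd \<eta> \<in> H" using \<eta> N_iff by blast
    then show ?thesis using assms[OF \<eta>] l2_zero unfolding N_iff by simp
  qed
  then have "bd ` N \<subseteq> {\<eta> \<in> N. bd \<eta> = 0}" by blast
  then have "bd ` N \<subseteq> ortho (\<delta> ` D)" unfolding kernel_bd_eq_ortho .
  then have "\<delta> ` D \<subseteq> ortho (bd ` N)"
    by (rule ortho_commute[OF linear_subspace_subset[OF lin]])
  then have "orthogonal_sum3 \<Sigma> m H (ortho (\<delta> ` D) \<inter> ortho (bd ` N))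
      (cl (\<delta> ` D)) (cl (bd ` N))"
    by (rule orthogonal_sum3_complement[OF lin linear_subspace_range_bd])
  then show ?thesis
    unfolding kernel_laplacian kernel_bd_eq_ortho kernel_\<delta>_eq_ortho by (simp only: Int_commute)
qed

text \<open>The hypothesis puts \<open>\<delta> (D \<inter> \<ell>\<^sup>2(\<Sigma>_{k-1}))\<close> into \<open>ker \<delta>\<close>. Subtracting from a cocycle of
dimension \<open>k\<close> its projection onto the closure of this space leaves an element of \<open>ker \<partial>\<close> by \<open>kernel_bd_if_ortho_lower_dim\<close>, hence
a harmonic cochain.\<close>

theorem hodge_isomorphism:
  assumes bd_bd: "\<And>\<eta>. \<eta> \<in> N \<Longrightarrow> bd (bd \<eta>) = 0"
  shows "quotient_isomorphic \<Sigma> m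
     (kernel_on (D \<inter> H_dim k) \<delta>)
     (cl (\<delta> ` (D \<inter> H_dim (k - 1))))
     (kernel_on (dom_laplacian \<Sigma> m \<delta> \<inter> H_dim k) (laplacian \<Sigma> m \<delta>))"
proof -
  let ?V = "D \<inter> H_dim (k - 1)"
  let ?A = "ortho (bd ` N) \<inter> H_dim k" and ?R = "cl (\<delta> ` ?V)"
  let ?B = "(ortho (bd ` N) \<inter> ortho (\<delta> ` D)) \<inter> H_dim k"
  have A_eq: "kernel_on (D \<inter> H_dim k) \<delta> = ?A"
    unfolding kernel_\<delta>_eq_ortho[symmetric] kernel_on_def by blast
  have "kernel_on (dom_laplacian \<Sigma> m \<delta> \<inter> H_dim k) (laplacian \<Sigma> m \<delta>) =
      kernel_on (dom_laplacian \<Sigma> m \<delta>) (laplacian \<Sigma> m \<delta>) \<inter> H_dim k"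
    unfolding kernel_on_def by blast
  then have B_eq: "kernel_on (dom_laplacian \<Sigma> m \<delta> \<inter> H_dim k) (laplacian \<Sigma> m \<delta>) = ?B"
    unfolding kernel_laplacian kernel_bd_eq_ortho kernel_\<delta>_eq_ortho .
  have \<delta>DH: "\<delta> ` D \<subseteq> H" using D_iff by blast
  have bdH: "bd ` N \<subseteq> H" using N_iff by blast
  have linV: "linear_subspace \<Sigma> m ?V"
    using linear_subspace_D closed_subspace_imp_linear[OF closed_subspace_l2_dim]
    unfolding linear_subspace_def by blast
  have lin: "linear_subspace \<Sigma> m (\<delta> ` ?V)" by (rule linear_subspace_\<delta>_image[OF linV]) blast
  note \<delta>VH = linear_subspace_subset[OF lin]
  have A: "closed_subspace \<Sigma> m ?A" and B: "closed_subspace \<Sigma> m ?B"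
    by (intro closed_subspace_Int closed_subspace_ortho closed_subspace_l2_dim \<delta>DH bdH)+
  have R: "closed_subspace \<Sigma> m ?R" by (rule closed_subspace_closure[OF lin])
  have "\<delta> ` ?V \<subseteq> ?A"
  proof
    fix f assume "f \<in> \<delta> ` ?V"
    then obtain \<omega> where \<omega>: "\<omega> \<in> D" "\<omega> \<in> H_dim (k - 1)" "f = \<delta> \<omega>" by blast
    have "f \<in> ortho (bd ` N)"
    proof (rule orthoI)
      show "f \<in> H" using \<omega> D_iff by blast
      fix a assume "a \<in> bd ` N"
      then obtain \<eta> where \<eta>: "\<eta> \<in> N" "a = bd \<eta>" by blast
      have bdN: "bd \<eta> \<in> N" using \<eta>(1) bd_bd[OF \<eta>(1)] l2_zero by (simp add: N_iff)
      have "ip f a = ip \<omega> (bd (bd \<eta>))" unfolding \<omega>(3) \<eta>(2) by (rule \<delta>_bd_adjoint[OF \<omega>(1) bdN])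
      then show "ip f a = 0" using bd_bd[OF \<eta>(1)] by simp
    qed
    then show "f \<in> ?A" using \<delta>_l2_dim[OF \<omega>(1,2)] \<omega>(3) by blast
  qed
  then have RA: "?R \<subseteq> ?A"
    using l2_closure_mono[of "\<delta> ` ?V" ?A] A unfolding closed_subspace_def by blast
  have orthR: "ip b r = 0" if b: "b \<in> ortho (\<delta> ` ?V)" and r: "r \<in> ?R" for b r
    using ortho_closure_subset[OF \<delta>VH] b r orthoD by blast
  show ?thesis
    unfolding A_eq B_eq
  proof (rule quotient_isomorphic_orthogonal_complement[OF A R B RA])
    show "?B \<subseteq> ?A" by blast
    show "ip b r = 0" if b: "b \<in> ?B" and r: "r \<in> ?R" for b r
    proof (rule orthR[OF _ r])
      show "b \<in> ortho (\<delta> ` ?V)" using b unfolding ortho_def by blast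
    qed
    show "\<exists>b\<in>?B. \<exists>r\<in>?R. a = b + r" if a: "a \<in> ?A" for a
    proof -
      have aH: "a \<in> H" using a ortho_subset by blast
      obtain r where r: "r \<in> ?R" and orth: "\<forall>v\<in>?R. ip (a - r) v = 0"
        using projection_on_closure[OF lin aH] by blast
      have rA: "r \<in> ?A" using r RA by blast
      have bA: "a - r \<in> ?A" by (rule linear_subspace_diff[OF closed_subspace_imp_linear[OF A] a rA])
      have "a - r \<in> ortho (\<delta> ` ?V)"
        using orth subset_l2_closure[OF \<delta>VH] bA ortho_subset by (intro orthoI) blast+
      then have "a - r \<in> ortho (\<delta> ` D)"
        using kernel_bd_if_ortho_lower_dim[of "a - r" k] bA unfolding kernel_bd_eq_ortho by blast
      then have "a - r \<in> ?B" using bA by blast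
      moreover have "a = (a - r) + r" by simp
      ultimately show ?thesis using r by blast
    qed
  qed
qed

end

theorem corollary5p3:
  fixes X :: "'v set" and \<Sigma> :: "'v set set" and m :: "'v set \<Rightarrow> real"
    and \<delta> :: "('v set \<Rightarrow> complex) \<Rightarrow> ('v set \<Rightarrow> complex)"
  assumes "weighted_simplicial_complex X \<Sigma> m"
    and "coboundary_operator \<Sigma> \<delta>"
    and "\<And>\<rho> C. \<rho> \<in> \<Sigma> \<Longrightarrow> C \<in> graph_components (link X \<Sigma> \<rho>) (link_graph \<Sigma> m \<rho>) \<Longrightarrow>
           recurrent_graph C (link_graph \<Sigma> m \<rho>)"
  shows "orthogonal_sum3 \<Sigma> m (l2 \<Sigma> m)
           (kernel_on (dom_laplacian \<Sigma> m \<delta>) (laplacian \<Sigma> m \<delta>))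
           (l2_closure \<Sigma> m (\<delta> ` dom_coboundary_D \<Sigma> m \<delta>))
           (l2_closure \<Sigma> m (boundary \<Sigma> m \<delta> ` dom_boundary_N \<Sigma> m \<delta>))
         \<and> (\<forall>k::int. 0 \<le> k \<longrightarrow>
           quotient_isomorphic \<Sigma> m
             (kernel_on (dom_coboundary_D \<Sigma> m \<delta> \<inter> l2_dim \<Sigma> m k) \<delta>)
             (l2_closure \<Sigma> m (\<delta> ` (dom_coboundary_D \<Sigma> m \<delta> \<inter> l2_dim \<Sigma> m (k - 1))))
             (kernel_on (dom_laplacian \<Sigma> m \<delta> \<inter> l2_dim \<Sigma> m k) (laplacian \<Sigma> m \<delta>)))"
proof -
  interpret weighted_complex X \<Sigma> m \<delta>
    by (rule weighted_complex.intro[OF assms(1,2)])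
  have bd_bd: "boundary \<Sigma> m \<delta> (boundary \<Sigma> m \<delta> \<eta>) = 0" if "\<eta> \<in> dom_boundary_N \<Sigma> m \<delta>" for \<eta>
    by (rule bd_bd_zero[OF assms(3) that])
  show ?thesis
  proof (intro conjI allI impI)
    show "orthogonal_sum3 \<Sigma> m (l2 \<Sigma> m)
        (kernel_on (dom_laplacian \<Sigma> m \<delta>) (laplacian \<Sigma> m \<delta>))
        (l2_closure \<Sigma> m (\<delta> ` dom_coboundary_D \<Sigma> m \<delta>))
        (l2_closure \<Sigma> m (boundary \<Sigma> m \<delta> ` dom_boundary_N \<Sigma> m \<delta>))"
      by (rule hodge_decomposition[OF bd_bd])
    show "quotient_isomorphic \<Sigma> m
        (kernel_on (dom_coboundary_D \<Sigma> m \<delta> \<inter> l2_dim \<Sigma> m k) \<delta>)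
        (l2_closure \<Sigma> m (\<delta> ` (dom_coboundary_D \<Sigma> m \<delta> \<inter> l2_dim \<Sigma> m (k - 1))))
        (kernel_on (dom_laplacian \<Sigma> m \<delta> \<inter> l2_dim \<Sigma> m k) (laplacian \<Sigma> m \<delta>))" for k
      by (rule hodge_isomorphism[OF bd_bd])
  qed
qed

end
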